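(* Let $(M,g)$ be a simply connected Lorentzian surface, oriented in space and in time, with given spin structure, and let $H:M\to\mathbb{R}$ be a smooth function. The existence of a spinor field $\psi\in\Gamma(\Sigma M)$ solution of $$D\psi=iH\psi\qquad\text{with}\qquad|\psi|^2=-1$$ is equivalent to the existence of an isometric immersion of $M$ into $\mathbb{R}^{2,1}$ with mean curvature $H$, i.e. with mean curvature vector $HN$ for a normal vector field $N$ with $\langle N,N\rangle=-1$.
   Context: $\mathbb{R}^{2,1}$ is $\mathbb{R}^3$ with metric $-dx_0^2-dx_2^2+dx_3^2$ (the subspace $x_1=0$ of $\mathbb{R}^4$ with metric $-dx_0^2+dx_1^2-dx_2^2+dx_3^2$). $(e_2,e_3)$ denotes a positively oriented orthonormal frame of $TM$: $\langle e_2,e_2\rangle=-1$ with $e_2$ future-directed, $\langle e_3,e_3\rangle=1$. $\Sigma M$ is the (rank 2 complex) spinor bundle of $M$ with its spinorial connection $\nabla$, complex structure $i$, and ($\mathbb{C}$-linear) Clifford action satisfying $X\cdot X=-\langle X,X\rangle$; $e_2\cdot e_3$ acts as $+id$ on $\Sigma^+M$ and as $-id$ on $\Sigma^-M$, and in a spinorial frame over $(e_2,e_3)$ spinors have coordinates $\begin{pmatrix}a+ib\\c+id\end{pmatrix}\in\mathbb{C}^2$ (first component in $\Sigma^+M$, second in $\Sigma^-M$), the element $\pm e^u\in Spin(1,1)$ acting as $\pm e^u$ on the first and $\pm e^{-u}$ on the second component, $e_2\cdot$ acting by $\begin{pmatrix}0&1\\1&0\end{pmatrix}$ and $e_3\cdot$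 by $\begin{pmatrix}0&-1\\1&0\end{pmatrix}$. The Dirac operator is $D\psi=-e_2\cdot\nabla_{e_2}\psi+e_3\cdot\nabla_{e_3}\psi$. The scalar product on $\Sigma M$ is given in coordinates by $$\left\langle\begin{pmatrix}a+ib\\c+id\end{pmatrix},\begin{pmatrix}a'+ib'\\c'+id'\end{pmatrix}\right\rangle=-\frac{ac'+a'c+bd'+b'd}{2};$$ it satisfies $\langle X\cdot\psi,\psi'\rangle=\langle\psi,X\cdot\psi'\rangle$, and $|\psi|^2:=\langle\psi,\psi\rangle$. The mean curvature vector is half the trace of the second fundamental form. *)

theory Defs
  imports "HOL-Analysis.Analysis"
begin

section \<open>Smooth maps between normed spaces\<close>

primrec Ck_on :: "nat \<Rightarrow> 'a::real_normed_vector set \<Rightarrow> ('a \<Rightarrow> 'b::real_normed_vector) \<Rightarrow> bool" where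
  "Ck_on 0 = (\<lambda>S f. continuous_on S f)"
| "Ck_on (Suc k) = (\<lambda>S f. (\<forall>x\<in>S. f differentiable at x) \<and>
     (\<forall>v. Ck_on k S (\<lambda>x. frechet_derivative f (at x) v)))"

text \<open>Only used on open sets of finite-dimensional spaces, where it says that all iterated
  partial derivatives exist and are continuous.\<close>

definition smooth_on :: "'a::real_normed_vector set \<Rightarrow> ('a \<Rightarrow> 'b::real_normed_vector) \<Rightarrow> bool" where
  "smooth_on S f \<longleftrightarrow> (\<forall>k. Ck_on k S f)"


section \<open>Oriented smooth surfaces\<close>

text \<open>The surface is the whole type \<open>'m\<close>; a chart is a pair of its domain and the coordinate map
  (whose values outside the domain are irrelevant).\<close>

type_synonym 'm chart = "'m set \<times> ('m \<Rightarrow> real^2)"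

abbreviation dom_chart :: "'m chart \<Rightarrow> 'm set" where
  "dom_chart c \<equiv> fst c"

abbreviation chart_map :: "'m chart \<Rightarrow> 'm \<Rightarrow> real^2" where
  "chart_map c \<equiv> snd c"

definition chart_inv :: "'m chart \<Rightarrow> real^2 \<Rightarrow> 'm" where
  "chart_inv c = inv_into (dom_chart c) (chart_map c)"

definition is_chart :: "'m::topological_space chart \<Rightarrow> bool" where
  "is_chart c \<longleftrightarrow> open (dom_chart c) \<and> open (chart_map c ` dom_chart c) \<and>
     homeomorphism (dom_chart c) (chart_map c ` dom_chart c) (chart_map c) (chart_inv c)"

definition transition :: "'m chart \<Rightarrow> 'm chart \<Rightarrow> real^2 \<Rightarrow> real^2" where
  "transition c c' = chart_map c' \<circ> chart_inv c"

definition smooth_atlas :: "'m::topological_space chart set \<Rightarrow> bool" where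
  "smooth_atlas A \<longleftrightarrow> (\<forall>c\<in>A. is_chart c) \<and> (\<Union>c\<in>A. dom_chart c) = UNIV \<and>
     (\<forall>c\<in>A. \<forall>c'\<in>A. smooth_on (chart_map c ` (dom_chart c \<inter> dom_chart c')) (transition c c'))"

definition oriented_atlas :: "'m::topological_space chart set \<Rightarrow> bool" where
  "oriented_atlas A \<longleftrightarrow> smooth_atlas A \<and>
     (\<forall>c\<in>A. \<forall>c'\<in>A. \<forall>x \<in> chart_map c ` (dom_chart c \<inter> dom_chart c').
        0 < det (matrix (frechet_derivative (transition c c') (at x))))"

definition smooth_map :: "'m chart set \<Rightarrow> 'm set \<Rightarrow> ('m \<Rightarrow> 'b::real_normed_vector) \<Rightarrow> bool" where
  "smooth_map A U f \<longleftrightarrow> (\<forall>c\<in>A. smooth_on (chart_map c ` (U \<inter> dom_chart c)) (f \<circ> chart_inv c))"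


section \<open>Tangent vectors\<close>

text \<open>A tangent vector at \<open>p\<close> is the family of its coordinate vectors in all charts around \<open>p\<close>,
  related by the Jacobians of the transition maps. The value on every other argument is set to 0,
  so that equality of families is equality of tangent vectors.\<close>

type_synonym 'm tangent = "'m chart \<Rightarrow> real^2"

definition tangent_space :: "'m chart set \<Rightarrow> 'm \<Rightarrow> 'm tangent set" where
  "tangent_space A p = {v.
     (\<forall>c\<in>A. \<forall>c'\<in>A. p \<in> dom_chart c \<longrightarrow> p \<in> dom_chart c' \<longrightarrow>
        v c' = frechet_derivative (transition c c') (at (chart_map c p)) (v c)) \<and>
     (\<forall>c. c \<notin> A \<or> p \<notin> dom_chart c \<longrightarrow> v c = 0)}"

definition lincomb :: "real \<Rightarrow> 'm tangent \<Rightarrow> real \<Rightarrow> 'm tangent \<Rightarrow> 'm tangent" where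
  "lincomb a v b w = (\<lambda>c. a *\<^sub>R v c + b *\<^sub>R w c)"

text \<open>The vector field on \<open>dom_chart c\<close> with constant coordinates \<open>a\<close> in the chart \<open>c\<close>.\<close>

definition const_field :: "'m chart set \<Rightarrow> 'm chart \<Rightarrow> real^2 \<Rightarrow> 'm \<Rightarrow> 'm tangent" where
  "const_field A c a p = (\<lambda>c'. if c' \<in> A \<and> p \<in> dom_chart c'
     then frechet_derivative (transition c c') (at (chart_map c p)) a else 0)"

definition coord_field :: "'m chart set \<Rightarrow> 'm chart \<Rightarrow> 2 \<Rightarrow> 'm \<Rightarrow> 'm tangent" where
  "coord_field A c i = const_field A c (axis i 1)"

definition smooth_vector_field :: "'m chart set \<Rightarrow> 'm set \<Rightarrow> ('m \<Rightarrow> 'm tangent) \<Rightarrow> bool" where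
  "smooth_vector_field A U X \<longleftrightarrow> (\<forall>p\<in>U. X p \<in> tangent_space A p) \<and>
     (\<forall>c\<in>A. smooth_on (chart_map c ` (U \<inter> dom_chart c)) (\<lambda>x. X (chart_inv c x) c))"

definition chart_at :: "'m chart set \<Rightarrow> 'm \<Rightarrow> 'm chart" where
  "chart_at A p = (SOME c. c \<in> A \<and> p \<in> dom_chart c)"

text \<open>The differential of a vector-valued map; by the chain rule, the choice of the chart around
  \<open>p\<close> does not matter when \<open>f\<close> is smooth near \<open>p\<close> and \<open>v\<close> is tangent at \<open>p\<close>.\<close>

definition differential ::
    "'m chart set \<Rightarrow> ('m \<Rightarrow> 'b::real_normed_vector) \<Rightarrow> 'm \<Rightarrow> 'm tangent \<Rightarrow> 'b" where
  "differential A f p v = (let c = chart_at A p in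
     frechet_derivative (f \<circ> chart_inv c) (at (chart_map c p)) (v c))"


section \<open>Lorentzian metrics and the Levi-Civita connection\<close>

type_synonym 'm metric = "'m \<Rightarrow> 'm tangent \<Rightarrow> 'm tangent \<Rightarrow> real"

definition gram :: "'m chart set \<Rightarrow> 'm metric \<Rightarrow> 'm chart \<Rightarrow> real^2 \<Rightarrow> real^2^2" where
  "gram A g c x = (\<chi> i j. let p = chart_inv c x in g p (coord_field A c i p) (coord_field A c j p))"

text \<open>In dimension 2, a symmetric bilinear form has signature (1,1) iff it admits an orthonormal
  basis with one timelike and one spacelike vector.\<close>

definition lorentzian_metric :: "'m chart set \<Rightarrow> 'm metric \<Rightarrow> bool" where
  "lorentzian_metric A g \<longleftrightarrow>
     (\<forall>p. \<forall>u\<in>tangent_space A p. \<forall>v\<in>tangent_space A p. g p u v = g p v u) \<and>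
     (\<forall>p. \<forall>u\<in>tangent_space A p. \<forall>v\<in>tangent_space A p. \<forall>w\<in>tangent_space A p. \<forall>a b.
        g p (lincomb a u b v) w = a * g p u w + b * g p v w) \<and>
     (\<forall>p. \<exists>u\<in>tangent_space A p. \<exists>v\<in>tangent_space A p.
        g p u u = -1 \<and> g p v v = 1 \<and> g p u v = 0) \<and>
     (\<forall>c\<in>A. smooth_on (chart_map c ` dom_chart c) (gram A g c))"

definition partial :: "2 \<Rightarrow> (real^2 \<Rightarrow> real) \<Rightarrow> real^2 \<Rightarrow> real" where
  "partial i f x = frechet_derivative f (at x) (axis i 1)"

definition christoffel ::
    "'m chart set \<Rightarrow> 'm metric \<Rightarrow> 'm chart \<Rightarrow> real^2 \<Rightarrow> 2 \<Rightarrow> 2 \<Rightarrow> 2 \<Rightarrow> real" where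
  "christoffel A g c x k i j = (1/2) * (\<Sum>l\<in>UNIV. matrix_inv (gram A g c x) $ k $ l *
     (partial i (\<lambda>y. gram A g c y $ j $ l) x + partial j (\<lambda>y. gram A g c y $ i $ l) x
      - partial l (\<lambda>y. gram A g c y $ i $ j) x))"

text \<open>The Levi-Civita covariant derivative at \<open>p\<close> of the vector field \<open>Y\<close> in the direction \<open>v\<close>.\<close>

definition levi_civita ::
    "'m chart set \<Rightarrow> 'm metric \<Rightarrow> ('m \<Rightarrow> 'm tangent) \<Rightarrow> 'm \<Rightarrow> 'm tangent \<Rightarrow> 'm tangent" where
  "levi_civita A g Y p v = (\<lambda>c. if c \<in> A \<and> p \<in> dom_chart c then
     (let x = chart_map c p in
      frechet_derivative (\<lambda>y. Y (chart_inv c y) c) (at x) (v c) +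
      (\<chi> k. \<Sum>i\<in>UNIV. \<Sum>j\<in>UNIV. christoffel A g c x k i j * v c $ i * Y p c $ j))
     else 0)"

text \<open>The time-orientation is given by a timelike vector field \<open>T\<close> declared to be future-directed;
  a timelike \<open>v\<close> is then future-directed iff its product with \<open>T\<close> is negative.\<close>

definition time_orientation :: "'m chart set \<Rightarrow> 'm metric \<Rightarrow> ('m \<Rightarrow> 'm tangent) \<Rightarrow> bool" where
  "time_orientation A g T \<longleftrightarrow> smooth_vector_field A UNIV T \<and> (\<forall>p. g p (T p) (T p) < 0)"

definition oriented_frames ::
    "'m chart set \<Rightarrow> 'm metric \<Rightarrow> ('m \<Rightarrow> 'm tangent) \<Rightarrow> 'm \<Rightarrow> ('m tangent \<times> 'm tangent) set" where
  "oriented_frames A g T p = {(e2, e3). e2 \<in> tangent_space A p \<and> e3 \<in> tangent_space A p \<and>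
     g p e2 e2 = -1 \<and> g p e3 e3 = 1 \<and> g p e2 e3 = 0 \<and> g p e2 (T p) < 0 \<and>
     (\<forall>c\<in>A. p \<in> dom_chart c \<longrightarrow> 0 < e2 c $ 1 * e3 c $ 2 - e2 c $ 2 * e3 c $ 1)}"


section \<open>The spinor representation\<close>

definition gamma2 :: "complex^2^2" where
  "gamma2 = vector [vector [0, 1], vector [1, 0]]"

definition gamma3 :: "complex^2^2" where
  "gamma3 = vector [vector [0, -1], vector [1, 0]]"

text \<open>The element \<open>\<plusminus>e\<^sup>u\<close> of \<open>Spin(1,1)\<close> is represented by the nonzero real number \<open>a = \<plusminus>e\<^sup>u\<close>.\<close>

definition spin_rep :: "real \<Rightarrow> complex^2^2" where
  "spin_rep a = vector [vector [of_real a, 0], vector [0, of_real (inverse a)]]"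

text \<open>The right action on frames of the image of \<open>a = \<plusminus>e\<^sup>u\<close> under the double covering
  \<open>Spin(1,1) \<rightarrow> SO(1,1)\<close>; the coefficients are \<open>cosh (2u)\<close> and \<open>sinh (2u)\<close>. The covering is fixed by
  the requirement that Clifford multiplication be equivariant, see the lemma below.\<close>

definition frame_action :: "'m tangent \<times> 'm tangent \<Rightarrow> real \<Rightarrow> 'm tangent \<times> 'm tangent" where
  "frame_action e a = (let C = (a\<^sup>2 + inverse (a\<^sup>2)) / 2; S = (a\<^sup>2 - inverse (a\<^sup>2)) / 2 in
     (lincomb C (fst e) (- S) (snd e), lincomb (- S) (fst e) C (snd e)))"

lemma clifford_equivariant:
  assumes "a \<noteq> 0"
  defines "C \<equiv> (a\<^sup>2 + inverse (a\<^sup>2)) / 2" and "S \<equiv> (a\<^sup>2 - inverse (a\<^sup>2)) / 2"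
  shows "spin_rep a ** gamma2 ** spin_rep (inverse a) = C *\<^sub>R gamma2 + (- S) *\<^sub>R gamma3"
    and "spin_rep a ** gamma3 ** spin_rep (inverse a) = (- S) *\<^sub>R gamma2 + C *\<^sub>R gamma3"
  using assms(1)
  by (simp_all add: C_def S_def vec_eq_iff forall_2 matrix_matrix_mult_def sum_2 spin_rep_def
      gamma2_def gamma3_def complex_eq_iff power2_eq_square field_simps)

definition spinor_product :: "complex^2 \<Rightarrow> complex^2 \<Rightarrow> real" where
  "spinor_product \<psi> \<phi> = - (Re (\<psi>$1) * Re (\<phi>$2) + Re (\<phi>$1) * Re (\<psi>$2)
     + Im (\<psi>$1) * Im (\<phi>$2) + Im (\<phi>$1) * Im (\<psi>$2)) / 2"


section \<open>Spin structures, spinor fields and the Dirac operator\<close>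

text \<open>A section \<open>s\<close> over \<open>U\<close> of the bundle \<open>prj\<close> of spinorial frames; \<open>Lam\<close> maps a spinorial frame to
  the frame of the tangent plane lying below it. Since \<open>Lam\<close> is a covering, a continuous section
  over a smooth frame field is a smooth section.\<close>

definition spinorial_frame ::
    "'m::topological_space chart set \<Rightarrow> ('q::topological_space \<Rightarrow> 'm) \<Rightarrow>
     ('q \<Rightarrow> 'm tangent \<times> 'm tangent) \<Rightarrow> 'm set \<Rightarrow> ('m \<Rightarrow> 'q) \<Rightarrow> bool" where
  "spinorial_frame A prj Lam U s \<longleftrightarrow> open U \<and> continuous_on U s \<and> (\<forall>p\<in>U. prj (s p) = p) \<and>
     smooth_vector_field A U (\<lambda>p. fst (Lam (s p))) \<and>
     smooth_vector_field A U (\<lambda>p. snd (Lam (s p)))"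

text \<open>A spin structure: a principal \<open>Spin(1,1)\<close>-bundle \<open>prj\<close> with right action \<open>act\<close> and total space
  \<open>'q\<close>, and an equivariant bundle map \<open>Lam\<close> to the positively oriented orthonormal frames.
  Only nonzero reals are used as second argument of \<open>act\<close>.\<close>

definition spin_structure ::
    "'m::topological_space chart set \<Rightarrow> 'm metric \<Rightarrow> ('m \<Rightarrow> 'm tangent) \<Rightarrow>
     ('q::topological_space \<Rightarrow> 'm) \<Rightarrow> ('q \<Rightarrow> real \<Rightarrow> 'q) \<Rightarrow>
     ('q \<Rightarrow> 'm tangent \<times> 'm tangent) \<Rightarrow> bool" where
  "spin_structure A g T prj act Lam \<longleftrightarrow>
     continuous_on UNIV prj \<and>
     (\<forall>q. act q 1 = q) \<and>
     (\<forall>q a b. a \<noteq> 0 \<longrightarrow> b \<noteq> 0 \<longrightarrow> act (act q a) b = act q (a * b)) \<and>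
     (\<forall>q a. a \<noteq> 0 \<longrightarrow> prj (act q a) = prj q) \<and>
     (\<forall>q q'. prj q = prj q' \<longrightarrow> (\<exists>!a. a \<noteq> 0 \<and> q' = act q a)) \<and>
     (\<forall>q. Lam q \<in> oriented_frames A g T (prj q)) \<and>
     (\<forall>q a. a \<noteq> 0 \<longrightarrow> Lam (act q a) = frame_action (Lam q) a) \<and>
     (\<forall>p. \<exists>U s h. p \<in> U \<and> spinorial_frame A prj Lam U s \<and>
        homeomorphism (U \<times> (UNIV - {0})) (prj -` U) (\<lambda>(x, a). act (s x) a) h)"

text \<open>The spinor bundle is associated to the spin structure, so that a section is an equivariant map
  to the spinor representation; the value at \<open>q\<close> is the coordinate vector in the spinorial
  frame \<open>q\<close>.\<close>

definition spinor_field ::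
    "'m::topological_space chart set \<Rightarrow> ('q::topological_space \<Rightarrow> 'm) \<Rightarrow> ('q \<Rightarrow> real \<Rightarrow> 'q) \<Rightarrow>
     ('q \<Rightarrow> 'm tangent \<times> 'm tangent) \<Rightarrow> ('q \<Rightarrow> complex^2) \<Rightarrow> bool" where
  "spinor_field A prj act Lam \<psi> \<longleftrightarrow>
     (\<forall>q a. a \<noteq> 0 \<longrightarrow> \<psi> (act q a) = spin_rep (inverse a) *v \<psi> q) \<and>
     (\<forall>U s. spinorial_frame A prj Lam U s \<longrightarrow> smooth_map A U (\<psi> \<circ> s))"

text \<open>The spinorial connection in the spinorial frame \<open>s\<close> over \<open>(e\<^sub>2,e\<^sub>3)\<close>. In general it is
  \<open>X \<psi> + 1/2 (\<Sum>i<j. \<epsilon>\<^sub>i \<epsilon>\<^sub>j \<langle>\<nabla>\<^sub>X e\<^sub>i, e\<^sub>j\<rangle> e\<^sub>i \<cdot> e\<^sub>j \<cdot> \<psi>)\<close> with \<open>\<epsilon>\<^sub>i = \<langle>e\<^sub>i, e\<^sub>i\<rangle>\<close>, so the coefficient is \<open>-1/2\<close> here.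
  Equivalently, with \<open>\<omega> = \<langle>\<nabla>e\<^sub>2, e\<^sub>3\<rangle>\<close>, one has \<open>\<nabla>e\<^sub>2 = \<omega> e\<^sub>3\<close> and \<open>\<nabla>e\<^sub>3 = \<omega> e\<^sub>2\<close>, and \<open>- \<omega>/2 e\<^sub>2 \<cdot> e\<^sub>3\<close> is the
  multiple of \<open>e\<^sub>2 \<cdot> e\<^sub>3\<close> for which the connection is a derivation for Clifford multiplication:\<close>

lemma spin_connection_coefficient:
  "((- \<omega> / 2) *\<^sub>R (gamma2 ** gamma3)) ** gamma2 - gamma2 ** ((- \<omega> / 2) *\<^sub>R (gamma2 ** gamma3))
     = \<omega> *\<^sub>R gamma3"
  "((- \<omega> / 2) *\<^sub>R (gamma2 ** gamma3)) ** gamma3 - gamma3 ** ((- \<omega> / 2) *\<^sub>R (gamma2 ** gamma3))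
     = \<omega> *\<^sub>R gamma2"
  by (simp_all add: vec_eq_iff forall_2 matrix_matrix_mult_def sum_2
      gamma2_def gamma3_def complex_eq_iff)

definition spin_connection ::
    "'m chart set \<Rightarrow> 'm metric \<Rightarrow> ('q \<Rightarrow> 'm tangent \<times> 'm tangent) \<Rightarrow> ('m \<Rightarrow> 'q) \<Rightarrow>
     ('q \<Rightarrow> complex^2) \<Rightarrow> 'm \<Rightarrow> 'm tangent \<Rightarrow> complex^2" where
  "spin_connection A g Lam s \<psi> p v =
     (let e2 = (\<lambda>x. fst (Lam (s x))); e3 = (\<lambda>x. snd (Lam (s x))) in
      differential A (\<psi> \<circ> s) p v
      - ((1/2) * g p (levi_civita A g e2 p v) (e3 p)) *\<^sub>R (gamma2 *v (gamma3 *v \<psi> (s p))))"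

definition dirac ::
    "'m chart set \<Rightarrow> 'm metric \<Rightarrow> ('q \<Rightarrow> 'm tangent \<times> 'm tangent) \<Rightarrow> ('m \<Rightarrow> 'q) \<Rightarrow>
     ('q \<Rightarrow> complex^2) \<Rightarrow> 'm \<Rightarrow> complex^2" where
  "dirac A g Lam s \<psi> p =
     - (gamma2 *v spin_connection A g Lam s \<psi> p (fst (Lam (s p))))
     + gamma3 *v spin_connection A g Lam s \<psi> p (snd (Lam (s p)))"

definition dirac_equation ::
    "'m::topological_space chart set \<Rightarrow> 'm metric \<Rightarrow> ('q::topological_space \<Rightarrow> 'm) \<Rightarrow>
     ('q \<Rightarrow> 'm tangent \<times> 'm tangent) \<Rightarrow> ('m \<Rightarrow> real) \<Rightarrow> ('q \<Rightarrow> complex^2) \<Rightarrow> bool" where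
  "dirac_equation A g prj Lam H \<psi> \<longleftrightarrow>
     (\<forall>U s. spinorial_frame A prj Lam U s \<longrightarrow>
        (\<forall>p\<in>U. dirac A g Lam s \<psi> p = (\<i> * of_real (H p)) *s \<psi> (s p)))"


section \<open>Isometric immersions into the Lorentzian 3-space\<close>

text \<open>The components of \<open>real^3\<close> are the coordinates \<open>x\<^sub>0, x\<^sub>2, x\<^sub>3\<close> (in this order).\<close>

definition lor :: "real^3 \<Rightarrow> real^3 \<Rightarrow> real" where
  "lor x y = - (x$1 * y$1) - x$2 * y$2 + x$3 * y$3"

definition isometric_immersion :: "'m chart set \<Rightarrow> 'm metric \<Rightarrow> ('m \<Rightarrow> real^3) \<Rightarrow> bool" where
  "isometric_immersion A g F \<longleftrightarrow> smooth_map A UNIV F \<and>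
     (\<forall>p. inj_on (differential A F p) (tangent_space A p)) \<and>
     (\<forall>p. \<forall>v\<in>tangent_space A p. \<forall>w\<in>tangent_space A p.
        lor (differential A F p v) (differential A F p w) = g p v w)"

definition unit_normal_field :: "'m chart set \<Rightarrow> ('m \<Rightarrow> real^3) \<Rightarrow> ('m \<Rightarrow> real^3) \<Rightarrow> bool" where
  "unit_normal_field A F N \<longleftrightarrow> smooth_map A UNIV N \<and> (\<forall>p. lor (N p) (N p) = -1) \<and>
     (\<forall>p. \<forall>v\<in>tangent_space A p. lor (N p) (differential A F p v) = 0)"

text \<open>\<open>B(v,w) = \<partial>\<^sub>v (dF(W)) - dF(\<nabla>\<^sub>v W)\<close>, where \<open>W\<close> is an extension of \<open>w\<close> to a vector field near
  \<open>p\<close>; we take the one with constant coordinates in a chart.\<close>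

definition second_fundamental_form ::
    "'m chart set \<Rightarrow> 'm metric \<Rightarrow> ('m \<Rightarrow> real^3) \<Rightarrow> 'm \<Rightarrow> 'm tangent \<Rightarrow> 'm tangent \<Rightarrow> real^3" where
  "second_fundamental_form A g F p v w =
     (let c = chart_at A p; W = const_field A c (w c) in
      differential A (\<lambda>x. differential A F x (W x)) p v
      - differential A F p (levi_civita A g W p v))"

definition mean_curvature_vector ::
    "'m chart set \<Rightarrow> 'm metric \<Rightarrow> ('m \<Rightarrow> real^3) \<Rightarrow> 'm \<Rightarrow> real^3" where
  "mean_curvature_vector A g F p =
     (let c = chart_at A p in (1/2) *\<^sub>R (\<Sum>i\<in>UNIV. \<Sum>j\<in>UNIV.
        matrix_inv (gram A g c (chart_map c p)) $ i $ j *\<^sub>R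
        second_fundamental_form A g F p (coord_field A c i p) (coord_field A c j p)))"

end

theory Submission
  imports Defs
begin

text \<open>
  Let \<open>z, w\<close> be the components of \<open>\<psi>\<close> in a spinorial frame over \<open>(e\<^sub>2, e\<^sub>3)\<close>, put \<open>e\<^sub>\<plusminus> = e\<^sub>2 \<plusminus> e\<^sub>3\<close> and
  \<open>\<omega> = \<langle>\<nabla>e\<^sub>2, e\<^sub>3\<rangle>\<close>, so that \<open>\<nabla>e\<^sub>\<plusminus> = \<plusminus>\<omega> e\<^sub>\<plusminus>\<close>. In this null frame the equation \<open>D\<psi> = iH\<psi>\<close> reads
  \<open>e\<^sub>+ w = - \<omega>(e\<^sub>+)/2 w - iHz\<close> and \<open>e\<^sub>- z = \<omega>(e\<^sub>-)/2 z - iHw\<close>, and \<open>|\<psi>|\<^sup>2 = -1\<close> means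
  \<open>Re (z cnj w) = 1\<close>: the two complex numbers form a real matrix of determinant 1. Since
  \<open>SL(2,R)\<close> is the spin group of \<open>R\<^sup>2\<^sup>,\<^sup>1\<close>, such a pair, up to a common sign, is a frame of \<open>R\<^sup>2\<^sup>,\<^sup>1\<close>.
  Explicitly, with \<open>R\<^sup>2\<^sup>,\<^sup>1\<close> identified with \<open>C \<times> R\<close>, the vectors
  \<open>E\<^sub>+ = (z\<^sup>2, |z|\<^sup>2)\<close> and \<open>E\<^sub>- = (w\<^sup>2, -|w|\<^sup>2)\<close> are null with product \<open>-2\<close>, as \<open>e\<^sub>+\<close> and \<open>e\<^sub>-\<close> are, and
  \<open>N = (izw, Im (z cnj w))\<close> is their unit normal. A change of spinorial frame by \<open>a\<close> multiplies \<open>e\<^sub>+, E\<^sub>+\<close>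
  by \<open>a\<^sup>-\<^sup>2\<close> and \<open>e\<^sub>-, E\<^sub>-\<close> by \<open>a\<^sup>2\<close>, so the 1-form \<open>\<beta>\<close> sending \<open>e\<^sub>\<plusminus>\<close> to \<open>E\<^sub>\<plusminus>\<close> lives on the surface.

  The Dirac equation is equivalent to
  \<open>e\<^sub>+(E\<^sub>-) + \<omega>(e\<^sub>+) E\<^sub>- = -2HN = e\<^sub>-(E\<^sub>+) - \<omega>(e\<^sub>-) E\<^sub>+\<close> (\<open>dirac_iff_gauss\<close>).
  The equality of the outer terms says that \<open>\<beta>\<close> is closed (\<open>closed_form_criterion\<close>); a primitive \<open>F\<close>
  is an isometric immersion because \<open>\<beta>\<close> maps a null frame to a null frame with the same products, and
  the value \<open>-2HN\<close> of both terms, which are \<open>II(e\<^sub>+,e\<^sub>-)\<close> and \<open>II(e\<^sub>-,e\<^sub>+)\<close> by the Gauss formula, is the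
  statement about the mean curvature (\<open>mean_curvature_frame\<close>).

  Conversely, for an immersion \<open>F\<close> both terms are equal by symmetry of the second fundamental form, hence equal
  to \<open>-2HN\<close>. After a reflection of \<open>R\<^sup>2\<^sup>,\<^sup>1\<close> the frame \<open>(dF(e\<^sub>+), dF(e\<^sub>-), N)\<close> has the right orientation,
  and then it is the frame of a pair \<open>(z, w)\<close>, where \<open>z\<close> is a square root of the complex part of \<open>dF(e\<^sub>+)\<close> and
  \<open>w = (1 - i N\<^sub>3) / cnj z\<close> (\<open>frame_to_spinor\<close>).

  What is needed in the large is in both directions the same: the primitive \<open>F\<close> exists locally up to a
  constant, the root \<open>z\<close> exists locally up to a sign, and simple connectedness lets such local choices be
  continued to the whole surface (\<open>global_section\<close>).
\<close>

section \<open>Calculus of smooth maps\<close>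

lemma has_frechet_derivative:
  "f differentiable at x \<Longrightarrow> (f has_derivative frechet_derivative f (at x)) (at x)"
  by (simp add: frechet_derivative_works)

lemma Ck_on_cong:
  assumes "open S" "\<And>x. x \<in> S \<Longrightarrow> f x = g x" "Ck_on k S f"
  shows "Ck_on k S g"
  using assms(2,3)
proof (induction k arbitrary: f g)
  case 0
  then show ?case using continuous_on_cong[of S S f g] by simp
next
  case (Suc k)
  have d: "(g has_derivative frechet_derivative f (at x)) (at x)" if "x \<in> S" for x
    using has_derivative_transform_within_open[OF _ \<open>open S\<close> that, of f _ UNIV g] Suc.prems that
    by (auto simp: frechet_derivative_works)
  then have "frechet_derivative f (at x) v = frechet_derivative g (at x) v" if "x \<in> S" for x v
    using frechet_derivative_at[OF d[OF that]] by simp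
  then have "Ck_on k S (\<lambda>x. frechet_derivative g (at x) v)" for v
    using Suc.IH[of "\<lambda>x. frechet_derivative f (at x) v"] Suc.prems by simp
  then show ?case using d by (auto simp: differentiable_def)
qed

text \<open>Every closure property below is an induction on \<open>k\<close> that computes the derivative and quotes this rule, so that
  only the formula for the derivative differs from case to case.\<close>

lemma Ck_on_Suc_intro:
  assumes S: "open S" and f: "\<And>x. x \<in> S \<Longrightarrow> (f has_derivative f' x) (at x)"
    and C: "\<And>v. Ck_on k S (\<lambda>x. f' x v)"
  shows "Ck_on (Suc k) S f"
proof -
  have *: "f' x v = frechet_derivative f (at x) v" if "x \<in> S" for x v
    using frechet_derivative_at[OF f[OF that]] by simp
  have "Ck_on k S (\<lambda>x. frechet_derivative f (at x) v)" for v
    by (rule Ck_on_cong[OF S * C])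
  then show ?thesis using f by (auto simp: differentiable_def)
qed

lemma Ck_on_Suc_D: "Ck_on (Suc k) S f \<Longrightarrow> Ck_on k S f"
proof (induction k arbitrary: f)
  case 0
  then show ?case
    by (auto intro!: continuous_at_imp_continuous_on differentiable_imp_continuous_within)
qed auto

lemma Ck_on_subset: "Ck_on k S f \<Longrightarrow> T \<subseteq> S \<Longrightarrow> Ck_on k T f"
  by (induction k arbitrary: f) (auto intro: continuous_on_subset)

lemma Ck_on_local:
  assumes "\<And>x. x \<in> S \<Longrightarrow> \<exists>T. open T \<and> x \<in> T \<and> Ck_on k (S \<inter> T) f"
  shows "Ck_on k S f"
  using assms
proof (induction k arbitrary: f)
  case 0
  show ?case
    unfolding Ck_on.simps continuous_on_eq_continuous_within
  proof
    fix x assume x: "x \<in> S"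
    then obtain T where "open T" "x \<in> T" "continuous_on (S \<inter> T) f" using 0 by (auto simp: )
    then show "continuous (at x within S) f"
      using x at_within_nhd[of x T S "S \<inter> T"] by (auto simp: continuous_on_eq_continuous_within)
  qed
next
  case (Suc k)
  have d: "f differentiable at x" if "x \<in> S" for x
    using Suc.prems[OF that] that by auto
  have "Ck_on k S (\<lambda>x. frechet_derivative f (at x) v)" for v
  proof (rule Suc.IH)
    fix x assume "x \<in> S"
    then obtain T where "open T" "x \<in> T" "Ck_on (Suc k) (S \<inter> T) f" using Suc.prems by blast
    then show "\<exists>T. open T \<and> x \<in> T \<and> Ck_on k (S \<inter> T) (\<lambda>x. frechet_derivative f (at x) v)" by auto
  qed
  with d show ?case by simp
qed

lemma Ck_on_const: "open S \<Longrightarrow> Ck_on k S (\<lambda>x. c)"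
proof (induction k arbitrary: c)
  case (Suc k)
  show ?case by (rule Ck_on_Suc_intro[OF Suc.prems, where f'="\<lambda>x v. 0"]) (use Suc in auto)
qed simp

lemma Ck_on_bounded_linear:
  assumes "open S" "bounded_linear h" "Ck_on k S f"
  shows "Ck_on k S (\<lambda>x. h (f x))"
  using assms(3)
proof (induction k arbitrary: f)
  case 0
  then show ?case using assms(2) by (simp add: bounded_linear.continuous_on)
next
  case (Suc k)
  show ?case
    by (rule Ck_on_Suc_intro[OF \<open>open S\<close>, where f'="\<lambda>x v. h (frechet_derivative f (at x) v)"])
      (use Suc in \<open>auto intro!: bounded_linear.has_derivative[OF assms(2)] has_frechet_derivative\<close>)
qed

lemma Ck_on_add:
  assumes "open S" "Ck_on k S f" "Ck_on k S g"
  shows "Ck_on k S (\<lambda>x. f x + g x)"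
  using assms(2,3)
proof (induction k arbitrary: f g)
  case 0
  then show ?case by (simp add: continuous_on_add)
next
  case (Suc k)
  show ?case
    by (rule Ck_on_Suc_intro[OF \<open>open S\<close>, where
          f'="\<lambda>x v. frechet_derivative f (at x) v + frechet_derivative g (at x) v"])
      (use Suc in \<open>auto intro!: has_derivative_add simp: has_frechet_derivative\<close>)
qed

lemma Ck_on_bilinear:
  assumes "open S" "bounded_bilinear prd" "Ck_on k S f" "Ck_on k S g"
  shows "Ck_on k S (\<lambda>x. prd (f x) (g x))"
  using assms(3,4)
proof (induction k arbitrary: f g)
  case 0
  then show ?case using assms(2) by (simp add: bounded_bilinear.continuous_on)
next
  case (Suc k)
  show ?case
    by (rule Ck_on_Suc_intro[OF \<open>open S\<close>, where
          f'="\<lambda>x v. prd (f x) (frechet_derivative g (at x) v) + prd (frechet_derivative f (at x) v) (g x)"])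
      (use Suc.prems in \<open>auto intro!: bounded_bilinear.FDERIV[OF assms(2)] Ck_on_add[OF assms(1)] Suc.IH
         has_frechet_derivative simp: Ck_on_Suc_D[simplified]\<close>)
qed

lemma Ck_on_inverse:
  fixes f :: "'a::real_normed_vector \<Rightarrow> 'b::real_normed_field"
  assumes "open S" "Ck_on k S f" "\<And>x. x \<in> S \<Longrightarrow> f x \<noteq> 0"
  shows "Ck_on k S (\<lambda>x. inverse (f x))"
  using assms(2)
proof (induction k)
  case 0
  then show ?case using assms(3) by (simp add: continuous_on_inverse)
next
  case (Suc k)
  have i: "Ck_on k S (\<lambda>x. inverse (f x))" using Suc Ck_on_Suc_D by blast
  have "Ck_on k S (\<lambda>x. (- 1) * (inverse (f x) * frechet_derivative f (at x) v * inverse (f x)))" for v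
    by (intro Ck_on_bilinear[OF assms(1) bounded_bilinear_mult] i Ck_on_const[OF assms(1)])
      (use Suc.prems in auto)
  then show ?case
    by (intro Ck_on_Suc_intro[OF \<open>open S\<close>, where
          f'="\<lambda>x v. - (inverse (f x) * frechet_derivative f (at x) v * inverse (f x))"])
      (use Suc.prems assms(3) in \<open>auto intro!: has_derivative_inverse simp: has_frechet_derivative\<close>)
qed

text \<open>The derivative \<open>f' / (2 sqrt f)\<close> contains the function itself, which is already known to be of class \<open>C\<^sup>k\<close> in the
  induction step.\<close>

lemma Ck_on_sqrt:
  fixes f :: "'a::real_normed_vector \<Rightarrow> real"
  assumes "open S" "Ck_on k S f" "\<And>x. x \<in> S \<Longrightarrow> f x > 0"
  shows "Ck_on k S (\<lambda>x. sqrt (f x))"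
  using assms(2)
proof (induction k)
  case 0
  then show ?case by (simp add: continuous_on_real_sqrt)
next
  case (Suc k)
  have i: "Ck_on k S (\<lambda>x. sqrt (f x))" using Suc Ck_on_Suc_D by blast
  have "Ck_on k S (\<lambda>x. frechet_derivative f (at x) v * (inverse (sqrt (f x)) * (1/2)))" for v
    by (intro Ck_on_bilinear[OF assms(1) bounded_bilinear_mult] i Ck_on_const[OF assms(1)] Ck_on_inverse[OF assms(1)])
      (use Suc.prems assms(3) in \<open>force+\<close>)
  then show ?case
    by (intro Ck_on_Suc_intro[OF \<open>open S\<close>, where
          f'="\<lambda>x v. frechet_derivative f (at x) v * (inverse (sqrt (f x)) * (1/2))"])
      (use Suc.prems assms(3) in \<open>auto intro!: derivative_eq_intros has_frechet_derivative simp: field_simps\<close>)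
qed

lemma smooth_onD: "smooth_on S f \<Longrightarrow> Ck_on k S f"
  by (simp add: smooth_on_def)

lemma smooth_on_continuous: "smooth_on S f \<Longrightarrow> continuous_on S f"
  using smooth_onD[of S f 0] by simp

lemma smooth_on_has_derivative:
  "smooth_on S f \<Longrightarrow> x \<in> S \<Longrightarrow> (f has_derivative frechet_derivative f (at x)) (at x)"
  using smooth_onD[of S f "Suc 0"] by (simp add: has_frechet_derivative)

lemma smooth_on_differentiable: "smooth_on S f \<Longrightarrow> x \<in> S \<Longrightarrow> f differentiable at x"
  using smooth_onD[of S f "Suc 0"] by simp

lemma smooth_on_frechet_derivative: "smooth_on S f \<Longrightarrow> smooth_on S (\<lambda>x. frechet_derivative f (at x) v)"
  unfolding smooth_on_def
proof
  fix k
  assume "\<forall>k. Ck_on k S f"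
  then have "Ck_on (Suc k) S f" by blast
  then show "Ck_on k S (\<lambda>x. frechet_derivative f (at x) v)" by simp
qed

lemma smooth_onI:
  assumes "open S" "\<And>x. x \<in> S \<Longrightarrow> (f has_derivative f' x) (at x)"
    and "\<And>v. smooth_on S (\<lambda>x. f' x v)"
  shows "smooth_on S f"
  unfolding smooth_on_def
proof
  fix k
  have "Ck_on (Suc k) S f" using assms by (intro Ck_on_Suc_intro) (auto simp: smooth_on_def)
  then show "Ck_on k S f" by (rule Ck_on_Suc_D)
qed

lemma smooth_on_cong:
  "open S \<Longrightarrow> (\<And>x. x \<in> S \<Longrightarrow> f x = g x) \<Longrightarrow> smooth_on S f \<Longrightarrow> smooth_on S g"
  unfolding smooth_on_def using Ck_on_cong by blast

lemma smooth_on_subset: "smooth_on S f \<Longrightarrow> T \<subseteq> S \<Longrightarrow> smooth_on T f"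
  unfolding smooth_on_def using Ck_on_subset by blast

lemma smooth_on_local:
  assumes "\<And>x. x \<in> S \<Longrightarrow> \<exists>T. open T \<and> x \<in> T \<and> smooth_on (S \<inter> T) f"
  shows "smooth_on S f"
  unfolding smooth_on_def
  by (intro allI Ck_on_local) (use assms in \<open>meson smooth_onD\<close>)

lemma smooth_on_const: "open S \<Longrightarrow> smooth_on S (\<lambda>x. c)"
  by (simp add: smooth_on_def Ck_on_const)

lemma smooth_on_bounded_linear: "open S \<Longrightarrow> bounded_linear h \<Longrightarrow> smooth_on S f \<Longrightarrow> smooth_on S (\<lambda>x. h (f x))"
  by (simp add: smooth_on_def Ck_on_bounded_linear)

lemma smooth_on_add: "open S \<Longrightarrow> smooth_on S f \<Longrightarrow> smooth_on S g \<Longrightarrow> smooth_on S (\<lambda>x. f x + g x)"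
  by (simp add: smooth_on_def Ck_on_add)

lemma smooth_on_mult:
  fixes f g :: "'a::real_normed_vector \<Rightarrow> 'b::real_normed_algebra"
  shows "open S \<Longrightarrow> smooth_on S f \<Longrightarrow> smooth_on S g \<Longrightarrow> smooth_on S (\<lambda>x. f x * g x)"
  by (simp add: smooth_on_def Ck_on_bilinear[OF _ bounded_bilinear_mult])

lemma smooth_on_scaleR: "open S \<Longrightarrow> smooth_on S f \<Longrightarrow> smooth_on S g \<Longrightarrow> smooth_on S (\<lambda>x. f x *\<^sub>R g x)"
  by (simp add: smooth_on_def Ck_on_bilinear[OF _ bounded_bilinear_scaleR])

lemma smooth_on_minus: "open S \<Longrightarrow> smooth_on S f \<Longrightarrow> smooth_on S (\<lambda>x. - f x)"
  using smooth_on_bounded_linear[OF _ bounded_linear_minus[OF bounded_linear_ident]] .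

lemma smooth_on_diff: "open S \<Longrightarrow> smooth_on S f \<Longrightarrow> smooth_on S g \<Longrightarrow> smooth_on S (\<lambda>x. f x - g x)"
  using smooth_on_add[of S f "\<lambda>x. - g x"] smooth_on_minus[of S g] by simp

lemma smooth_on_inverse:
  fixes f :: "'a::real_normed_vector \<Rightarrow> 'b::real_normed_field"
  shows "open S \<Longrightarrow> smooth_on S f \<Longrightarrow> (\<And>x. x \<in> S \<Longrightarrow> f x \<noteq> 0) \<Longrightarrow> smooth_on S (\<lambda>x. inverse (f x))"
  by (simp add: smooth_on_def Ck_on_inverse)

lemma smooth_on_divide:
  fixes f g :: "'a::real_normed_vector \<Rightarrow> 'b::real_normed_field"
  shows "open S \<Longrightarrow> smooth_on S f \<Longrightarrow> smooth_on S g \<Longrightarrow> (\<And>x. x \<in> S \<Longrightarrow> g x \<noteq> 0) \<Longrightarrow> smooth_on S (\<lambda>x. f x / g x)"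
  by (simp add: divide_inverse smooth_on_mult smooth_on_inverse)

lemma smooth_on_sqrt:
  fixes f :: "'a::real_normed_vector \<Rightarrow> real"
  shows "open S \<Longrightarrow> smooth_on S f \<Longrightarrow> (\<And>x. x \<in> S \<Longrightarrow> f x > 0) \<Longrightarrow> smooth_on S (\<lambda>x. sqrt (f x))"
  by (simp add: smooth_on_def Ck_on_sqrt)

lemma smooth_on_sum:
  assumes "open S" "\<And>i. i \<in> I \<Longrightarrow> smooth_on S (f i)"
  shows "smooth_on S (\<lambda>x. \<Sum>i\<in>I. f i x)"
  using assms(2) by (induction I rule: infinite_finite_induct)
    (auto intro!: smooth_on_const smooth_on_add assms(1))

lemma smooth_on_vec_nth: "open S \<Longrightarrow> smooth_on S f \<Longrightarrow> smooth_on S (\<lambda>x. f x $ i)"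
  by (rule smooth_on_bounded_linear[OF _ bounded_linear_vec_nth])

text \<open>A vector is the sum of the images of its components under the coordinate embeddings, which are linear.\<close>

lemma smooth_on_vec:
  fixes f :: "'a::real_normed_vector \<Rightarrow> ('b::real_normed_vector)^'n"
  assumes S: "open S" and f: "\<And>i. smooth_on S (\<lambda>x. f x $ i)"
  shows "smooth_on S f"
proof -
  have bl: "bounded_linear (\<lambda>y::'b. (\<chi> j. if j = i then y else 0) :: 'b^'n)" for i
  proof (rule bounded_linear_intro[where K = 1])
    show "norm ((\<chi> j. if j = i then y else 0) :: 'b^'n) \<le> norm y * 1" for y
    proof -
      have "norm ((\<chi> j. if j = i then y else 0) :: 'b^'n) \<le> (\<Sum>j\<in>UNIV. norm (if j = i then y else 0))"
        unfolding norm_vec_def by (rule order_trans[OF L2_set_le_sum]) auto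
      also have "\<dots> = norm y" by (simp add: if_distrib[of norm] cong: if_cong)
      finally show ?thesis by simp
    qed
  qed (auto simp: vec_eq_iff)
  have "smooth_on S (\<lambda>x. \<Sum>i\<in>UNIV. (\<chi> j. if j = i then f x $ i else 0))"
    by (intro smooth_on_sum[OF S] smooth_on_bounded_linear[OF S bl] f)
  moreover have "(\<Sum>i\<in>UNIV. (\<chi> j. if j = i then f x $ i else 0)) = f x" for x
    by (simp add: vec_eq_iff)
  ultimately show ?thesis by simp
qed

section \<open>Symmetry of second derivatives and the Poincare lemma\<close>

lemma DERIV_along_line:
  fixes f :: "'a::real_normed_vector \<Rightarrow> real"
  assumes "f differentiable at (p + s *\<^sub>R v)"
  shows "((\<lambda>s. f (p + s *\<^sub>R v)) has_real_derivative frechet_derivative f (at (p + s *\<^sub>R v)) v) (at s)"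
proof -
  have "((\<lambda>s. p + s *\<^sub>R v) has_derivative (\<lambda>h. h *\<^sub>R v)) (at s)"
    by (auto intro!: derivative_eq_intros)
  from has_derivative_compose[OF this has_frechet_derivative[OF assms]]
  have "((\<lambda>s. f (p + s *\<^sub>R v)) has_derivative (\<lambda>h. frechet_derivative f (at (p + s *\<^sub>R v)) (h *\<^sub>R v))) (at s)" .
  moreover have "frechet_derivative f (at (p + s *\<^sub>R v)) (h *\<^sub>R v) = frechet_derivative f (at (p + s *\<^sub>R v)) v * h" for h
    using linear_scale[OF linear_frechet_derivative[OF assms]] by simp
  ultimately show ?thesis by (simp add: has_field_derivative_def)
qed

text \<open>The second difference is symmetric in \<open>v\<close> and \<open>w\<close>, while the mean value theorem, applied first along \<open>v\<close>
  and then along \<open>w\<close>, expresses it through only one of the two mixed derivatives.\<close>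

lemma second_difference_mvt:
  fixes f :: "'a::real_normed_vector \<Rightarrow> real"
  assumes f: "Ck_on 2 S f" and t: "t > 0"
    and S: "\<And>a b. 0 \<le> a \<Longrightarrow> a \<le> t \<Longrightarrow> 0 \<le> b \<Longrightarrow> b \<le> t \<Longrightarrow> x + a *\<^sub>R v + b *\<^sub>R w \<in> S"
  shows "\<exists>a\<in>{0..t}. \<exists>b\<in>{0..t}. f (x + t *\<^sub>R v + t *\<^sub>R w) - f (x + t *\<^sub>R v) - f (x + t *\<^sub>R w) + f x =
    t * t * frechet_derivative (\<lambda>y. frechet_derivative f (at y) v) (at (x + a *\<^sub>R v + b *\<^sub>R w)) w"
proof -
  have d: "f differentiable at y" "(\<lambda>y. frechet_derivative f (at y) v) differentiable at y" if "y \<in> S" for y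
    using f that by (auto simp: numeral_2_eq_2)
  have 1: "((\<lambda>s. f (x + s *\<^sub>R v + b *\<^sub>R w)) has_real_derivative
      frechet_derivative f (at (x + s *\<^sub>R v + b *\<^sub>R w)) v) (at s)"
    if "0 \<le> s" "s \<le> t" "0 \<le> b" "b \<le> t" for s b
    using DERIV_along_line[of f "x + b *\<^sub>R w" s v] d(1)[OF S[of s b]] that by (simp add: algebra_simps)
  have "\<exists>z>0. z < t \<and> (f (x + t *\<^sub>R v + t *\<^sub>R w) - f (x + t *\<^sub>R v + 0 *\<^sub>R w)) - (f (x + 0 *\<^sub>R v + t *\<^sub>R w) - f (x + 0 *\<^sub>R v + 0 *\<^sub>R w)) =
     (t - 0) * (frechet_derivative f (at (x + z *\<^sub>R v + t *\<^sub>R w)) v - frechet_derivative f (at (x + z *\<^sub>R v + 0 *\<^sub>R w)) v)"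
    using t by (intro MVT2[OF t, of "\<lambda>s. f (x + s *\<^sub>R v + t *\<^sub>R w) - f (x + s *\<^sub>R v + 0 *\<^sub>R w)"] DERIV_diff 1) auto
  then obtain a where a: "0 < a" "a < t" and ea: "f (x + t *\<^sub>R v + t *\<^sub>R w) - f (x + t *\<^sub>R v) - f (x + t *\<^sub>R w) + f x =
     t * (frechet_derivative f (at (x + a *\<^sub>R v + t *\<^sub>R w)) v - frechet_derivative f (at (x + a *\<^sub>R v)) v)"
    by (auto simp: algebra_simps)
  have "\<exists>z>0. z < t \<and> frechet_derivative f (at (x + a *\<^sub>R v + t *\<^sub>R w)) v - frechet_derivative f (at (x + a *\<^sub>R v + 0 *\<^sub>R w)) v
     = (t - 0) * frechet_derivative (\<lambda>y. frechet_derivative f (at y) v) (at (x + a *\<^sub>R v + z *\<^sub>R w)) w"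
    by (intro MVT2[OF t, of "\<lambda>s. frechet_derivative f (at (x + a *\<^sub>R v + s *\<^sub>R w)) v"] 
        DERIV_along_line[where f="\<lambda>y. frechet_derivative f (at y) v"] d(2) S) (use a in auto)
  then obtain b where "0 < b" "b < t" "frechet_derivative f (at (x + a *\<^sub>R v + t *\<^sub>R w)) v - frechet_derivative f (at (x + a *\<^sub>R v)) v
     = t * frechet_derivative (\<lambda>y. frechet_derivative f (at y) v) (at (x + a *\<^sub>R v + b *\<^sub>R w)) w"
    by auto
  with a ea show ?thesis by (intro bexI[of _ a] bexI[of _ b]) auto
qed

text \<open>The same second difference divided by \<open>t\<^sup>2\<close> tends to both mixed derivatives as \<open>t\<close> tends to 0.\<close>

lemma second_derivative_symmetric_real:
  fixes f :: "'a::real_normed_vector \<Rightarrow> real"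
  assumes S: "open S" "x \<in> S" and f: "Ck_on 2 S f"
  shows "frechet_derivative (\<lambda>y. frechet_derivative f (at y) v) (at x) w =
    frechet_derivative (\<lambda>y. frechet_derivative f (at y) w) (at x) v"
proof -
  define D where "D = (\<lambda>v w y. frechet_derivative (\<lambda>y. frechet_derivative f (at y) v) (at y) w)"
  have cont: "continuous_on S (D v w)" for v w
    using f by (simp add: D_def numeral_2_eq_2)
  have "\<bar>D v w x - D w v x\<bar> \<le> e + e" if "e > 0" for e
  proof -
    have ev: "\<forall>\<^sub>F y in nhds x. y \<in> S \<and> dist (D v w y) (D v w x) < e \<and> dist (D w v y) (D w v x) < e"
      using S cont[of v w] cont[of w v] that
      by (auto intro!: eventually_conj tendstoD eventually_nhds_in_open
          simp: continuous_on_eq_continuous_at isCont_def tendsto_at_iff_tendsto_nhds)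
    have lim: "((\<lambda>t. x + fst t *\<^sub>R v + snd t *\<^sub>R w) \<longlongrightarrow> x) (nhds (0, 0))"
    proof -
      have "isCont (\<lambda>t. x + fst t *\<^sub>R v + snd t *\<^sub>R w) (0, 0)" by (intro continuous_intros)
      then show ?thesis
        using tendsto_at_iff_tendsto_nhds[of "\<lambda>t. x + fst t *\<^sub>R v + snd t *\<^sub>R w" "(0, 0)"] by (simp add: isCont_def)
    qed
    obtain d where d: "d > 0" "\<And>t. dist t (0,0) < d \<Longrightarrow> (\<lambda>y. y \<in> S \<and> dist (D v w y) (D v w x) < e \<and> dist (D w v y) (D w v x) < e)
       (x + fst t *\<^sub>R v + snd t *\<^sub>R w)"
      using eventually_compose_filterlim[OF ev lim] unfolding eventually_nhds_metric by auto
    define t where "t = d / 4"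
    have t: "t > 0" using d by (simp add: t_def)
    have good: "x + a *\<^sub>R v + b *\<^sub>R w \<in> S" "dist (D v w (x + a *\<^sub>R v + b *\<^sub>R w)) (D v w x) < e"
      "dist (D w v (x + a *\<^sub>R v + b *\<^sub>R w)) (D w v x) < e"
      if "0 \<le> a" "a \<le> t" "0 \<le> b" "b \<le> t" for a b
    proof -
      have "dist (a, b) (0::real, 0::real) \<le> \<bar>a\<bar> + \<bar>b\<bar>"
        by (simp add: dist_prod_def real_sqrt_ge_0_iff sqrt_sum_squares_le_sum_abs)
      also have "\<dots> < d" using that d t by (simp add: t_def)
      finally show "x + a *\<^sub>R v + b *\<^sub>R w \<in> S" "dist (D v w (x + a *\<^sub>R v + b *\<^sub>R w)) (D v w x) < e"
      "dist (D w v (x + a *\<^sub>R v + b *\<^sub>R w)) (D w v x) < e" using d(2)[of "(a,b)"] by auto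
    qed
    obtain a b where ab: "a\<in>{0..t}" "b\<in>{0..t}" and 1: "f (x + t *\<^sub>R v + t *\<^sub>R w) - f (x + t *\<^sub>R v) - f (x + t *\<^sub>R w) + f x
        = t * t * D v w (x + a *\<^sub>R v + b *\<^sub>R w)"
      using second_difference_mvt[OF f t, of x v w] good(1) unfolding D_def by blast
    have "x + a *\<^sub>R w + b *\<^sub>R v \<in> S" if "0 \<le> a" "a \<le> t" "0 \<le> b" "b \<le> t" for a b
      using good(1)[of b a] that by (simp add: algebra_simps)
    then obtain a' b' where ab': "a'\<in>{0..t}" "b'\<in>{0..t}" and 2: "f (x + t *\<^sub>R w + t *\<^sub>R v) - f (x + t *\<^sub>R w) - f (x + t *\<^sub>R v) + f x
        = t * t * D w v (x + a' *\<^sub>R w + b' *\<^sub>R v)"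
      using second_difference_mvt[OF f t, of x w v] unfolding D_def by blast
    have "t * t * D v w (x + a *\<^sub>R v + b *\<^sub>R w) = t * t * D w v (x + b' *\<^sub>R v + a' *\<^sub>R w)"
      using 1 2 by (simp add: algebra_simps)
    then have "D v w (x + a *\<^sub>R v + b *\<^sub>R w) = D w v (x + b' *\<^sub>R v + a' *\<^sub>R w)" using t by simp
    moreover have "dist (D v w (x + a *\<^sub>R v + b *\<^sub>R w)) (D v w x) < e"
      "dist (D w v (x + b' *\<^sub>R v + a' *\<^sub>R w)) (D w v x) < e" using good(2)[of a b] good(3)[of b' a'] ab ab' by auto
    ultimately show ?thesis by (simp add: dist_real_def)
  qed
  then have "\<bar>D v w x - D w v x\<bar> \<le> e" if "e > 0" for e
    using that by (metis field_sum_of_halves half_gt_zero)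
  then show ?thesis
    unfolding D_def by (metis abs_le_zero_iff eq_iff_diff_eq_0 field_le_epsilon add_0)
qed

lemma frechet_derivative_vec_nth:
  fixes f :: "'a::real_normed_vector \<Rightarrow> 'b::real_normed_vector^'n"
  assumes "f differentiable at x"
  shows "frechet_derivative (\<lambda>y. f y $ i) (at x) v = frechet_derivative f (at x) v $ i"
  using frechet_derivative_at[OF bounded_linear.has_derivative[OF bounded_linear_vec_nth has_frechet_derivative[OF assms]], of i]
  by metis

lemma second_derivative_symmetric:
  fixes f :: "'a::real_normed_vector \<Rightarrow> real^'n"
  assumes S: "open S" "x \<in> S" and f: "Ck_on 2 S f"
  shows "frechet_derivative (\<lambda>y. frechet_derivative f (at y) v) (at x) w =
    frechet_derivative (\<lambda>y. frechet_derivative f (at y) w) (at x) v"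
proof -
  have df: "f differentiable at y" "(\<lambda>y. frechet_derivative f (at y) v) differentiable at y" if "y \<in> S" for y v
    using f that by (auto simp: numeral_2_eq_2)
  have *: "frechet_derivative (\<lambda>y. frechet_derivative (\<lambda>y. f y $ i) (at y) v) (at x) w =
      frechet_derivative (\<lambda>y. frechet_derivative f (at y) v) (at x) w $ i" for v w i
  proof -
    have "frechet_derivative (\<lambda>y. frechet_derivative f (at y) v $ i) (at x)
      = frechet_derivative (\<lambda>y. frechet_derivative (\<lambda>y. f y $ i) (at y) v) (at x)"
      by (rule frechet_derivative_transform_within_open[OF _ S])
        (use df S in \<open>auto simp: frechet_derivative_vec_nth
          intro: differentiableI[OF bounded_linear.has_derivative[OF bounded_linear_vec_nth has_frechet_derivative[OF df(2)]]]\<close>)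
    then show ?thesis using frechet_derivative_vec_nth[OF df(2)[OF S(2)]] by metis
  qed
  have "Ck_on 2 S (\<lambda>y. f y $ i)" for i
    by (rule Ck_on_bounded_linear[OF S(1) bounded_linear_vec_nth f])
  then show ?thesis
    using second_derivative_symmetric_real[OF S, of "\<lambda>y. f y $ i" v w for i] by (simp add: vec_eq_iff *)
qed

text \<open>The primitive is the integral of \<open>\<beta>\<close> along rays, \<open>F y = \<integral>\<^sub>0\<^sup>1 \<beta>(x\<^sub>0 + t y)(y) dt\<close>. Differentiation under the integral
  gives an integrand that, thanks to the symmetry of \<open>D\<beta>\<close>, is the derivative of \<open>t \<beta>(x\<^sub>0 + t y)(v)\<close>.\<close>

theorem poincare_lemma_ball:
  fixes \<beta> :: "'a::euclidean_space \<Rightarrow> 'a \<Rightarrow> 'b::euclidean_space"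
  assumes lin: "\<And>x. x \<in> ball x0 r \<Longrightarrow> linear (\<beta> x)"
    and C1: "\<And>v. Ck_on 1 (ball x0 r) (\<lambda>x. \<beta> x v)"
    and sym: "\<And>x v w. x \<in> ball x0 r \<Longrightarrow>
      frechet_derivative (\<lambda>y. \<beta> y v) (at x) w = frechet_derivative (\<lambda>y. \<beta> y w) (at x) v"
  shows "\<exists>f. \<forall>x\<in>ball x0 r. (f has_derivative \<beta> x) (at x)"
proof -
  define U where "U = ball (0::'a) r"
  have U: "open U" "convex U" by (simp_all add: U_def)
  have inB: "x0 + t *\<^sub>R y \<in> ball x0 r" if "y \<in> U" "t \<in> {0..1}" for y t
  proof -
    have "t * norm y \<le> 1 * norm y" by (rule mult_right_mono) (use that in auto)
    then show ?thesis using that by (auto simp: U_def dist_norm)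
  qed
  define D where "D = (\<lambda>x v w. frechet_derivative (\<lambda>y. \<beta> y v) (at x) w)"
  have dB: "((\<lambda>y. \<beta> y v) has_derivative D x v) (at x)" if "x \<in> ball x0 r" for x v
    using C1[of v] that unfolding D_def by (auto intro!: has_frechet_derivative)
  have Dlin: "linear (D x v)" if "x \<in> ball x0 r" for x v
    using dB[OF that] has_derivative_linear by blast
  have cB: "continuous_on (ball x0 r) (\<lambda>x. \<beta> x v)" for v
    using Ck_on_Suc_D[of 0 _ "\<lambda>x. \<beta> x v"] C1[of v] by simp
  have cD: "continuous_on (ball x0 r) (\<lambda>x. D x v w)" for v w
    using C1[of v] by (simp add: D_def)
  define L where "L = (\<lambda>y t v. \<Sum>i\<in>Basis. (v \<bullet> i) *\<^sub>R \<beta> (x0 + t *\<^sub>R y) i + (y \<bullet> i) *\<^sub>R (t *\<^sub>R D (x0 + t *\<^sub>R y) i v))"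
  have Llin: "bounded_linear (L y t)" if "y \<in> U" "t \<in> {0..1}" for y t
  proof -
    have "linear (L y t)"
      using linear_add[OF Dlin[OF inB[OF that]]] linear_scale[OF Dlin[OF inB[OF that]]]
      unfolding L_def
      by (intro linearI) (auto simp: inner_add_left algebra_simps sum.distrib scaleR_sum_right)
    then show ?thesis by (simp add: linear_conv_bounded_linear)
  qed
  have L_eq: "L y t v = \<beta> (x0 + t *\<^sub>R y) v + t *\<^sub>R D (x0 + t *\<^sub>R y) v y" if "y \<in> U" "t \<in> {0..1}" for y t v
  proof -
    have "(\<Sum>i\<in>Basis. (v \<bullet> i) *\<^sub>R \<beta> (x0 + t *\<^sub>R y) i) = \<beta> (x0 + t *\<^sub>R y) (\<Sum>i\<in>Basis. (v \<bullet> i) *\<^sub>R i)"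
      using lin[OF inB[OF that]] by (simp add: linear_sum linear_scale)
    moreover have "(\<Sum>i\<in>Basis. (y \<bullet> i) *\<^sub>R (t *\<^sub>R D (x0 + t *\<^sub>R y) i v)) = t *\<^sub>R D (x0 + t *\<^sub>R y) v (\<Sum>i\<in>Basis. (y \<bullet> i) *\<^sub>R i)"
      using Dlin[OF inB[OF that]] sym[OF inB[OF that]]
      by (simp add: linear_sum linear_scale scaleR_sum_right D_def mult.commute)
    ultimately show ?thesis by (simp add: L_def sum.distrib euclidean_representation)
  qed
  define F where "F = (\<lambda>y. integral (cbox 0 (1::real)) (\<lambda>t. \<beta> (x0 + t *\<^sub>R y) y))"
  have g_der: "((\<lambda>y. \<beta> (x0 + t *\<^sub>R y) y) has_derivative L y t) (at y within U)" if y: "y \<in> U" and t: "t \<in> {0..1}" for y t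
  proof -
    have "((\<lambda>y. x0 + t *\<^sub>R y) has_derivative (\<lambda>h. t *\<^sub>R h)) (at y)"
      by (auto intro!: derivative_eq_intros)
    from has_derivative_compose[OF this dB[OF inB[OF that]]]
    have *: "((\<lambda>y. \<beta> (x0 + t *\<^sub>R y) i) has_derivative (\<lambda>h. D (x0 + t *\<^sub>R y) i (t *\<^sub>R h))) (at y)" for i .
    have "((\<lambda>y. \<Sum>i\<in>Basis. (y \<bullet> i) *\<^sub>R \<beta> (x0 + t *\<^sub>R y) i) has_derivative
        (\<lambda>h. \<Sum>i\<in>Basis. (y \<bullet> i) *\<^sub>R D (x0 + t *\<^sub>R y) i (t *\<^sub>R h) + (h \<bullet> i) *\<^sub>R \<beta> (x0 + t *\<^sub>R y) i)) (at y)"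
      by (intro has_derivative_sum has_derivative_scaleR has_derivative_inner_left has_derivative_ident *)
    also have "(\<lambda>h. \<Sum>i\<in>Basis. (y \<bullet> i) *\<^sub>R D (x0 + t *\<^sub>R y) i (t *\<^sub>R h) + (h \<bullet> i) *\<^sub>R \<beta> (x0 + t *\<^sub>R y) i) = L y t"
      using linear_scale[OF Dlin[OF inB[OF that]]] by (simp add: L_def add.commute)
    finally have 1: "((\<lambda>y. \<Sum>i\<in>Basis. (y \<bullet> i) *\<^sub>R \<beta> (x0 + t *\<^sub>R y) i) has_derivative L y t) (at y within U)"
      by (rule has_derivative_at_withinI)
    have 2: "\<beta> (x0 + t *\<^sub>R y) y = (\<Sum>i\<in>Basis. (y \<bullet> i) *\<^sub>R \<beta> (x0 + t *\<^sub>R y) i)" if "y \<in> U" for y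
    proof -
      have "(\<Sum>i\<in>Basis. (y \<bullet> i) *\<^sub>R \<beta> (x0 + t *\<^sub>R y) i) = \<beta> (x0 + t *\<^sub>R y) (\<Sum>i\<in>Basis. (y \<bullet> i) *\<^sub>R i)"
        using lin[OF inB[OF that t]] by (simp add: linear_sum linear_scale)
      then show ?thesis by (simp add: euclidean_representation)
    qed
    show ?thesis by (rule has_derivative_transform[OF y 2 1])
  qed
  have line_cont: "continuous_on (U \<times> {0..1}) (\<lambda>(y, t). h (x0 + t *\<^sub>R y))" if "continuous_on (ball x0 r) h"
    for h :: "'a \<Rightarrow> 'b"
    unfolding case_prod_unfold
    by (rule continuous_on_compose2[OF that]) (use inB in \<open>auto intro!: continuous_intros\<close>)
  have L_cont: "continuous_on (U \<times> {0..1}) (\<lambda>(y, t). L y t v)" for v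
    using line_cont[OF cB] line_cont[OF cD] unfolding L_def case_prod_unfold
    by (intro continuous_intros) auto
  have Fder: "(F has_derivative integral (cbox 0 1) (\<lambda>t. Blinfun (L y t))) (at y within U)" if "y \<in> U" for y
    unfolding F_def
  proof (rule leibniz_rule[OF _ _ _ that U(2)])
    show "((\<lambda>y. \<beta> (x0 + t *\<^sub>R y) y) has_derivative blinfun_apply (Blinfun (L y t))) (at y within U)"
      if "y \<in> U" "t \<in> cbox 0 1" for y t
      using g_der[of y t] Llin[of y t] that by (simp add: bounded_linear_Blinfun_apply)
    show "(\<lambda>t. \<beta> (x0 + t *\<^sub>R y) y) integrable_on cbox 0 1" if "y \<in> U" for y
      by (intro integrable_continuous continuous_on_compose2[OF cB])
        (use inB that in \<open>auto intro!: continuous_intros\<close>)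
    show "continuous_on (U \<times> cbox 0 1) (\<lambda>(y, t). Blinfun (L y t))"
    proof (rule continuous_on_blinfun_componentwise)
      fix i :: 'a
      show "continuous_on (U \<times> cbox 0 1) (\<lambda>p. blinfun_apply (case p of (y, t) \<Rightarrow> Blinfun (L y t)) i)"
        by (rule continuous_on_eq[of _ "\<lambda>(y, t). L y t i"])
          (use L_cont[of i] Llin in \<open>auto simp: bounded_linear_Blinfun_apply\<close>)
    qed
  qed
  have "blinfun_apply (integral (cbox 0 1) (\<lambda>t. Blinfun (L y t))) v = \<beta> (x0 + y) v" if y: "y \<in> U" for y v
  proof -
    have "continuous_on (cbox 0 1) (\<lambda>t. Blinfun (L y t))"
    proof (rule continuous_on_blinfun_componentwise)
      fix i :: 'a
      have "continuous_on {0..1} (\<lambda>t. L y t i)"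
        using continuous_on_compose2[OF L_cont[of i]
            continuous_on_Pair[OF continuous_on_const[of _ y] continuous_on_id[of "{0..1}"]]] y by auto
      then show "continuous_on (cbox 0 1) (\<lambda>t. blinfun_apply (Blinfun (L y t)) i)"
        unfolding cbox_interval by (rule continuous_on_eq) (use y Llin in \<open>auto simp: bounded_linear_Blinfun_apply\<close>)
    qed
    then have "(\<lambda>t. Blinfun (L y t)) integrable_on cbox 0 1" by (rule integrable_continuous)
    then have "blinfun_apply (integral (cbox 0 1) (\<lambda>t. Blinfun (L y t))) v = integral (cbox 0 1) (\<lambda>t. blinfun_apply (Blinfun (L y t)) v)"
      by (rule blinfun_apply_integral)
    also have "\<dots> = integral {0..1} (\<lambda>t. L y t v)"
      by (auto intro!: integral_cong simp: bounded_linear_Blinfun_apply Llin y)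
    also have "((\<lambda>t. L y t v) has_integral (1 *\<^sub>R \<beta> (x0 + 1 *\<^sub>R y) v - 0 *\<^sub>R \<beta> (x0 + 0 *\<^sub>R y) v)) {0..1}"
    proof (rule fundamental_theorem_of_calculus)
      fix t :: real assume t: "t \<in> {0..1}"
      have "((\<lambda>t. x0 + t *\<^sub>R y) has_derivative (\<lambda>h. h *\<^sub>R y)) (at t)"
        by (auto intro!: derivative_eq_intros)
      from has_derivative_compose[OF this dB[OF inB[OF y t]]]
      have "((\<lambda>t. \<beta> (x0 + t *\<^sub>R y) v) has_derivative (\<lambda>h. D (x0 + t *\<^sub>R y) v (h *\<^sub>R y))) (at t)" .
      then have "((\<lambda>t. \<beta> (x0 + t *\<^sub>R y) v) has_vector_derivative D (x0 + t *\<^sub>R y) v y) (at t)"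
        using linear_scale[OF Dlin[OF inB[OF y t]]] by (simp add: has_vector_derivative_def)
      from has_vector_derivative_scaleR[OF DERIV_ident this]
      have "((\<lambda>t. t *\<^sub>R \<beta> (x0 + t *\<^sub>R y) v) has_vector_derivative L y t v) (at t)"
        by (simp add: L_eq[OF y t] add.commute)
      then show "((\<lambda>t. t *\<^sub>R \<beta> (x0 + t *\<^sub>R y) v) has_vector_derivative L y t v) (at t within {0..1})"
        by (rule has_vector_derivative_at_within)
    qed simp
    then have "integral {0..1} (\<lambda>t. L y t v) = \<beta> (x0 + y) v" by (simp add: integral_unique)
    finally show ?thesis .
  qed
  then have bl: "blinfun_apply (integral (cbox 0 1) (\<lambda>t. Blinfun (L y t))) = \<beta> (x0 + y)" if "y \<in> U" for y
    using that by blast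
  have F': "(F has_derivative \<beta> (x0 + y)) (at y)" if "y \<in> U" for y
    using Fder[OF that] by (simp only: bl[OF that] at_within_open[OF that U(1)])
  have "((\<lambda>x. F (x - x0)) has_derivative \<beta> x) (at x)" if "x \<in> ball x0 r" for x
  proof -
    have "((\<lambda>x. x - x0) has_derivative (\<lambda>h. h)) (at x)" by (auto intro!: derivative_eq_intros)
    moreover have "x - x0 \<in> U" using that by (simp add: U_def dist_norm norm_minus_commute)
    ultimately show ?thesis using has_derivative_compose[of "\<lambda>x. x - x0" "\<lambda>h. h" x UNIV F "\<beta> x"] F'[of "x - x0"] by simp
  qed
  then show ?thesis by blast
qed

section \<open>Global sections over simply connected spaces\<close>

lemma eventually_nhds_compose_within:
  assumes "continuous_on K h" "k \<in> K" "eventually P (nhds (h k))"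
  shows "eventually (\<lambda>j. j \<in> K \<longrightarrow> P (h j)) (nhds k)"
proof -
  have "(h \<longlongrightarrow> h k) (at k within K)" using assms by (simp add: continuous_on_def)
  from eventually_compose_filterlim[OF assms(3) this]
  have "eventually (\<lambda>j. j \<noteq> k \<longrightarrow> j \<in> K \<longrightarrow> P (h j)) (nhds k)" by (simp add: eventually_at_filter)
  then show ?thesis
    by (rule eventually_mono) (use eventually_nhds_x_imp_x[OF assms(3)] in auto)
qed

text \<open>Constant loops are homotopic, and the homotopy traces out a path. Stated for arbitrary topological spaces,
  since the surface is only a topological space with charts.\<close>

lemma simply_connected_joinable:
  fixes x y :: "'x::topological_space"
  assumes "simply_connected (UNIV :: 'x set)"
  shows "\<exists>c. path c \<and> c 0 = x \<and> c 1 = y"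
proof -
  have "homotopic_loops UNIV (\<lambda>_. x) (\<lambda>_. y)"
    using assms by (simp add: simply_connected_def pathstart_def pathfinish_def path_def)
  then obtain h where h: "continuous_on ({0..1::real} \<times> {0..1}) h" "\<And>t. t \<in> {0..1::real} \<Longrightarrow> h (0, t) = x"
    "\<And>t. t \<in> {0..1::real} \<Longrightarrow> h (1, t) = y"
    unfolding homotopic_loops by auto
  have "path (\<lambda>t. h (t, 0))"
    unfolding path_def by (rule continuous_on_compose2[OF h(1)]) (auto intro!: continuous_intros)
  with h show ?thesis by (intro exI[of _ "\<lambda>t. h (t, 0)"]) auto
qed

text \<open>A set of local sections with values in \<open>'v\<close> that behaves like the sections of a covering space: two sections
  that agree at a point agree near it, two that differ at a point differ near it, and every point has a
  neighbourhood over which a section exists through each value that some section takes there. Instances are the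
  primitives of a closed form and the square roots of a function.\<close>

locale local_system =
  fixes S :: "('x::topological_space set \<times> ('x \<Rightarrow> 'v)) set"
  assumes open_domain: "(U, f) \<in> S \<Longrightarrow> open U"
    and agree: "(U, f) \<in> S \<Longrightarrow> (V, g) \<in> S \<Longrightarrow> x \<in> U \<Longrightarrow> x \<in> V \<Longrightarrow>
      \<forall>\<^sub>F y in nhds x. (f y = g y) = (f x = g x)"
    and extend: "\<exists>U. open U \<and> x \<in> U \<and> (\<forall>y\<in>U. \<forall>V g. (V, g) \<in> S \<longrightarrow> y \<in> V \<longrightarrow> (\<exists>f. (U, f) \<in> S \<and> f y = g y))"
begin

definition fibre :: "'x \<Rightarrow> 'v set" where
  "fibre x = {v. \<exists>U f. (U, f) \<in> S \<and> x \<in> U \<and> f x = v}"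

definition lift :: "('c::topological_space \<Rightarrow> 'x) \<Rightarrow> 'c set \<Rightarrow> ('c \<Rightarrow> 'v) \<Rightarrow> bool" where
  "lift h K \<phi> \<longleftrightarrow> (\<forall>k\<in>K. \<exists>U f. (U, f) \<in> S \<and> h k \<in> U \<and> (\<forall>\<^sub>F j in nhds k. j \<in> K \<longrightarrow> \<phi> j = f (h j)))"

definition liftable :: "('c::topological_space \<Rightarrow> 'x) \<Rightarrow> 'c set \<Rightarrow> bool" where
  "liftable h K \<longleftrightarrow> (\<forall>k\<in>K. \<forall>v\<in>fibre (h k). \<exists>\<phi>. lift h K \<phi> \<and> \<phi> k = v)"

lemma liftE:
  assumes "lift h K \<phi>" "k \<in> K"
  obtains U f where "(U, f) \<in> S" "h k \<in> U" "\<forall>\<^sub>F j in nhds k. j \<in> K \<longrightarrow> \<phi> j = f (h j)" "\<phi> k = f (h k)"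
  using assms eventually_nhds_x_imp_x unfolding lift_def by blast

lemma lift_in_fibre: "lift h K \<phi> \<Longrightarrow> k \<in> K \<Longrightarrow> \<phi> k \<in> fibre (h k)"
  unfolding fibre_def by (erule (1) liftE, rule CollectI, intro exI conjI) (assumption+, simp)

lemma lift_cong: "lift h K \<phi> \<Longrightarrow> (\<And>k. k \<in> K \<Longrightarrow> h k = h' k) \<Longrightarrow> lift h' K \<phi>"
  by (auto simp: lift_def elim!: eventually_mono)

lemma lift_compose:
  assumes "lift h K \<phi>" "continuous_on J u" "u ` J \<subseteq> K"
  shows "lift (\<lambda>j. h (u j)) J (\<lambda>j. \<phi> (u j))"
  unfolding lift_def
proof
  fix j assume j: "j \<in> J"
  then have "u j \<in> K" using assms(3) by auto
  with assms(1) obtain U f where f: "(U, f) \<in> S" "h (u j) \<in> U" "\<forall>\<^sub>F k in nhds (u j). k \<in> K \<longrightarrow> \<phi> k = f (h k)"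
    by (rule liftE)
  have "\<forall>\<^sub>F i in nhds j. i \<in> J \<longrightarrow> \<phi> (u i) = f (h (u i))"
    using eventually_nhds_compose_within[OF assms(2) j f(3)] by (rule eventually_mono) (use assms(3) in auto)
  with f show "\<exists>U f. (U, f) \<in> S \<and> h (u j) \<in> U \<and> (\<forall>\<^sub>F i in nhds j. i \<in> J \<longrightarrow> \<phi> (u i) = f (h (u i)))" by blast
qed

lemma lift_subset: "lift h K \<phi> \<Longrightarrow> J \<subseteq> K \<Longrightarrow> lift h J \<phi>"
  using lift_compose[of h K \<phi> J "\<lambda>j. j"] by simp

lemma lift_section: "(U, f) \<in> S \<Longrightarrow> h ` K \<subseteq> U \<Longrightarrow> lift h K (\<lambda>k. f (h k))"
  unfolding lift_def by (auto intro!: exI[of _ U] exI[of _ f])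

text \<open>The set where two lifts agree is open and closed.\<close>

lemma lift_unique:
  assumes h: "continuous_on K h" and K: "connected K" and l: "lift h K \<phi>" "lift h K \<psi>"
    and eq: "k0 \<in> K" "\<phi> k0 = \<psi> k0" and k: "k \<in> K"
  shows "\<phi> k = \<psi> k"
proof -
  have "\<forall>\<^sub>F j in at k within K. (\<phi> k = \<psi> k) = (\<phi> j = \<psi> j)" if k: "k \<in> K" for k
  proof -
    obtain U f where f: "(U, f) \<in> S" "h k \<in> U" "\<forall>\<^sub>F j in nhds k. j \<in> K \<longrightarrow> \<phi> j = f (h j)" "\<phi> k = f (h k)"
      using liftE[OF l(1) k] .
    obtain V g where g: "(V, g) \<in> S" "h k \<in> V" "\<forall>\<^sub>F j in nhds k. j \<in> K \<longrightarrow> \<psi> j = g (h j)" "\<psi> k = g (h k)"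
      using liftE[OF l(2) k] .
    have "\<forall>\<^sub>F j in nhds k. j \<in> K \<longrightarrow> (f (h j) = g (h j)) = (f (h k) = g (h k))"
      by (rule eventually_nhds_compose_within[OF h k agree[OF f(1) g(1) f(2) g(2)]])
    with f(3) g(3) show ?thesis
      unfolding eventually_at_filter by eventually_elim (use f(4) g(4) in auto)
  qed
  from connected_local_const[OF K eq(1) k, of "\<lambda>k. \<phi> k = \<psi> k"] this eq(2) show ?thesis by blast
qed

lemma lift_glue:
  assumes cl: "closed K1" "closed K2" and h: "continuous_on (K1 \<union> K2) h"
    and l: "lift h K1 \<phi>1" "lift h K2 \<phi>2" and eq: "\<And>k. k \<in> K1 \<Longrightarrow> k \<in> K2 \<Longrightarrow> \<phi>1 k = \<phi>2 k"
  shows "lift h (K1 \<union> K2) (\<lambda>k. if k \<in> K1 then \<phi>1 k else \<phi>2 k)"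
  unfolding lift_def
proof
  fix k assume k: "k \<in> K1 \<union> K2"
  have away: "\<forall>\<^sub>F j in nhds k. j \<notin> K" if "closed K" "k \<notin> K" for K
    using eventually_nhds_in_open[of "- K" k] that by auto
  consider "k \<in> K1" "k \<in> K2" | "k \<in> K1" "k \<notin> K2" | "k \<notin> K1" "k \<in> K2" using k by blast
  then show "\<exists>U f. (U, f) \<in> S \<and> h k \<in> U \<and> (\<forall>\<^sub>F j in nhds k. j \<in> K1 \<union> K2 \<longrightarrow>
      (if j \<in> K1 then \<phi>1 j else \<phi>2 j) = f (h j))"
  proof cases
    case 1
    obtain U f where f: "(U, f) \<in> S" "h k \<in> U" "\<forall>\<^sub>F j in nhds k. j \<in> K1 \<longrightarrow> \<phi>1 j = f (h j)" "\<phi>1 k = f (h k)"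
      using liftE[OF l(1) 1(1)] .
    obtain V g where g: "(V, g) \<in> S" "h k \<in> V" "\<forall>\<^sub>F j in nhds k. j \<in> K2 \<longrightarrow> \<phi>2 j = g (h j)" "\<phi>2 k = g (h k)"
      using liftE[OF l(2) 1(2)] .
    have "\<forall>\<^sub>F j in nhds k. j \<in> K1 \<union> K2 \<longrightarrow> (f (h j) = g (h j)) = (f (h k) = g (h k))"
      by (rule eventually_nhds_compose_within[OF h k agree[OF f(1) g(1) f(2) g(2)]])
    with f(3) g(3) have "\<forall>\<^sub>F j in nhds k. j \<in> K1 \<union> K2 \<longrightarrow> (if j \<in> K1 then \<phi>1 j else \<phi>2 j) = f (h j)"
      by eventually_elim (use f(4) g(4) eq[OF 1] in auto)
    with f show ?thesis by blast
  next
    case 2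
    obtain U f where f: "(U, f) \<in> S" "h k \<in> U" "\<forall>\<^sub>F j in nhds k. j \<in> K1 \<longrightarrow> \<phi>1 j = f (h j)" "\<phi>1 k = f (h k)"
      using liftE[OF l(1) 2(1)] .
    from f(3) away[OF cl(2) 2(2)] have "\<forall>\<^sub>F j in nhds k. j \<in> K1 \<union> K2 \<longrightarrow> (if j \<in> K1 then \<phi>1 j else \<phi>2 j) = f (h j)"
      by eventually_elim auto
    with f show ?thesis by blast
  next
    case 3
    obtain U f where f: "(U, f) \<in> S" "h k \<in> U" "\<forall>\<^sub>F j in nhds k. j \<in> K2 \<longrightarrow> \<phi>2 j = f (h j)" "\<phi>2 k = f (h k)"
      using liftE[OF l(2) 3(2)] .
    from f(3) away[OF cl(1) 3(1)] have "\<forall>\<^sub>F j in nhds k. j \<in> K1 \<union> K2 \<longrightarrow> (if j \<in> K1 then \<phi>1 j else \<phi>2 j) = f (h j)"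
      by eventually_elim auto
    with f show ?thesis by blast
  qed
qed

text \<open>Two overlapping domains are glued along their intersection; lifts that agree at one point of a connected
  intersection agree on all of it.\<close>

lemma liftable_union:
  assumes cl: "closed K1" "closed K2" and h: "continuous_on (K1 \<union> K2) h"
    and con: "connected (K1 \<inter> K2)" "K1 \<inter> K2 \<noteq> {}" and L: "liftable h K1" "liftable h K2"
  shows "liftable h (K1 \<union> K2)"
proof -
  have *: "\<exists>\<phi>. lift h (K1 \<union> K2) \<phi> \<and> \<phi> k = v"
    if cl: "closed K1" "closed K2" and h: "continuous_on (K1 \<union> K2) h"
    and con: "connected (K1 \<inter> K2)" "K1 \<inter> K2 \<noteq> {}" and L: "liftable h K1" "liftable h K2"
    and k: "k \<in> K1" "v \<in> fibre (h k)" for K1 K2 k v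
  proof -
    obtain \<phi>1 where 1: "lift h K1 \<phi>1" "\<phi>1 k = v" using L(1) k by (auto simp: liftable_def)
    obtain l where l: "l \<in> K1" "l \<in> K2" using con(2) by auto
    obtain \<phi>2 where 2: "lift h K2 \<phi>2" "\<phi>2 l = \<phi>1 l"
      using L(2) l lift_in_fibre[OF 1(1) l(1)] by (auto simp: liftable_def)
    have "\<phi>1 j = \<phi>2 j" if "j \<in> K1" "j \<in> K2" for j
      by (rule lift_unique[OF continuous_on_subset[OF h] con(1) lift_subset[OF 1(1)] lift_subset[OF 2(1)], of l])
        (use l 2 that in auto)
    from lift_glue[OF cl h 1(1) 2(1) this] k 1(2) show ?thesis
      by (intro exI[of _ "\<lambda>k. if k \<in> K1 then \<phi>1 k else \<phi>2 k"]) auto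
  qed
  show ?thesis
    unfolding liftable_def
  proof (intro ballI)
    fix k v assume "k \<in> K1 \<union> K2" and v: "v \<in> fibre (h k)"
    then show "\<exists>\<phi>. lift h (K1 \<union> K2) \<phi> \<and> \<phi> k = v"
      using *[OF cl h con L _ v] *[of K2 K1 k v] assms v by (auto simp: Un_commute Int_commute)
  qed
qed

lemma liftable_small:
  "\<exists>U. open U \<and> x \<in> U \<and> (\<forall>(h :: 'c::topological_space \<Rightarrow> 'x) K. h ` K \<subseteq> U \<longrightarrow> liftable h K)"
proof -
  obtain U where U: "open U" "x \<in> U" "\<And>y V g. y \<in> U \<Longrightarrow> (V, g) \<in> S \<Longrightarrow> y \<in> V \<Longrightarrow> \<exists>f. (U, f) \<in> S \<and> f y = g y"
    using extend[of x] by blast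
  have "liftable h K" if "h ` K \<subseteq> U" for h :: "'c \<Rightarrow> 'x" and K
    unfolding liftable_def
  proof (intro ballI)
    fix k v assume "k \<in> K" "v \<in> fibre (h k)"
    then obtain V g where "(V, g) \<in> S" "h k \<in> V" "g (h k) = v" by (auto simp: fibre_def)
    moreover have "h k \<in> U" using \<open>k \<in> K\<close> that by auto
    ultimately obtain f where "(U, f) \<in> S" "f (h k) = v" using U(3) by blast
    then show "\<exists>\<phi>. lift h K \<phi> \<and> \<phi> k = v" using lift_section[of U f h K] that by blast
  qed
  with U show ?thesis by blast
qed

text \<open>The homotopy lifting property. Subdivision of the square is replaced by two bisection arguments: a thin
  strip around a fixed abscissa is liftable, and thin strips are put together to the square.\<close>

lemma liftable_square:
  fixes h :: "real \<times> real \<Rightarrow> 'x"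
  assumes h: "continuous_on ({0..1} \<times> {0..1}) h"
  shows "liftable h ({0..1} \<times> {0..1})"
proof -
  have strip: "\<exists>d>0. \<forall>s1 s2. 0 \<le> s1 \<and> s1 \<le> s \<and> s \<le> s2 \<and> s2 \<le> 1 \<and> s2 - s1 < d \<longrightarrow> liftable h ({s1..s2} \<times> {0..1})"
    if s: "0 \<le> s" "s \<le> 1" for s
  proof -
    \<comment> \<open>Bisection in the second coordinate at the fixed first coordinate \<open>s\<close>: all sufficiently thin boxes are
      liftable.\<close>
    define Q where "Q = (\<lambda>a b. 0 \<le> a \<and> a \<le> b \<and> b \<le> 1 \<longrightarrow> (\<exists>d>0. \<forall>s1 s2. 0 \<le> s1 \<and> s1 \<le> s \<and> s \<le> s2 \<and> s2 \<le> 1 \<and> s2 - s1 < d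
      \<longrightarrow> liftable h ({s1..s2} \<times> {a..b})))"
    have "Q 0 1"
    proof (rule Bolzano)
      fix a b c assume Q: "Q a b" "Q b c" and abc: "a \<le> b" "b \<le> c"
      show "Q a c"
        unfolding Q_def
      proof (intro impI)
        assume ac: "0 \<le> a \<and> a \<le> c \<and> c \<le> 1"
        obtain d1 where d1: "d1 > 0" "\<And>s1 s2. 0 \<le> s1 \<Longrightarrow> s1 \<le> s \<Longrightarrow> s \<le> s2 \<Longrightarrow> s2 \<le> 1 \<Longrightarrow> s2 - s1 < d1 \<Longrightarrow> liftable h ({s1..s2} \<times> {a..b})"
          using Q(1) abc ac unfolding Q_def by auto
        obtain d2 where d2: "d2 > 0" "\<And>s1 s2. 0 \<le> s1 \<Longrightarrow> s1 \<le> s \<Longrightarrow> s \<le> s2 \<Longrightarrow> s2 \<le> 1 \<Longrightarrow> s2 - s1 < d2 \<Longrightarrow> liftable h ({s1..s2} \<times> {b..c})"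
          using Q(2) abc ac unfolding Q_def by auto
        have "liftable h ({s1..s2} \<times> {a..c})" if s12: "0 \<le> s1" "s1 \<le> s" "s \<le> s2" "s2 \<le> 1" "s2 - s1 < min d1 d2" for s1 s2
        proof -
          have un: "{s1..s2} \<times> {a..c} = {s1..s2} \<times> {a..b} \<union> {s1..s2} \<times> {b..c}" using abc by auto
          have int: "({s1..s2} \<times> {a..b}) \<inter> ({s1..s2} \<times> {b..c}) = {s1..s2} \<times> {b}" using abc by auto
          show ?thesis
            unfolding un
          proof (rule liftable_union)
            show "continuous_on ({s1..s2} \<times> {a..b} \<union> {s1..s2} \<times> {b..c}) h"
              by (rule continuous_on_subset[OF h]) (use s12 ac abc in auto)
          qed (use s12 d1 d2 int in \<open>auto intro!: closed_Times connected_Times\<close>)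
        qed
        then show "\<exists>d>0. \<forall>s1 s2. 0 \<le> s1 \<and> s1 \<le> s \<and> s \<le> s2 \<and> s2 \<le> 1 \<and> s2 - s1 < d \<longrightarrow> liftable h ({s1..s2} \<times> {a..c})"
          using d1(1) d2(1) by (intro exI[of _ "min d1 d2"]) auto
      qed
    next
      fix t :: real assume t: "0 \<le> t" "t \<le> 1"
      obtain U where U: "open U" "h (s, t) \<in> U" "\<And>h K. h ` K \<subseteq> U \<Longrightarrow> liftable (h :: real \<times> real \<Rightarrow> 'x) K"
        using liftable_small[where 'c="real \<times> real"] by metis
      have "\<forall>\<^sub>F p in nhds (s, t). p \<in> {0..1} \<times> {0..1} \<longrightarrow> h p \<in> U"
        by (rule eventually_nhds_compose_within[OF h]) (use U s t eventually_nhds_in_open in auto)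
      then obtain d where d: "d > 0" "\<And>p. dist p (s, t) < d \<Longrightarrow> p \<in> {0..1} \<times> {0..1} \<Longrightarrow> h p \<in> U"
        unfolding eventually_nhds_metric by blast
      show "\<exists>d>0. \<forall>a b. a \<le> t \<and> t \<le> b \<and> b - a < d \<longrightarrow> Q a b"
      proof (intro exI[of _ "d/2"] conjI allI impI)
        fix a b assume ab: "a \<le> t \<and> t \<le> b \<and> b - a < d / 2"
        show "Q a b"
          unfolding Q_def
        proof (intro impI exI[of _ "d/2"] conjI allI U(3))
          fix s1 s2 assume *: "0 \<le> a \<and> a \<le> b \<and> b \<le> 1" "0 \<le> s1 \<and> s1 \<le> s \<and> s \<le> s2 \<and> s2 \<le> 1 \<and> s2 - s1 < d / 2"
          have "h (s', t') \<in> U" if "s' \<in> {s1..s2}" "t' \<in> {a..b}" for s' t'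
          proof (rule d(2))
            have "dist (s', t') (s, t) \<le> \<bar>s' - s\<bar> + \<bar>t' - t\<bar>"
              using sqrt_sum_squares_le_sum_abs[of "s' - s" "t' - t"] by (simp add: dist_prod_def dist_real_def)
            also have "\<dots> < d" using that * ab by (auto simp: abs_if)
            finally show "dist (s', t') (s, t) < d" .
          qed (use that * in auto)
          then show "h ` ({s1..s2} \<times> {a..b}) \<subseteq> U" by auto
        qed (use d in auto)
      qed (use d in auto)
    qed simp
    then show ?thesis by (simp add: Q_def)
  qed
  define R where "R = (\<lambda>a b. 0 \<le> a \<and> a \<le> b \<and> b \<le> 1 \<longrightarrow> liftable h ({a..b} \<times> {0..1::real}))"
  have "R 0 1"
  proof (rule Bolzano)
    fix a b c assume R: "R a b" "R b c" and abc: "a \<le> b" "b \<le> c"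
    show "R a c"
      unfolding R_def
    proof
      assume ac: "0 \<le> a \<and> a \<le> c \<and> c \<le> 1"
      have un: "{a..c} \<times> {0..1::real} = {a..b} \<times> {0..1} \<union> {b..c} \<times> {0..1}" using abc by auto
      have int: "({a..b} \<times> {0..1::real}) \<inter> ({b..c} \<times> {0..1}) = {b} \<times> {0..1}" using abc by auto
      show "liftable h ({a..c} \<times> {0..1})"
        unfolding un
      proof (rule liftable_union)
        show "continuous_on ({a..b} \<times> {0..1} \<union> {b..c} \<times> {0..1}) h"
          by (rule continuous_on_subset[OF h]) (use ac abc in auto)
      qed (use R ac abc int in \<open>auto simp: R_def intro!: closed_Times connected_Times\<close>)
    qed
  next
    fix s :: real assume "0 \<le> s" "s \<le> 1"
    from strip[OF this] obtain d where d: "d > 0" "\<And>s1 s2. 0 \<le> s1 \<and> s1 \<le> s \<and> s \<le> s2 \<and> s2 \<le> 1 \<and> s2 - s1 < d \<Longrightarrow> liftable h ({s1..s2} \<times> {0..1})"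
      by blast
    then show "\<exists>d>0. \<forall>a b. a \<le> s \<and> s \<le> b \<and> b - a < d \<longrightarrow> R a b"
      by (intro exI[of _ d]) (auto simp: R_def)
  qed simp
  then show ?thesis by (simp add: R_def)
qed

lemma path_lift:
  fixes c :: "real \<Rightarrow> 'x"
  assumes c: "path c" and v: "v \<in> fibre (c 0)"
  obtains \<phi> where "lift c {0..1} \<phi>" "\<phi> 0 = v"
proof -
  have "continuous_on ({0..1} \<times> {0..1}) (\<lambda>p::real \<times> real. c (fst p))"
    using c unfolding path_def by (rule continuous_on_compose2) (auto intro!: continuous_intros)
  from liftable_square[OF this] v obtain \<Phi> where \<Phi>: "lift (\<lambda>p::real \<times> real. c (fst p)) ({0..1} \<times> {0..1}) \<Phi>" "\<Phi> (0, 0) = v"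
    by (fastforce simp: liftable_def)
  have "lift (\<lambda>t. c (fst (t, 0::real))) {0..1} (\<lambda>t. \<Phi> (t, 0))"
    by (rule lift_compose[OF \<Phi>(1)]) (auto intro!: continuous_intros)
  then show thesis using that[of "\<lambda>t. \<Phi> (t, 0)"] \<Phi>(2) by simp
qed

lemma path_lift_unique:
  "path c \<Longrightarrow> lift c {0..1} \<phi> \<Longrightarrow> lift c {0..1} \<psi> \<Longrightarrow> s \<in> {0..1} \<Longrightarrow> \<phi> s = \<psi> s \<Longrightarrow> t \<in> {0..1} \<Longrightarrow> \<phi> t = \<psi> t"
  by (rule lift_unique[of "{0..1}" c \<phi> \<psi> s t]) (auto simp: path_def)

text \<open>A null homotopy is lifted to the square. On the side where the homotopy is constant the lift is constant, so the
  lifts of the lower and the upper side, which lift the same path, agree at one end and hence at the other.\<close>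

lemma loop_lift_closed:
  assumes sc: "simply_connected (UNIV :: 'x set)" and c: "path c" "c 0 = c 1" and l: "lift c {0..1} \<phi>"
  shows "\<phi> 0 = \<phi> 1"
proof -
  have "homotopic_loops UNIV c (\<lambda>_. c 0)"
    using sc c by (simp add: simply_connected_def pathstart_def pathfinish_def path_def)
  then have "\<exists>h. continuous_on ({0..1::real} \<times> {0..1::real}) h \<and> (\<forall>x\<in>{0..1}. h (0, x) = c x) \<and>
      (\<forall>x\<in>{0..1}. h (1, x) = c 0) \<and> (\<forall>t\<in>{0..1}. h (t, 1) = h (t, 0))"
    unfolding homotopic_loops by (simp add: pathstart_def pathfinish_def)
  then obtain h where h: "continuous_on ({0..1::real} \<times> {0..1::real}) h" "\<And>x. x \<in> {0..1} \<Longrightarrow> h (0, x) = c x"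
    "\<And>x. x \<in> {0..1} \<Longrightarrow> h (1, x) = c 0" "\<And>t. t \<in> {0..1} \<Longrightarrow> h (t, 1) = h (t, 0)"
    by metis
  have "\<phi> 0 \<in> fibre (h (0, 0))" using lift_in_fibre[OF l, of 0] h(2)[of 0] by simp
  with liftable_square[OF h(1)] obtain \<Phi> where \<Phi>: "lift h ({0..1} \<times> {0..1}) \<Phi>" "\<Phi> (0, 0) = \<phi> 0"
    by (fastforce simp: liftable_def)
  have cont: "continuous_on {0..1} (Pair a)" "continuous_on {0..1} (\<lambda>t. (t, a))" for a :: real
    by (auto intro!: continuous_on_Pair continuous_on_const continuous_on_id)
  have V: "lift (\<lambda>t. h (a, t)) {0..1} (\<lambda>t. \<Phi> (a, t))" if "a \<in> {0..1}" for a
    by (rule lift_compose[OF \<Phi>(1) cont(1)]) (use that in auto)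
  have W: "lift (\<lambda>t. h (t, a)) {0..1} (\<lambda>t. \<Phi> (t, a))" if "a \<in> {0..1}" for a
    by (rule lift_compose[OF \<Phi>(1) cont(2)]) (use that in auto)
  have bottom: "\<Phi> (0, t) = \<phi> t" if "t \<in> {0..1}" for t
    by (rule path_lift_unique[OF c(1) lift_cong[OF V] l, of 0 0]) (use h(2) \<Phi>(2) that in auto)
  obtain U f where f: "(U, f) \<in> S" "h (1, 0) \<in> U" "\<Phi> (1, 0) = f (h (1, 0))"
    by (rule liftE[OF \<Phi>(1), of "(1, 0)"]) auto
  have "lift (\<lambda>t. c 0) {0..1::real} (\<lambda>t. f (c 0))" by (rule lift_section[OF f(1)]) (use f h(3)[of 0] in auto)
  then have "\<Phi> (1, 1) = f (c 0)"
    by (intro path_lift_unique[OF _ lift_cong[OF V[of 1]], of "\<lambda>t. c 0" "\<lambda>t. f (c 0)" 0 1])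
      (use f h(3) in \<open>auto simp: path_def\<close>)
  then have top: "\<Phi> (1, 1) = \<Phi> (1, 0)" using f h(3)[of 0] by simp
  have "path (\<lambda>t. h (t, 0))"
    unfolding path_def by (rule continuous_on_compose2[OF h(1) cont(2)]) auto
  then have "\<Phi> (0, 1) = \<Phi> (0, 0)"
    by (rule path_lift_unique[OF _ lift_cong[OF W[of 1]] W[of 0], of 1 0]) (use h(4) top in auto)
  with bottom show ?thesis by simp
qed

lemma join_lift:
  assumes c: "path c" "path d" "c 1 = d 0" and l: "lift (c +++ d) {0..1} \<epsilon>"
  shows "lift c {0..1} (\<lambda>t. \<epsilon> (t / 2))" "lift d {0..1} (\<lambda>t. \<epsilon> ((t + 1) / 2))"
proof -
  have "lift (\<lambda>t. (c +++ d) (t / 2)) {0..1} (\<lambda>t. \<epsilon> (t / 2))"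
    by (rule lift_compose[OF l]) (auto intro!: continuous_intros)
  then show "lift c {0..1} (\<lambda>t. \<epsilon> (t / 2))" by (rule lift_cong) (auto simp: joinpaths_def)
  have "lift (\<lambda>t. (c +++ d) ((t + 1) / 2)) {0..1} (\<lambda>t. \<epsilon> ((t + 1) / 2))"
    by (rule lift_compose[OF l]) (auto intro!: continuous_intros)
  then show "lift d {0..1} (\<lambda>t. \<epsilon> ((t + 1) / 2))"
    by (rule lift_cong) (use c in \<open>auto simp: joinpaths_def field_simps\<close>)
qed

lemma lift_path_independent:
  assumes sc: "simply_connected (UNIV :: 'x set)" and c: "path c" "path d" "c 0 = d 0" "c 1 = d 1"
    and l: "lift c {0..1} \<phi>" "lift d {0..1} \<psi>" "\<phi> 0 = \<psi> 0"
  shows "\<phi> 1 = \<psi> 1"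
proof -
  have r: "path (reversepath d)" using c by simp
  have r0: "c 1 = reversepath d 0" using c by (simp add: reversepath_def)
  have e: "path (c +++ reversepath d)" using c r r0 by (simp add: pathfinish_def pathstart_def)
  have 0: "(c +++ reversepath d) 0 = c 0" "(c +++ reversepath d) 1 = c 0"
    using c by (auto simp: joinpaths_def reversepath_def)
  obtain \<epsilon> where \<epsilon>: "lift (c +++ reversepath d) {0..1} \<epsilon>" "\<epsilon> 0 = \<phi> 0"
    using path_lift[OF e, of "\<phi> 0"] 0 lift_in_fibre[OF l(1), of 0] by auto
  note j = join_lift[OF c(1) r r0 \<epsilon>(1)]
  have 1: "\<epsilon> (1 / 2) = \<phi> 1"
    using path_lift_unique[OF c(1) j(1) l(1), of 0 1] \<epsilon>(2) by simp
  have "lift (\<lambda>t. reversepath d (1 - t)) {0..1} (\<lambda>t. \<epsilon> (((1 - t) + 1) / 2))"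
    by (rule lift_compose[OF j(2)]) (auto intro!: continuous_intros)
  then have "lift d {0..1} (\<lambda>t. \<epsilon> (((1 - t) + 1) / 2))" by (simp add: reversepath_def)
  from path_lift_unique[OF c(2) this l(2), of 0 1] loop_lift_closed[OF sc e _ \<epsilon>(1)] 0 \<epsilon>(2) l(3) 1
  show ?thesis by simp
qed

text \<open>The value at a point is the end value of the lift of any path from the base point; by simple
  connectedness the path does not matter.\<close>

theorem global_section:
  assumes sc: "simply_connected (UNIV :: 'x set)"
    and lpc: "\<And>(x :: 'x) U. open U \<Longrightarrow> x \<in> U \<Longrightarrow> \<exists>V\<subseteq>U. open V \<and> x \<in> V \<and> (\<forall>y\<in>V. \<exists>c. path c \<and> path_image c \<subseteq> V \<and> c 0 = x \<and> c 1 = y)"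
    and ne: "(U0, f0) \<in> S" "x0 \<in> U0"
  obtains F where "\<And>x. \<exists>U f. (U, f) \<in> S \<and> x \<in> U \<and> (\<forall>\<^sub>F y in nhds x. F y = f y)"
proof -
  define v0 where "v0 = f0 x0"
  have v0: "v0 \<in> fibre x0" using ne by (auto simp: fibre_def v0_def)
  define reach where "reach = (\<lambda>y v. \<exists>c \<phi>. path c \<and> c 0 = x0 \<and> c 1 = y \<and> lift c {0..1} \<phi> \<and> \<phi> 0 = v0 \<and> \<phi> 1 = v)"
  have ex: "\<exists>v. reach y v" for y
  proof -
    obtain c where c: "path c" "c 0 = x0" "c 1 = y" using simply_connected_joinable[OF sc] by blast
    then obtain \<phi> where "lift c {0..1} \<phi>" "\<phi> 0 = v0" using path_lift v0 by metis
    with c show ?thesis unfolding reach_def by blast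
  qed
  have un: "v = w" if "reach y v" "reach y w" for y v w
    using that lift_path_independent[OF sc] unfolding reach_def by metis
  define F where "F = (\<lambda>y. SOME v. reach y v)"
  have F: "reach y (F y)" for y unfolding F_def using ex by (rule someI_ex)
  have "\<exists>U f. (U, f) \<in> S \<and> x \<in> U \<and> (\<forall>\<^sub>F y in nhds x. F y = f y)" for x
  proof -
    obtain c \<phi> where c: "path c" "c 0 = x0" "c 1 = x" "lift c {0..1} \<phi>" "\<phi> 0 = v0" "\<phi> 1 = F x"
      using F[of x] unfolding reach_def by blast
    obtain U where U: "open U" "x \<in> U" "\<And>y V g. y \<in> U \<Longrightarrow> (V, g) \<in> S \<Longrightarrow> y \<in> V \<Longrightarrow> \<exists>f. (U, f) \<in> S \<and> f y = g y"
      using extend[of x] by blast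
    have "F x \<in> fibre x" using lift_in_fibre[OF c(4), of 1] c by simp
    then obtain V g where "(V, g) \<in> S" "x \<in> V" "g x = F x" by (auto simp: fibre_def)
    then obtain f where f: "(U, f) \<in> S" "f x = F x" using U(3)[OF U(2), of V g] by auto
    obtain V where V: "V \<subseteq> U" "open V" "x \<in> V" "\<And>y. y \<in> V \<Longrightarrow> \<exists>c. path c \<and> path_image c \<subseteq> V \<and> c 0 = x \<and> c 1 = y"
      using lpc[OF U(1,2)] by blast
    have "F y = f y" if y: "y \<in> V" for y
    proof -
      obtain d where d: "path d" "path_image d \<subseteq> V" "d 0 = x" "d 1 = y" using V(4)[OF y] by blast
      have e: "path (c +++ d)" using c d by (simp add: pathfinish_def pathstart_def)
      have e0: "(c +++ d) 0 = x0" "(c +++ d) 1 = y" using c d by (auto simp: joinpaths_def)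
      obtain \<epsilon> where \<epsilon>: "lift (c +++ d) {0..1} \<epsilon>" "\<epsilon> 0 = v0"
        using path_lift[OF e] e0 v0 by metis
      have cd: "c 1 = d 0" using c d by simp
      note j = join_lift[OF c(1) d(1) cd \<epsilon>(1)]
      have "\<epsilon> (1 / 2) = F x"
        using path_lift_unique[OF c(1) j(1) c(4), of 0 1] \<epsilon>(2) c by simp
      moreover have "lift d {0..1} (\<lambda>t. f (d t))"
        by (rule lift_section[OF f(1)]) (use d(2) V(1) in \<open>auto simp: path_image_def\<close>)
      ultimately have "\<epsilon> 1 = f y"
        using path_lift_unique[OF d(1) j(2), of "\<lambda>t. f (d t)" 0 1] d f(2) by simp
      then have "reach y (f y)" unfolding reach_def using e e0 \<epsilon> by blast
      then show ?thesis using un F by blast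
    qed
    then have "\<forall>\<^sub>F y in nhds x. F y = f y"
      using V(2,3) by (auto simp: eventually_nhds)
    with f U(2) show ?thesis by blast
  qed
  then show thesis using that by blast
qed

end

section \<open>Lorentzian geometry in a chart\<close>

abbreviation fd :: "('a::real_normed_vector \<Rightarrow> 'b::real_normed_vector) \<Rightarrow> 'a \<Rightarrow> 'a \<Rightarrow> 'b" where
  "fd f x \<equiv> frechet_derivative f (at x)"

lemma fd_eqI: "(f has_derivative f') (at x) \<Longrightarrow> fd f x = f'"
  by (rule frechet_derivative_at[symmetric])

lemma fd_linear: "f differentiable at x \<Longrightarrow> linear (fd f x)"
  by (rule linear_frechet_derivative)

lemma vec2_expand: "(v :: real^2) = v $ 1 *\<^sub>R axis 1 1 + v $ 2 *\<^sub>R axis 2 1"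
  by (simp add: vec_eq_iff forall_2 axis_def)

lemma linear_vec2: "linear L \<Longrightarrow> L (v :: real^2) = v $ 1 *\<^sub>R L (axis 1 1) + v $ 2 *\<^sub>R L (axis 2 1)"
  by (subst vec2_expand[of v]) (simp only: linear_add linear_scale)

lemma fd_vec2: "f differentiable at x \<Longrightarrow> fd f x (v :: real^2) = v $ 1 *\<^sub>R fd f x (axis 1 1) + v $ 2 *\<^sub>R fd f x (axis 2 1)"
  by (rule linear_vec2[OF fd_linear])

text \<open>The product rule for \<open>y \<mapsto> \<beta>\<^sub>y(Y\<^sub>y)\<close>.\<close>

lemma fd_along_field:
  fixes \<beta> :: "real^2 \<Rightarrow> real^2 \<Rightarrow> 'b::real_normed_vector" and Y :: "real^2 \<Rightarrow> real^2"
  assumes Om: "open Om" and x: "x \<in> Om" and \<Phi>: "\<And>v. smooth_on Om (\<lambda>y. \<beta> y v)" "\<And>y. y \<in> Om \<Longrightarrow> linear (\<beta> y)"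
    and Y: "(Y has_derivative Y') (at x)"
  shows "((\<lambda>y. \<beta> y (Y y)) has_derivative (\<lambda>v. fd (\<lambda>y. \<beta> y (Y x)) x v + \<beta> x (Y' v))) (at x)"
proof -
  have d: "((\<lambda>y. \<beta> y w) has_derivative fd (\<lambda>y. \<beta> y w) x) (at x)" for w
    by (rule smooth_on_has_derivative[OF \<Phi>(1) x])
  have dY: "((\<lambda>y. Y y $ i) has_derivative (\<lambda>v. Y' v $ i)) (at x)" for i
    by (rule bounded_linear.has_derivative[OF bounded_linear_vec_nth Y])
  have ex: "Y y $ 1 *\<^sub>R \<beta> y (axis 1 1) + Y y $ 2 *\<^sub>R \<beta> y (axis 2 1) = \<beta> y (Y y)" if "y \<in> Om" for y
    using linear_vec2[OF \<Phi>(2)[OF that]] by metis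
  have s: "((\<lambda>y. Y y $ 1 *\<^sub>R \<beta> y (axis 1 1) + Y y $ 2 *\<^sub>R \<beta> y (axis 2 1)) has_derivative
      (\<lambda>v. (Y x $ 1 *\<^sub>R fd (\<lambda>y. \<beta> y (axis 1 1)) x v + Y' v $ 1 *\<^sub>R \<beta> x (axis 1 1)) +
        (Y x $ 2 *\<^sub>R fd (\<lambda>y. \<beta> y (axis 2 1)) x v + Y' v $ 2 *\<^sub>R \<beta> x (axis 2 1)))) (at x)"
    by (intro has_derivative_add has_derivative_scaleR d dY)
  have t: "((\<lambda>y. Y x $ 1 *\<^sub>R \<beta> y (axis 1 1) + Y x $ 2 *\<^sub>R \<beta> y (axis 2 1)) has_derivative
      (\<lambda>v. Y x $ 1 *\<^sub>R fd (\<lambda>y. \<beta> y (axis 1 1)) x v + Y x $ 2 *\<^sub>R fd (\<lambda>y. \<beta> y (axis 2 1)) x v)) (at x)"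
    by (intro has_derivative_add bounded_linear.has_derivative[OF bounded_linear_scaleR_right] d)
  have u: "Y x $ 1 *\<^sub>R \<beta> y (axis 1 1) + Y x $ 2 *\<^sub>R \<beta> y (axis 2 1) = \<beta> y (Y x)" if "y \<in> Om" for y
    using linear_vec2[OF \<Phi>(2)[OF that], of "Y x"] by simp
  have "((\<lambda>y. \<beta> y (Y x)) has_derivative
      (\<lambda>v. Y x $ 1 *\<^sub>R fd (\<lambda>y. \<beta> y (axis 1 1)) x v + Y x $ 2 *\<^sub>R fd (\<lambda>y. \<beta> y (axis 2 1)) x v)) (at x)"
    by (rule has_derivative_transform_within_open[OF t Om x u])
  then have "fd (\<lambda>y. \<beta> y (Y x)) x v = Y x $ 1 *\<^sub>R fd (\<lambda>y. \<beta> y (axis 1 1)) x v + Y x $ 2 *\<^sub>R fd (\<lambda>y. \<beta> y (axis 2 1)) x v" for v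
    by (simp add: fd_eqI)
  moreover have "\<beta> x (Y' v) = Y' v $ 1 *\<^sub>R \<beta> x (axis 1 1) + Y' v $ 2 *\<^sub>R \<beta> x (axis 2 1)" for v
    by (rule linear_vec2[OF \<Phi>(2)[OF x]])
  ultimately have "(\<lambda>v. fd (\<lambda>y. \<beta> y (Y x)) x v + \<beta> x (Y' v)) =
      (\<lambda>v. (Y x $ 1 *\<^sub>R fd (\<lambda>y. \<beta> y (axis 1 1)) x v + Y' v $ 1 *\<^sub>R \<beta> x (axis 1 1)) +
        (Y x $ 2 *\<^sub>R fd (\<lambda>y. \<beta> y (axis 2 1)) x v + Y' v $ 2 *\<^sub>R \<beta> x (axis 2 1)))"
    by (simp add: fun_eq_iff algebra_simps)
  then show ?thesis
    using has_derivative_transform_within_open[OF s Om x ex] by simp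
qed

definition gform :: "real^2^2 \<Rightarrow> real^2 \<Rightarrow> real^2 \<Rightarrow> real" where
  "gform M u v = (\<Sum>i\<in>UNIV. \<Sum>j\<in>UNIV. M $ i $ j * u $ i * v $ j)"

lemma gform_add: "gform M (u + v) w = gform M u w + gform M v w" "gform M w (u + v) = gform M w u + gform M w v"
  and gform_diff: "gform M (u - v) w = gform M u w - gform M v w" "gform M w (u - v) = gform M w u - gform M w v"
  and gform_scaleR: "gform M (a *\<^sub>R u) w = a * gform M u w" "gform M w (a *\<^sub>R u) = a * gform M w u"
  and gform_minus: "gform M (- u) w = - gform M u w" "gform M w (- u) = - gform M w u"
  by (simp_all add: gform_def sum_2 algebra_simps)

lemmas gform_simps = gform_add gform_diff gform_scaleR gform_minus

lemma gform_commute: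
  assumes "\<And>i j. M $ i $ j = M $ j $ i"
  shows "gform M u v = gform M v u"
  using assms[of 1 2] by (simp add: gform_def sum_2)

text \<open>The Gram determinant of the frame is \<open>-1\<close>, so the two vectors are a basis; the coefficients are then read
  off from the products.\<close>

lemma lorentz_frame_expand:
  assumes sym: "\<And>i j. M $ i $ j = M $ j $ i"
    and on: "gform M e2 e2 = -1" "gform M e3 e3 = 1" "gform M e2 e3 = 0"
  shows "u = (- gform M u e2) *\<^sub>R e2 + gform M u e3 *\<^sub>R e3"
proof -
  define d where "d = e2 $ 1 * e3 $ 2 - e2 $ 2 * e3 $ 1"
  have "(M $ 1 $ 1 * M $ 2 $ 2 - M $ 1 $ 2 * M $ 2 $ 1) * d\<^sup>2 = gform M e2 e2 * gform M e3 e3 - gform M e2 e3 * gform M e3 e2"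
    by (simp add: d_def gform_def sum_2 power2_eq_square algebra_simps)
  then have "(M $ 1 $ 1 * M $ 2 $ 2 - M $ 1 $ 2 * M $ 2 $ 1) * d\<^sup>2 = -1"
    using on gform_commute[OF sym, of e3 e2] by simp
  then have d: "d \<noteq> 0" by auto
  define a b where "a = (u $ 1 * e3 $ 2 - u $ 2 * e3 $ 1) / d" and "b = (e2 $ 1 * u $ 2 - e2 $ 2 * u $ 1) / d"
  have "d *\<^sub>R (a *\<^sub>R e2 + b *\<^sub>R e3) = d *\<^sub>R u"
    using d unfolding a_def b_def by (simp add: vec_eq_iff forall_2 scaleR_add_right) (simp add: d_def algebra_simps)
  then have u: "u = a *\<^sub>R e2 + b *\<^sub>R e3" using d by simp
  have "gform M u e2 = - a" "gform M u e3 = b"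
    using on gform_commute[OF sym, of e3 e2] by (simp_all add: u gform_simps)
  then show ?thesis by (simp add: u)
qed

lemma matrix_inv_eqI:
  fixes M B :: "real^'n^'n"
  assumes "B ** M = mat 1"
  shows "matrix_inv M = B" "M ** matrix_inv M = mat 1"
proof -
  have "M ** B = mat 1" using assms matrix_left_right_inverse by blast
  then have "\<exists>A'. M ** A' = mat 1 \<and> A' ** M = mat 1" using assms by blast
  then have *: "M ** matrix_inv M = mat 1 \<and> matrix_inv M ** M = mat 1"
    unfolding matrix_inv_def by (rule someI_ex)
  then show "M ** matrix_inv M = mat 1" by blast
  have "matrix_inv M = (B ** M) ** matrix_inv M" using assms by simp
  also have "\<dots> = B ** (M ** matrix_inv M)" by (simp add: matrix_mul_assoc)
  finally show "matrix_inv M = B" using * by simp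
qed

lemma lorentz_frame_inverse:
  assumes sym: "\<And>i j. M $ i $ j = M $ j $ i"
    and on: "gform M e2 e2 = -1" "gform M e3 e3 = 1" "gform M e2 e3 = 0"
  shows "matrix_inv M = (\<chi> i j. e3 $ i * e3 $ j - e2 $ i * e2 $ j)" (is "_ = ?B")
    and "M ** matrix_inv M = mat 1"
proof -
  have "?B ** M = mat 1"
  proof -
    have "(?B ** M) $ i $ j = mat 1 $ i $ j" for i j
    proof -
      have "(axis j 1 :: real^2) $ i = ((- gform M (axis j 1) e2) *\<^sub>R e2 + gform M (axis j 1) e3 *\<^sub>R e3) $ i"
        using lorentz_frame_expand[OF assms, of "axis j 1"] by simp
      moreover have "gform M (axis j 1) w = (\<Sum>k\<in>UNIV. M $ k $ j * w $ k)" for w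
        unfolding gform_def using sym exhaust_2[of j] by (auto simp: sum_2 axis_def)
      ultimately show ?thesis
        using exhaust_2[of i] exhaust_2[of j]
        by (auto simp: matrix_matrix_mult_def mat_def sum_2 axis_def algebra_simps)
    qed
    then show ?thesis by (simp add: vec_eq_iff)
  qed
  from matrix_inv_eqI[OF this] show "matrix_inv M = ?B" "M ** matrix_inv M = mat 1" by simp_all
qed

definition Chr :: "(real^2 \<Rightarrow> real^2^2) \<Rightarrow> real^2 \<Rightarrow> 2 \<Rightarrow> 2 \<Rightarrow> 2 \<Rightarrow> real" where
  "Chr G x k i j = (1/2) * (\<Sum>l\<in>UNIV. matrix_inv (G x) $ k $ l *
     (partial i (\<lambda>y. G y $ j $ l) x + partial j (\<lambda>y. G y $ i $ l) x - partial l (\<lambda>y. G y $ i $ j) x))"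

definition Gam :: "(real^2 \<Rightarrow> real^2^2) \<Rightarrow> real^2 \<Rightarrow> real^2 \<Rightarrow> real^2 \<Rightarrow> real^2" where
  "Gam G x u v = (\<chi> k. \<Sum>i\<in>UNIV. \<Sum>j\<in>UNIV. Chr G x k i j * u $ i * v $ j)"

definition nabla :: "(real^2 \<Rightarrow> real^2^2) \<Rightarrow> (real^2 \<Rightarrow> real^2) \<Rightarrow> real^2 \<Rightarrow> real^2 \<Rightarrow> real^2" where
  "nabla G Y x v = fd Y x v + Gam G x v (Y x)"

lemma Gam_linear: "Gam G x (u + u') v = Gam G x u v + Gam G x u' v" "Gam G x v (u + u') = Gam G x v u + Gam G x v u'"
  "Gam G x (u - u') v = Gam G x u v - Gam G x u' v" "Gam G x v (u - u') = Gam G x v u - Gam G x v u'"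
  "Gam G x (a *\<^sub>R u) v = a *\<^sub>R Gam G x u v" "Gam G x v (a *\<^sub>R u) = a *\<^sub>R Gam G x v u"
  by (simp_all add: Gam_def vec_eq_iff sum_2 algebra_simps)

text \<open>\<open>D\<^sup>2\<Phi>(u,v) - D\<Phi>(\<Gamma>(u,v))\<close>: the second fundamental form in coordinates.\<close>

definition II :: "(real^2 \<Rightarrow> real^2^2) \<Rightarrow> (real^2 \<Rightarrow> 'b::real_normed_vector) \<Rightarrow> real^2 \<Rightarrow> real^2 \<Rightarrow> real^2 \<Rightarrow> 'b" where
  "II G \<Phi> x u v = fd (\<lambda>y. fd \<Phi> y v) x u - fd \<Phi> x (Gam G x u v)"

locale chart_frame =
  fixes Om :: "(real^2) set" and G :: "real^2 \<Rightarrow> real^2^2" and e2 e3 :: "real^2 \<Rightarrow> real^2"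
  assumes Om: "open Om"
    and G_smooth: "smooth_on Om G"
    and G_sym: "x \<in> Om \<Longrightarrow> G x $ i $ j = G x $ j $ i"
    and e2_smooth: "smooth_on Om e2" and e3_smooth: "smooth_on Om e3"
    and on22: "x \<in> Om \<Longrightarrow> gform (G x) (e2 x) (e2 x) = -1"
    and on33: "x \<in> Om \<Longrightarrow> gform (G x) (e3 x) (e3 x) = 1"
    and on23: "x \<in> Om \<Longrightarrow> gform (G x) (e2 x) (e3 x) = 0"
begin

definition om :: "real^2 \<Rightarrow> real^2 \<Rightarrow> real" where
  "om x v = gform (G x) (nabla G e2 x v) (e3 x)"

definition ep :: "real^2 \<Rightarrow> real^2" where "ep x = e2 x + e3 x"
definition em :: "real^2 \<Rightarrow> real^2" where "em x = e2 x - e3 x"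

lemma gcom: "x \<in> Om \<Longrightarrow> gform (G x) u v = gform (G x) v u"
  by (rule gform_commute) (rule G_sym)

lemma on32: "x \<in> Om \<Longrightarrow> gform (G x) (e3 x) (e2 x) = 0"
  using gcom on23 by metis

lemma expand:
  assumes "x \<in> Om"
  shows "u = (- gform (G x) u (e2 x)) *\<^sub>R e2 x + gform (G x) u (e3 x) *\<^sub>R e3 x"
  by (rule lorentz_frame_expand[OF G_sym[OF assms] on22[OF assms] on33[OF assms] on23[OF assms]])

lemma ep_smooth: "smooth_on Om ep" and em_smooth: "smooth_on Om em"
  unfolding ep_def em_def by (intro smooth_on_add smooth_on_diff Om e2_smooth e3_smooth)+

lemma null: "x \<in> Om \<Longrightarrow> gform (G x) (ep x) (ep x) = 0" "x \<in> Om \<Longrightarrow> gform (G x) (em x) (em x) = 0"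
  "x \<in> Om \<Longrightarrow> gform (G x) (ep x) (em x) = -2" "x \<in> Om \<Longrightarrow> gform (G x) (em x) (ep x) = -2"
  by (simp_all add: ep_def em_def gform_simps on22 on33 on23 on32)

lemma null_expand:
  assumes "x \<in> Om"
  shows "u = (- 1 / 2 * gform (G x) u (em x)) *\<^sub>R ep x + (- 1 / 2 * gform (G x) u (ep x)) *\<^sub>R em x"
proof -
  have "(- 1 / 2 * gform (G x) u (em x)) *\<^sub>R ep x + (- 1 / 2 * gform (G x) u (ep x)) *\<^sub>R em x =
      (- gform (G x) u (e2 x)) *\<^sub>R e2 x + gform (G x) u (e3 x) *\<^sub>R e3 x"
    by (simp add: ep_def em_def gform_simps vec_eq_iff) (simp add: field_simps)
  then show ?thesis using expand[OF assms, of u] by metis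
qed

text \<open>Lowering the index removes the inverse matrix from the definition of the Christoffel symbols.\<close>

lemma lowered_christoffel:
  assumes x: "x \<in> Om"
  shows "(\<Sum>k\<in>UNIV. G x $ l $ k * Chr G x k i j) =
    (partial i (\<lambda>y. G y $ j $ l) x + partial j (\<lambda>y. G y $ i $ l) x - partial l (\<lambda>y. G y $ i $ j) x) / 2"
proof -
  define B where "B = matrix_inv (G x)"
  define X where "X = (\<lambda>l. partial i (\<lambda>y. G y $ j $ l) x + partial j (\<lambda>y. G y $ i $ l) x - partial l (\<lambda>y. G y $ i $ j) x)"
  have "G x ** B = mat 1"
    unfolding B_def by (rule lorentz_frame_inverse[OF G_sym[OF x] on22[OF x] on33[OF x] on23[OF x]])
  then have B: "G x $ l $ 1 * B $ 1 $ m + G x $ l $ 2 * B $ 2 $ m = (if l = m then 1 else 0)" for l m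
    by (auto simp: vec_eq_iff matrix_matrix_mult_def mat_def sum_2)
  have "(\<Sum>k\<in>UNIV. G x $ l $ k * Chr G x k i j)
    = 1/2 * ((G x $ l $ 1 * B $ 1 $ 1 + G x $ l $ 2 * B $ 2 $ 1) * X 1 + (G x $ l $ 1 * B $ 1 $ 2 + G x $ l $ 2 * B $ 2 $ 2) * X 2)"
    unfolding Chr_def B_def[symmetric] X_def by (simp add: sum_2 algebra_simps)
  also have "\<dots> = X l / 2" unfolding B using exhaust_2[of l] by auto
  finally show ?thesis by (simp add: X_def)
qed

lemma G_differentiable: "x \<in> Om \<Longrightarrow> (\<lambda>y. G y $ i $ j) differentiable at x"
  by (rule smooth_on_differentiable[OF smooth_on_vec_nth[OF Om smooth_on_vec_nth[OF Om G_smooth]]])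

lemma partial_sym: "x \<in> Om \<Longrightarrow> partial k (\<lambda>y. G y $ i $ j) x = partial k (\<lambda>y. G y $ j $ i) x"
  unfolding partial_def
  by (rule fun_cong[OF frechet_derivative_transform_within_open[OF _ Om]])
    (use G_sym G_differentiable in auto)

lemma Gam_sym:
  assumes "x \<in> Om"
  shows "Gam G x u v = Gam G x v u"
proof -
  have "Chr G x k i j = Chr G x k j i" for k i j
    unfolding Chr_def using partial_sym[OF assms] by (simp add: add.commute)
  then show ?thesis by (simp add: Gam_def vec_eq_iff sum_2 algebra_simps)
qed

lemma gform_Gam:
  assumes x: "x \<in> Om"
  shows "gform (G x) (Gam G x v Y) Z = (\<Sum>l\<in>UNIV. \<Sum>i\<in>UNIV. \<Sum>j\<in>UNIV.
    (partial i (\<lambda>y. G y $ j $ l) x + partial j (\<lambda>y. G y $ i $ l) x - partial l (\<lambda>y. G y $ i $ j) x) / 2 * v $ i * Y $ j * Z $ l)"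
proof -
  have "gform (G x) (Gam G x v Y) Z = gform (G x) Z (Gam G x v Y)" by (rule gcom[OF x])
  also have "\<dots> = (\<Sum>l\<in>UNIV. \<Sum>i\<in>UNIV. \<Sum>j\<in>UNIV. (\<Sum>k\<in>UNIV. G x $ l $ k * Chr G x k i j) * v $ i * Y $ j * Z $ l)"
    by (simp add: gform_def Gam_def sum_2 algebra_simps)
  finally show ?thesis unfolding lowered_christoffel[OF x] .
qed

lemma fd_G: "x \<in> Om \<Longrightarrow> fd (\<lambda>y. G y $ i $ j) x v = (\<Sum>k\<in>UNIV. v $ k * partial k (\<lambda>y. G y $ i $ j) x)"
  by (subst fd_vec2) (auto intro: G_differentiable simp: partial_def sum_2)

text \<open>The connection is compatible with the metric: after lowering the index, the Christoffel terms add up to the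
  derivative of the metric coefficients.\<close>

lemma gform_has_derivative:
  assumes x: "x \<in> Om" and Y: "(Y has_derivative Y') (at x)" and Z: "(Z has_derivative Z') (at x)"
  shows "((\<lambda>y. gform (G y) (Y y) (Z y)) has_derivative
    (\<lambda>v. gform (G x) (Y' v + Gam G x v (Y x)) (Z x) + gform (G x) (Y x) (Z' v + Gam G x v (Z x)))) (at x)"
proof -
  have dG: "((\<lambda>y. G y $ i $ j) has_derivative fd (\<lambda>y. G y $ i $ j) x) (at x)" for i j
    by (rule smooth_on_has_derivative[OF _ x]) (intro smooth_on_vec_nth Om G_smooth)
  have dY: "((\<lambda>y. Y y $ i) has_derivative (\<lambda>v. Y' v $ i)) (at x)" for i
    by (rule bounded_linear.has_derivative[OF bounded_linear_vec_nth Y])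
  have dZ: "((\<lambda>y. Z y $ i) has_derivative (\<lambda>v. Z' v $ i)) (at x)" for i
    by (rule bounded_linear.has_derivative[OF bounded_linear_vec_nth Z])
  have d: "((\<lambda>y. gform (G y) (Y y) (Z y)) has_derivative (\<lambda>v. \<Sum>i\<in>UNIV. \<Sum>j\<in>UNIV.
      G x $ i $ j * Y x $ i * Z' v $ j + (G x $ i $ j * Y' v $ i + fd (\<lambda>y. G y $ i $ j) x v * Y x $ i) * Z x $ j)) (at x)"
    unfolding gform_def
    by (intro has_derivative_sum has_derivative_mult dG dY dZ)
  have "(\<Sum>i\<in>UNIV. \<Sum>j\<in>UNIV.
      G x $ i $ j * Y x $ i * Z' v $ j + (G x $ i $ j * Y' v $ i + fd (\<lambda>y. G y $ i $ j) x v * Y x $ i) * Z x $ j)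
    = gform (G x) (Y' v + Gam G x v (Y x)) (Z x) + gform (G x) (Y x) (Z' v + Gam G x v (Z x))" for v
  proof -
    have "(\<Sum>i\<in>UNIV. \<Sum>j\<in>UNIV. fd (\<lambda>y. G y $ i $ j) x v * Y x $ i * Z x $ j) =
      gform (G x) (Gam G x v (Y x)) (Z x) + gform (G x) (Gam G x v (Z x)) (Y x)"
      unfolding gform_Gam[OF x] fd_G[OF x] sum_2 partial_sym[OF x, of _ 2 1]
      by (simp add: field_simps)
    then show ?thesis
      unfolding gform_simps gcom[OF x, of "Y x" "Gam G x v (Z x)"]
      by (simp add: gform_def sum_2 algebra_simps)
  qed
  with d show ?thesis by simp
qed

lemma frame_has_derivative:
  assumes "x \<in> Om"
  shows "(e2 has_derivative fd e2 x) (at x)" "(e3 has_derivative fd e3 x) (at x)"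
    "(ep has_derivative fd ep x) (at x)" "(em has_derivative fd em x) (at x)"
  by (auto intro: smooth_on_has_derivative e2_smooth e3_smooth ep_smooth em_smooth assms)

lemma fd_ep: "x \<in> Om \<Longrightarrow> fd ep x v = fd e2 x v + fd e3 x v"
  and fd_em: "x \<in> Om \<Longrightarrow> fd em x v = fd e2 x v - fd e3 x v"
  unfolding ep_def em_def
  by (subst fd_eqI[OF has_derivative_add[OF frame_has_derivative(1,2)]]
     fd_eqI[OF has_derivative_diff[OF frame_has_derivative(1,2)]]; simp)+

lemma const_derivative:
  assumes x: "x \<in> Om" and c: "\<And>y. y \<in> Om \<Longrightarrow> f y = c" and d: "(f has_derivative f') (at x)"
  shows "f' v = (0::real)"
proof -
  have "((\<lambda>y. c) has_derivative f') (at x)"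
    by (rule has_derivative_transform_within_open[OF d Om x c])
  from has_derivative_unique[OF this has_derivative_const] show ?thesis by simp
qed

lemma nabla_e2: assumes x: "x \<in> Om" shows "nabla G e2 x v = om x v *\<^sub>R e3 x"
  and nabla_e3: "nabla G e3 x v = om x v *\<^sub>R e2 x"
proof -
  note d = frame_has_derivative(1,2)[OF x]
  have 22: "gform (G x) (nabla G e2 x v) (e2 x) = 0"
    using const_derivative[OF x on22 gform_has_derivative[OF x d(1) d(1)], of v]
    by (simp add: nabla_def gcom[OF x, of "e2 x"])
  have 33: "gform (G x) (nabla G e3 x v) (e3 x) = 0"
    using const_derivative[OF x on33 gform_has_derivative[OF x d(2) d(2)], of v]
    by (simp add: nabla_def gcom[OF x, of "e3 x"])
  have 23: "gform (G x) (nabla G e2 x v) (e3 x) + gform (G x) (nabla G e3 x v) (e2 x) = 0"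
    using const_derivative[OF x on23 gform_has_derivative[OF x d(1) d(2)], of v]
    by (simp add: nabla_def gcom[OF x, of "e2 x" "_ + _"])
  show "nabla G e2 x v = om x v *\<^sub>R e3 x"
    using expand[OF x, of "nabla G e2 x v"] 22 by (simp add: om_def)
  have "gform (G x) (nabla G e3 x v) (e2 x) = - om x v" using 23 by (simp add: om_def)
  then show "nabla G e3 x v = om x v *\<^sub>R e2 x"
    using expand[OF x, of "nabla G e3 x v"] 33 by simp
qed

lemma nabla_ep: assumes x: "x \<in> Om" shows "nabla G ep x v = om x v *\<^sub>R ep x"
  and nabla_em: "nabla G em x v = - om x v *\<^sub>R em x"
proof -
  have "nabla G ep x v = nabla G e2 x v + nabla G e3 x v" "nabla G em x v = nabla G e2 x v - nabla G e3 x v"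
    by (simp_all add: nabla_def fd_ep[OF x] fd_em[OF x]) (simp_all add: ep_def em_def Gam_linear)
  then show "nabla G ep x v = om x v *\<^sub>R ep x" "nabla G em x v = - om x v *\<^sub>R em x"
    by (simp_all add: nabla_e2[OF x] nabla_e3[OF x]) (simp_all add: ep_def em_def algebra_simps)
qed

text \<open>The connection is torsion free, so the bracket of \<open>e\<^sub>+\<close> and \<open>e\<^sub>-\<close> is the difference of the covariant
  derivatives.\<close>

lemma bracket_null: assumes x: "x \<in> Om"
  shows "fd em x (ep x) - fd ep x (em x) = - (om x (ep x) *\<^sub>R em x) - om x (em x) *\<^sub>R ep x"
proof -
  have "fd em x (ep x) = - om x (ep x) *\<^sub>R em x - Gam G x (ep x) (em x)"
    using nabla_em[OF x, of "ep x"] by (simp add: nabla_def eq_diff_eq)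
  moreover have "fd ep x (em x) = om x (em x) *\<^sub>R ep x - Gam G x (em x) (ep x)"
    using nabla_ep[OF x, of "em x"] by (simp add: nabla_def eq_diff_eq)
  ultimately show ?thesis by (simp add: Gam_sym[OF x, of "ep x" "em x"])
qed

lemma om_linear: "x \<in> Om \<Longrightarrow> om x (a *\<^sub>R u + b *\<^sub>R v) = a * om x u + b * om x v"
  using fd_linear[OF smooth_on_differentiable[OF e2_smooth]]
  by (simp add: om_def nabla_def linear_add linear_scale Gam_linear gform_simps algebra_simps)

text \<open>The connection form is determined by the bracket of the frame fields. This is what makes it independent of
  the chart, since brackets, unlike Christoffel symbols, are geometric.\<close>

lemma om_bracket: assumes x: "x \<in> Om"
  shows "om x v = gform (G x) v (e2 x) * gform (G x) (fd e3 x (e2 x) - fd e2 x (e3 x)) (e2 x)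
    - gform (G x) v (e3 x) * gform (G x) (fd e3 x (e2 x) - fd e2 x (e3 x)) (e3 x)"
proof -
  have b: "fd e3 x (e2 x) - fd e2 x (e3 x) = om x (e2 x) *\<^sub>R e2 x - om x (e3 x) *\<^sub>R e3 x"
  proof -
    have "fd e3 x (e2 x) = om x (e2 x) *\<^sub>R e2 x - Gam G x (e2 x) (e3 x)"
      using nabla_e3[OF x, of "e2 x"] by (simp add: nabla_def eq_diff_eq)
    moreover have "fd e2 x (e3 x) = om x (e3 x) *\<^sub>R e3 x - Gam G x (e3 x) (e2 x)"
      using nabla_e2[OF x, of "e3 x"] by (simp add: nabla_def eq_diff_eq)
    ultimately show ?thesis by (simp add: Gam_sym[OF x, of "e2 x" "e3 x"])
  qed
  have "om x v = - gform (G x) v (e2 x) * om x (e2 x) + gform (G x) v (e3 x) * om x (e3 x)"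
    using om_linear[OF x] expand[OF x, of v] by metis
  then show ?thesis unfolding b by (simp add: gform_simps on22 on33 on23 on32 x)
qed

lemma fd_form_linear:
  fixes \<beta> :: "real^2 \<Rightarrow> real^2 \<Rightarrow> 'b::real_normed_vector"
  assumes x: "x \<in> Om" and \<beta>: "\<And>v. smooth_on Om (\<lambda>y. \<beta> y v)" "\<And>y. y \<in> Om \<Longrightarrow> linear (\<beta> y)"
  shows "fd (\<lambda>y. \<beta> y (a *\<^sub>R u + b *\<^sub>R v)) x w = a *\<^sub>R fd (\<lambda>y. \<beta> y u) x w + b *\<^sub>R fd (\<lambda>y. \<beta> y v) x w"
proof -
  have d: "((\<lambda>y. \<beta> y w) has_derivative fd (\<lambda>y. \<beta> y w) x) (at x)" for w
    by (rule smooth_on_has_derivative[OF \<beta>(1) x])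
  have s: "((\<lambda>y. a *\<^sub>R \<beta> y u + b *\<^sub>R \<beta> y v) has_derivative
      (\<lambda>w. a *\<^sub>R fd (\<lambda>y. \<beta> y u) x w + b *\<^sub>R fd (\<lambda>y. \<beta> y v) x w)) (at x)"
    by (intro has_derivative_add bounded_linear.has_derivative[OF bounded_linear_scaleR_right] d)
  have t: "a *\<^sub>R \<beta> y u + b *\<^sub>R \<beta> y v = \<beta> y (a *\<^sub>R u + b *\<^sub>R v)" if "y \<in> Om" for y
    using \<beta>(2)[OF that] by (simp add: linear_add linear_scale)
  have "((\<lambda>y. \<beta> y (a *\<^sub>R u + b *\<^sub>R v)) has_derivative
      (\<lambda>w. a *\<^sub>R fd (\<lambda>y. \<beta> y u) x w + b *\<^sub>R fd (\<lambda>y. \<beta> y v) x w)) (at x)"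
    by (rule has_derivative_transform_within_open[OF s Om x t])
  then show ?thesis by (simp add: fd_eqI)
qed

lemma fd_smooth_form:
  assumes "smooth_on Om \<Phi>"
  shows "smooth_on Om (\<lambda>y. fd \<Phi> y v)" "y \<in> Om \<Longrightarrow> linear (fd \<Phi> y)"
  using assms by (auto intro: smooth_on_frechet_derivative fd_linear smooth_on_differentiable)

text \<open>The second fundamental form may be computed with any extension of the second argument to a vector field:
  the derivatives of the extension cancel.\<close>

lemma II_field:
  assumes x: "x \<in> Om" and \<Phi>: "smooth_on Om \<Phi>" and Y: "Y differentiable at x"
  shows "fd (\<lambda>y. fd \<Phi> y (Y y)) x v - fd \<Phi> x (nabla G Y x v) = II G \<Phi> x v (Y x)"
proof -
  have "fd (\<lambda>y. fd \<Phi> y (Y y)) x v = fd (\<lambda>y. fd \<Phi> y (Y x)) x v + fd \<Phi> x (fd Y x v)"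
    using fd_eqI[OF fd_along_field[OF Om x fd_smooth_form[OF \<Phi>] has_frechet_derivative[OF Y]]] by simp
  then show ?thesis
    by (simp add: II_def nabla_def linear_add[OF fd_smooth_form(2)[OF \<Phi> x]])
qed

lemma II_linear:
  assumes x: "x \<in> Om" and \<Phi>: "smooth_on Om \<Phi>"
  shows "II G \<Phi> x w (a *\<^sub>R u + b *\<^sub>R v) = a *\<^sub>R II G \<Phi> x w u + b *\<^sub>R II G \<Phi> x w v"
    and "II G \<Phi> x (a *\<^sub>R u + b *\<^sub>R v) w = a *\<^sub>R II G \<Phi> x u w + b *\<^sub>R II G \<Phi> x v w"
proof -
  have l: "linear (fd (\<lambda>y. fd \<Phi> y w) x)" for w
    by (rule fd_linear[OF smooth_on_differentiable[OF fd_smooth_form(1)[OF \<Phi>] x]])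
  note lin = linear_add[OF l] linear_scale[OF l] linear_add[OF fd_smooth_form(2)[OF \<Phi> x]]
    linear_scale[OF fd_smooth_form(2)[OF \<Phi> x]]
  show "II G \<Phi> x w (a *\<^sub>R u + b *\<^sub>R v) = a *\<^sub>R II G \<Phi> x w u + b *\<^sub>R II G \<Phi> x w v"
  proof -
    have "fd (\<lambda>y. fd \<Phi> y (a *\<^sub>R u + b *\<^sub>R v)) x w = a *\<^sub>R fd (\<lambda>y. fd \<Phi> y u) x w + b *\<^sub>R fd (\<lambda>y. fd \<Phi> y v) x w"
      by (rule fd_form_linear[OF x]) (use fd_smooth_form[OF \<Phi>] in auto)
    then show ?thesis unfolding II_def by (simp add: Gam_linear lin algebra_simps)
  qed
  show "II G \<Phi> x (a *\<^sub>R u + b *\<^sub>R v) w = a *\<^sub>R II G \<Phi> x u w + b *\<^sub>R II G \<Phi> x v w"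
    unfolding II_def by (simp add: Gam_linear lin algebra_simps)
qed

lemma II_sym:
  fixes \<Phi> :: "real^2 \<Rightarrow> real^'n"
  assumes x: "x \<in> Om" and \<Phi>: "smooth_on Om \<Phi>"
  shows "II G \<Phi> x u v = II G \<Phi> x v u"
  unfolding II_def using second_derivative_symmetric[OF Om x smooth_onD[OF \<Phi>], of u v] Gam_sym[OF x, of u v] by simp

lemma II_expand:
  assumes x: "x \<in> Om" and \<Phi>: "smooth_on Om \<Phi>"
  shows "II G \<Phi> x u v = (\<Sum>i\<in>UNIV. \<Sum>j\<in>UNIV. (u $ i * v $ j) *\<^sub>R II G \<Phi> x (axis i 1) (axis j 1))"
proof -
  have "II G \<Phi> x u v = II G \<Phi> x (u $ 1 *\<^sub>R axis 1 1 + u $ 2 *\<^sub>R axis 2 1) (v $ 1 *\<^sub>R axis 1 1 + v $ 2 *\<^sub>R axis 2 1)"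
    by (simp only: vec2_expand[symmetric])
  then show ?thesis by (simp add: II_linear[OF x \<Phi>] sum_2 scaleR_add_right add_ac mult.commute)
qed

text \<open>The inverse metric is \<open>- e\<^sub>2 e\<^sub>2 + e\<^sub>3 e\<^sub>3 = - (e\<^sub>+ e\<^sub>- + e\<^sub>- e\<^sub>+) / 2\<close>.\<close>

lemma mean_curvature_null:
  assumes x: "x \<in> Om" and \<Phi>: "smooth_on Om \<Phi>"
  shows "(1/2) *\<^sub>R (\<Sum>i\<in>UNIV. \<Sum>j\<in>UNIV. matrix_inv (G x) $ i $ j *\<^sub>R II G \<Phi> x (axis i 1) (axis j 1)) =
    - (1/4) *\<^sub>R (II G \<Phi> x (ep x) (em x) + II G \<Phi> x (em x) (ep x))"
proof -
  have "(1/2) *\<^sub>R (\<Sum>i\<in>UNIV. \<Sum>j\<in>UNIV. matrix_inv (G x) $ i $ j *\<^sub>R II G \<Phi> x (axis i 1) (axis j 1)) =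
      (\<Sum>i\<in>UNIV. \<Sum>j\<in>UNIV. (1/2 * (e3 x $ i * e3 x $ j - e2 x $ i * e2 x $ j)) *\<^sub>R II G \<Phi> x (axis i 1) (axis j 1))"
    unfolding lorentz_frame_inverse(1)[OF G_sym[OF x] on22[OF x] on33[OF x] on23[OF x]]
    by (simp add: scaleR_sum_right)
  also have "\<dots> = (\<Sum>i\<in>UNIV. \<Sum>j\<in>UNIV. (- (1/4) * (ep x $ i * em x $ j + em x $ i * ep x $ j)) *\<^sub>R II G \<Phi> x (axis i 1) (axis j 1))"
    by (intro sum.cong refl arg_cong2[of _ _ _ _ "(*\<^sub>R)"]) (simp add: ep_def em_def algebra_simps)
  also have "\<dots> = - (1/4) *\<^sub>R (II G \<Phi> x (ep x) (em x) + II G \<Phi> x (em x) (ep x))"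
    unfolding II_expand[OF x \<Phi>, of "ep x" "em x"] II_expand[OF x \<Phi>, of "em x" "ep x"]
      sum.distrib[symmetric] scaleR_left.add[symmetric] scaleR_sum_right scaleR_scaleR ..
  finally show ?thesis .
qed

text \<open>\<open>d\<beta>(e\<^sub>+,e\<^sub>-) = e\<^sub>+(\<beta>(e\<^sub>-)) - e\<^sub>-(\<beta>(e\<^sub>+)) - \<beta>([e\<^sub>+,e\<^sub>-])\<close>, and in dimension 2 this single value
  decides whether \<open>\<beta>\<close> is closed.\<close>

lemma closed_form_criterion:
  fixes \<beta> :: "real^2 \<Rightarrow> real^2 \<Rightarrow> 'b::real_normed_vector"
  assumes x: "x \<in> Om" and \<beta>: "\<And>v. smooth_on Om (\<lambda>y. \<beta> y v)" "\<And>y. y \<in> Om \<Longrightarrow> linear (\<beta> y)"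
    and PQ: "\<And>y. y \<in> Om \<Longrightarrow> \<beta> y (ep y) = P y" "\<And>y. y \<in> Om \<Longrightarrow> \<beta> y (em y) = Q y"
    and eq: "fd Q x (ep x) + om x (ep x) *\<^sub>R Q x = fd P x (em x) - om x (em x) *\<^sub>R P x"
  shows "fd (\<lambda>y. \<beta> y v) x w = fd (\<lambda>y. \<beta> y w) x v"
proof -
  define B where "B = (\<lambda>v w. fd (\<lambda>y. \<beta> y v) x w)"
  have B1: "B (a *\<^sub>R u + b *\<^sub>R v) w = a *\<^sub>R B u w + b *\<^sub>R B v w" for a b u v w
    unfolding B_def by (rule fd_form_linear[OF x \<beta>])
  have l: "linear (B v)" for v
    unfolding B_def by (rule fd_linear[OF smooth_on_differentiable[OF \<beta>(1) x]])
  have B2: "B w (a *\<^sub>R u + b *\<^sub>R v) = a *\<^sub>R B w u + b *\<^sub>R B w v" for a b u v w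
    by (simp add: linear_add[OF l] linear_scale[OF l])
  have tr: "fd R x = fd (\<lambda>y. \<beta> y (Y y)) x" if "\<And>y. y \<in> Om \<Longrightarrow> \<beta> y (Y y) = R y" "(Y has_derivative fd Y x) (at x)" for R Y
  proof (rule fd_eqI)
    have "((\<lambda>y. \<beta> y (Y y)) has_derivative fd (\<lambda>y. \<beta> y (Y y)) x) (at x)"
      using fd_along_field[OF Om x \<beta> that(2)] fd_eqI by (intro has_frechet_derivative) (auto simp: differentiable_def)
    then show "(R has_derivative fd (\<lambda>y. \<beta> y (Y y)) x) (at x)"
      by (rule has_derivative_transform_within_open[OF _ Om x that(1)])
  qed
  note d = frame_has_derivative(3,4)[OF x]
  have "fd P x (em x) = B (ep x) (em x) + \<beta> x (fd ep x (em x))"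
  proof -
    have "fd P x = fd (\<lambda>y. \<beta> y (ep y)) x" by (rule tr[OF PQ(1) d(1)])
    also have "\<dots> = (\<lambda>v. fd (\<lambda>y. \<beta> y (ep x)) x v + \<beta> x (fd ep x v))" by (rule fd_eqI[OF fd_along_field[OF Om x \<beta> d(1)]])
    finally show ?thesis by (simp add: B_def)
  qed
  moreover have "fd Q x (ep x) = B (em x) (ep x) + \<beta> x (fd em x (ep x))"
  proof -
    have "fd Q x = fd (\<lambda>y. \<beta> y (em y)) x" by (rule tr[OF PQ(2) d(2)])
    also have "\<dots> = (\<lambda>v. fd (\<lambda>y. \<beta> y (em x)) x v + \<beta> x (fd em x v))" by (rule fd_eqI[OF fd_along_field[OF Om x \<beta> d(2)]])
    finally show ?thesis by (simp add: B_def)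
  qed
  moreover have "\<beta> x (fd em x (ep x)) - \<beta> x (fd ep x (em x)) = - (om x (ep x) *\<^sub>R Q x) - om x (em x) *\<^sub>R P x"
    using arg_cong[OF bracket_null[OF x], of "\<beta> x"] PQ[OF x] \<beta>(2)[OF x]
    by (simp add: linear_diff linear_neg linear_scale)
  ultimately have "B (em x) (ep x) - B (ep x) (em x) = 0"
    using eq by (simp add: algebra_simps)
  then have s: "B (em x) (ep x) = B (ep x) (em x)" by simp
  have "B v w = B w v"
  proof -
    obtain a b c d where v: "v = a *\<^sub>R ep x + b *\<^sub>R em x" and w: "w = c *\<^sub>R ep x + d *\<^sub>R em x"
      using null_expand[OF x] by blast
    show ?thesis unfolding v w B1 B2 s by (simp add: algebra_simps)
  qed
  then show ?thesis by (simp add: B_def)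
qed

text \<open>The 1-form that sends the null frame \<open>e\<^sub>+, e\<^sub>-\<close> to \<open>P, Q\<close>.\<close>

definition frame_form :: "(real^2 \<Rightarrow> 'b::real_normed_vector) \<Rightarrow> (real^2 \<Rightarrow> 'b) \<Rightarrow> real^2 \<Rightarrow> real^2 \<Rightarrow> 'b" where
  "frame_form P Q x v = (- 1 / 2 * gform (G x) v (em x)) *\<^sub>R P x + (- 1 / 2 * gform (G x) v (ep x)) *\<^sub>R Q x"

lemma gform_smooth:
  assumes "smooth_on Om Y" "smooth_on Om Z"
  shows "smooth_on Om (\<lambda>x. gform (G x) (Y x) (Z x))"
  unfolding gform_def
  by (intro smooth_on_sum smooth_on_mult smooth_on_vec_nth Om G_smooth assms)

lemma frame_form:
  shows "linear (frame_form P Q x)"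
    and "x \<in> Om \<Longrightarrow> frame_form P Q x (ep x) = P x" and "x \<in> Om \<Longrightarrow> frame_form P Q x (em x) = Q x"
  by (auto intro!: linearI simp: frame_form_def gform_simps null algebra_simps)

lemma frame_form_smooth:
  assumes "smooth_on Om P" "smooth_on Om Q"
  shows "smooth_on Om (\<lambda>x. frame_form P Q x v)"
proof -
  have "smooth_on Om (\<lambda>x. ((- 1 / 2) * gform (G x) v (em x)) *\<^sub>R P x + ((- 1 / 2) * gform (G x) v (ep x)) *\<^sub>R Q x)"
    by (intro smooth_on_add smooth_on_scaleR smooth_on_mult gform_smooth smooth_on_const Om assms ep_smooth em_smooth)
  then show ?thesis by (simp add: frame_form_def)
qed

lemma frame_form_unique:
  assumes x: "x \<in> Om" and L: "linear L" "L (ep x) = P x" "L (em x) = Q x"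
  shows "L = frame_form P Q x"
proof
  fix v
  have "L v = L ((- 1 / 2 * gform (G x) v (em x)) *\<^sub>R ep x + (- 1 / 2 * gform (G x) v (ep x)) *\<^sub>R em x)"
    using null_expand[OF x, of v] by simp
  also have "\<dots> = frame_form P Q x v"
    by (simp only: linear_add[OF L(1)] linear_scale[OF L(1)] L(2,3) frame_form_def)
  finally show "L v = frame_form P Q x v" .
qed

end

lemma lor_linear: "lor (u + v) w = lor u w + lor v w" "lor w (u + v) = lor w u + lor w v"
  "lor (a *\<^sub>R u) w = a * lor u w" "lor w (a *\<^sub>R u) = a * lor w u"
  by (simp_all add: lor_def algebra_simps)

lemma lor_commute: "lor u v = lor v u" by (simp add: lor_def algebra_simps)

lemma (in chart_frame) frame_form_isometric:
  assumes x: "x \<in> Om" and PQ: "lor (P x) (P x) = 0" "lor (Q x) (Q x) = 0" "lor (P x) (Q x) = -2"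
  shows "lor (frame_form P Q x v) (frame_form P Q x w) = gform (G x) v w"
proof -
  have "gform (G x) v w = gform (G x) ((- 1 / 2 * gform (G x) v (em x)) *\<^sub>R ep x + (- 1 / 2 * gform (G x) v (ep x)) *\<^sub>R em x) w"
    using null_expand[OF x, of v] by simp
  also have "\<dots> = lor (frame_form P Q x v) (frame_form P Q x w)"
    using PQ lor_commute[of "Q x" "P x"] gcom[OF x, of w]
    unfolding frame_form_def lor_linear gform_simps by (simp add: algebra_simps)
  finally show ?thesis by simp
qed

section \<open>Spinors and orthonormal frames\<close>

definition vec3 :: "complex \<Rightarrow> real \<Rightarrow> real^3" where
  "vec3 c t = vector [Re c, Im c, t]"

lemma vec3_nth [simp]: "vec3 c t $ 1 = Re c" "vec3 c t $ 2 = Im c" "vec3 c t $ 3 = t"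
  by (simp_all add: vec3_def)

lemma vec3_eq_iff: "u = vec3 c t \<longleftrightarrow> u $ 1 = Re c \<and> u $ 2 = Im c \<and> u $ 3 = t"
  by (simp add: vec_eq_iff forall_3)

text \<open>The frame of \<open>R\<^sup>2\<^sup>,\<^sup>1\<close> belonging to a spinor with components \<open>z, w\<close>: two null vectors and their normal. They are
  the values of the quadratic map from spinors to vectors, written out in coordinates.\<close>

definition frame_plus :: "complex \<Rightarrow> real^3" where "frame_plus z = vec3 (z\<^sup>2) ((cmod z)\<^sup>2)"
definition frame_minus :: "complex \<Rightarrow> real^3" where "frame_minus w = vec3 (w\<^sup>2) (- (cmod w)\<^sup>2)"
definition frame_normal :: "complex \<Rightarrow> complex \<Rightarrow> real^3" where
  "frame_normal z w = vec3 (\<i> * z * w) (Im (z * cnj w))"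

lemmas frame_defs = frame_plus_def frame_minus_def frame_normal_def

lemma frame_explicit:
  "frame_plus z = vec3 (z * z) (Re z * Re z + Im z * Im z)"
  "frame_minus w = vec3 (w * w) (- (Re w * Re w + Im w * Im w))"
  unfolding frame_plus_def frame_minus_def cmod_power2 unfolding power2_eq_square by (rule refl)+

lemma frame_lor:
  "lor (frame_plus z) (frame_plus z) = 0"
  "lor (frame_minus w) (frame_minus w) = 0"
  "lor (frame_plus z) (frame_minus w) = - 2 * (Re (z * cnj w))\<^sup>2"
  "lor (frame_normal z w) (frame_normal z w) = - (Re (z * cnj w))\<^sup>2"
  "lor (frame_normal z w) (frame_plus z) = 0"
  "lor (frame_normal z w) (frame_minus w) = 0"
  by (simp_all add: frame_explicit frame_normal_def lor_def power2_eq_square algebra_simps)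

lemma spinor_product_self: "spinor_product \<psi> \<psi> = - Re (\<psi> $ 1 * cnj (\<psi> $ 2))"
  by (simp add: spinor_product_def)

text \<open>The weights are those of \<open>e\<^sub>+\<close>, \<open>e\<^sub>-\<close> and a vector independent of the frame, so that the frame of a spinor does
  not depend on the spinorial frame in which it is computed.\<close>

lemma frame_act:
  assumes "a \<noteq> (0::real)"
  shows "frame_plus (of_real (inverse a) * z) = inverse (a\<^sup>2) *\<^sub>R frame_plus z"
    and "frame_minus (of_real a * w) = a\<^sup>2 *\<^sub>R frame_minus w"
    and "frame_normal (of_real (inverse a) * z) (of_real a * w) = frame_normal z w"
  using assms by (simp_all add: frame_explicit frame_normal_def vec_eq_iff forall_3 power2_eq_square field_simps)

lemma bounded_linear_vec3: "bounded_linear (\<lambda>p. vec3 (fst p) (snd p))"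
proof -
  have "linear (\<lambda>p. vec3 (fst p) (snd p))" by (intro linearI) (simp_all add: vec_eq_iff forall_3)
  then show ?thesis by (simp add: linear_conv_bounded_linear)
qed

lemma vec3_has_derivative:
  assumes "(f has_derivative f') (at x)" "(g has_derivative g') (at x)"
  shows "((\<lambda>x. vec3 (f x) (g x)) has_derivative (\<lambda>v. vec3 (f' v) (g' v))) (at x)"
  using bounded_linear.has_derivative[OF bounded_linear_vec3 has_derivative_Pair[OF assms]] by simp

lemma cmod_square_has_derivative:
  assumes "(z has_derivative z') (at x)"
  shows "((\<lambda>x. (cmod (z x))\<^sup>2) has_derivative (\<lambda>v. 2 * Re (z' v * cnj (z x)))) (at x)"
proof -
  have "((\<lambda>x. Re (z x) * Re (z x) + Im (z x) * Im (z x)) has_derivative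
     (\<lambda>v. (Re (z x) * Re (z' v) + Re (z' v) * Re (z x)) + (Im (z x) * Im (z' v) + Im (z' v) * Im (z x)))) (at x)"
    by (intro has_derivative_add has_derivative_mult bounded_linear.has_derivative[OF bounded_linear_Re assms]
        bounded_linear.has_derivative[OF bounded_linear_Im assms])
  then show ?thesis unfolding cmod_power2 by (simp add: power2_eq_square algebra_simps)
qed

lemma frame_plus_has_derivative:
  assumes "(z has_derivative z') (at x)"
  shows "((\<lambda>x. frame_plus (z x)) has_derivative (\<lambda>v. vec3 (2 * z x * z' v) (2 * Re (z' v * cnj (z x))))) (at x)"
proof -
  have "((\<lambda>x. (z x)\<^sup>2) has_derivative (\<lambda>v. 2 * z x * z' v)) (at x)"
    using has_derivative_mult[OF assms assms] by (simp add: power2_eq_square algebra_simps)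
  then show ?thesis unfolding frame_plus_def by (intro vec3_has_derivative cmod_square_has_derivative assms)
qed

lemma frame_minus_has_derivative:
  assumes "(w has_derivative w') (at x)"
  shows "((\<lambda>x. frame_minus (w x)) has_derivative (\<lambda>v. vec3 (2 * w x * w' v) (- (2 * Re (w' v * cnj (w x)))))) (at x)"
proof -
  have "((\<lambda>x. (w x)\<^sup>2) has_derivative (\<lambda>v. 2 * w x * w' v)) (at x)"
    using has_derivative_mult[OF assms assms] by (simp add: power2_eq_square algebra_simps)
  then show ?thesis unfolding frame_minus_def
    by (intro vec3_has_derivative has_derivative_minus cmod_square_has_derivative assms)
qed

lemma dirac_imp_gauss:
  assumes "w' = - of_real (k / 2) * w - \<i> * of_real H * z"
  shows "vec3 (2 * w * w') (- (2 * Re (w' * cnj w))) + k *\<^sub>R frame_minus w = (- 2 * H) *\<^sub>R frame_normal z w"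
  unfolding assms by (simp add: frame_explicit frame_normal_def vec_eq_iff forall_3 algebra_simps)

lemma dirac_imp_gauss':
  assumes "z' = of_real (k / 2) * z - \<i> * of_real H * w"
  shows "vec3 (2 * z * z') (2 * Re (z' * cnj z)) - k *\<^sub>R frame_plus z = (- 2 * H) *\<^sub>R frame_normal z w"
  unfolding assms by (simp add: frame_explicit frame_normal_def vec_eq_iff forall_3 algebra_simps)

text \<open>The complex part of \<open>E\<^sub>-\<close> is \<open>w\<^sup>2\<close>, whose derivative \<open>2 w w'\<close> determines \<open>w'\<close> when \<open>w\<close> does not vanish.\<close>

lemma gauss_imp_dirac:
  assumes "vec3 (2 * w * w') t + k *\<^sub>R frame_minus w = (- 2 * H) *\<^sub>R frame_normal z w" "w \<noteq> 0"
  shows "w' = - of_real (k / 2) * w - \<i> * of_real H * z"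
proof -
  have "2 * w * w' + of_real k * w\<^sup>2 = - 2 * of_real H * (\<i> * z * w)"
    using assms(1) by (simp add: frame_defs vec_eq_iff forall_3 complex_eq_iff)
  moreover have "(2 * w) * w' - (2 * w) * (- of_real (k / 2) * w - \<i> * of_real H * z) =
      (2 * w * w' + of_real k * w\<^sup>2) - (- 2 * of_real H * (\<i> * z * w))"
    by (simp add: power2_eq_square algebra_simps)
  ultimately have "(2 * w) * w' = (2 * w) * (- of_real (k / 2) * w - \<i> * of_real H * z)"
    by simp
  then show ?thesis using assms(2) by simp
qed

lemma gauss_imp_dirac':
  assumes "vec3 (2 * z * z') t - k *\<^sub>R frame_plus z = (- 2 * H) *\<^sub>R frame_normal z w" "z \<noteq> 0"
  shows "z' = of_real (k / 2) * z - \<i> * of_real H * w"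
proof -
  have "2 * z * z' - of_real k * z\<^sup>2 = - 2 * of_real H * (\<i> * z * w)"
    using assms(1) by (simp add: frame_defs vec_eq_iff forall_3 complex_eq_iff)
  moreover have "(2 * z) * z' - (2 * z) * (of_real (k / 2) * z - \<i> * of_real H * w) =
      (2 * z * z' - of_real k * z\<^sup>2) - (- 2 * of_real H * (\<i> * z * w))"
    by (simp add: power2_eq_square algebra_simps)
  ultimately have "(2 * z) * z' = (2 * z) * (of_real (k / 2) * z - \<i> * of_real H * w)"
    by simp
  then show ?thesis using assms(2) by simp
qed

text \<open>A positively oriented frame is determined by one of its null vectors and its normal.\<close>

text \<open>With \<open>c = p\<^sub>1 + i p\<^sub>2\<close> and \<open>m = n\<^sub>1 + i n\<^sub>2\<close>, the product \<open>m cnj c\<close> has real part \<open>n\<^sub>3 p\<^sub>3\<close> because \<open>n\<close> is orthogonal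
  to \<open>p\<close>, and imaginary part \<open>\<plusminus>p\<^sub>3\<close> because \<open>n\<close> is a unit vector. The orientation selects the sign, so that
  \<open>p\<close> and \<open>n\<^sub>3\<close> determine \<open>n\<close>. The second null vector is then determined by its products with \<open>p\<close> and \<open>n\<close>.\<close>

lemma frame_to_spinor:
  fixes p q n :: "real^3" and z :: complex
  assumes pp: "lor p p = 0" and qq: "lor q q = 0" and pq: "lor p q = -2"
    and nn: "lor n n = -1" and np: "lor n p = 0" and nq: "lor n q = 0"
    and pos: "p $ 3 > 0" and orient: "n $ 2 * p $ 1 - n $ 1 * p $ 2 > 0"
    and z: "z\<^sup>2 = Complex (p $ 1) (p $ 2)"
  defines "w \<equiv> (1 - \<i> * of_real (n $ 3)) / cnj z"
  shows "p = frame_plus z" "q = frame_minus w" "n = frame_normal z w" "Re (z * cnj w) = 1" "z \<noteq> 0" "w \<noteq> 0"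
proof -
  have p3: "(p $ 1)\<^sup>2 + (p $ 2)\<^sup>2 = (p $ 3)\<^sup>2" using pp by (simp add: lor_def power2_eq_square)
  have "((cmod z)\<^sup>2)\<^sup>2 = (p $ 3)\<^sup>2"
  proof -
    have "(cmod z)\<^sup>2 = cmod (z\<^sup>2)" by (simp add: norm_power)
    then have "((cmod z)\<^sup>2)\<^sup>2 = (cmod (z\<^sup>2))\<^sup>2" by simp
    then show ?thesis unfolding z using p3 by (simp add: cmod_power2)
  qed
  then have cz: "(cmod z)\<^sup>2 = p $ 3" using pos by (smt (verit) power2_eq_imp_eq zero_le_power2)
  then show z0: "z \<noteq> 0" using pos by auto
  have Rez: "Re (z\<^sup>2) = p $ 1" "Im (z\<^sup>2) = p $ 2" using z by simp_all
  show p_eq: "p = frame_plus z" unfolding frame_plus_def vec3_eq_iff using Rez cz by simp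
  have w0: "1 - \<i> * of_real (n $ 3) \<noteq> 0" by (simp add: complex_eq_iff)
  then show "w \<noteq> 0" using z0 by (simp add: w_def)
  have zw: "z * cnj w = 1 + \<i> * of_real (n $ 3)" using z0 by (simp add: w_def)
  then show re: "Re (z * cnj w) = 1" by simp
  define t where "t = n $ 2 * p $ 1 - n $ 1 * p $ 2"
  have np': "n $ 1 * p $ 1 + n $ 2 * p $ 2 = n $ 3 * p $ 3" using np by (simp add: lor_def)
  have nn': "(n $ 1)\<^sup>2 + (n $ 2)\<^sup>2 = 1 + (n $ 3)\<^sup>2" using nn by (simp add: lor_def power2_eq_square)
  have "t\<^sup>2 + (n $ 3 * p $ 3)\<^sup>2 = ((n $ 1)\<^sup>2 + (n $ 2)\<^sup>2) * ((p $ 1)\<^sup>2 + (p $ 2)\<^sup>2)"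
    unfolding t_def np'[symmetric] by (simp add: power2_eq_square algebra_simps)
  then have "t\<^sup>2 = (p $ 3)\<^sup>2" unfolding nn' p3 by (simp add: power2_eq_square algebra_simps)
  then have t: "t = p $ 3" using pos orient unfolding t_def[symmetric] by (smt (verit) power2_eq_imp_eq)
  have n1: "n $ 1 * p $ 3 = n $ 3 * p $ 1 - p $ 2"
  proof -
    have "n $ 1 * (p $ 3)\<^sup>2 = (n $ 1 * p $ 1 + n $ 2 * p $ 2) * p $ 1 - t * p $ 2"
      unfolding p3[symmetric] t_def by (simp add: power2_eq_square algebra_simps)
    also have "\<dots> = (n $ 3 * p $ 1 - p $ 2) * p $ 3" unfolding np' t by (simp add: algebra_simps)
    finally show ?thesis using pos by (simp add: power2_eq_square)
  qed
  have n2: "n $ 2 * p $ 3 = n $ 3 * p $ 2 + p $ 1"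
  proof -
    have "n $ 2 * (p $ 3)\<^sup>2 = (n $ 1 * p $ 1 + n $ 2 * p $ 2) * p $ 2 + t * p $ 1"
      unfolding p3[symmetric] t_def by (simp add: power2_eq_square algebra_simps)
    also have "\<dots> = (n $ 3 * p $ 2 + p $ 1) * p $ 3" unfolding np' t by (simp add: algebra_simps)
    finally show ?thesis using pos by (simp add: power2_eq_square)
  qed
  show n_eq: "n = frame_normal z w"
  proof -
    have c2: "z * cnj z = of_real (p $ 3)" using cz by (metis complex_norm_square)
    have "(\<i> * z * w) * of_real (p $ 3) = (\<i> + of_real (n $ 3)) * z\<^sup>2"
    proof -
      have wz: "w * cnj z = 1 - \<i> * of_real (n $ 3)" using z0 by (simp add: w_def)
      have "(\<i> * z * w) * (z * cnj z) = \<i> * z * z * (w * cnj z)" by (simp add: algebra_simps)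
      then show ?thesis unfolding c2 wz by (simp add: power2_eq_square algebra_simps)
    qed
    then have "Re (\<i> * z * w) * p $ 3 = n $ 3 * p $ 1 - p $ 2" "Im (\<i> * z * w) * p $ 3 = n $ 3 * p $ 2 + p $ 1"
      unfolding z by (simp_all add: complex_eq_iff)
    then have "Re (\<i> * z * w) = n $ 1" "Im (\<i> * z * w) = n $ 2" using n1 n2 pos by (metis mult_right_cancel less_irrefl)+
    then show ?thesis unfolding frame_normal_def vec3_eq_iff using zw by simp
  qed
  define q' where "q' = frame_minus w"
  \<comment> \<open>The difference of two candidates is orthogonal to \<open>p\<close> and \<open>n\<close>, hence a multiple of \<open>p\<close>, and then
    both can only be null if it vanishes.\<close>
  define d where "d = q - q'"
  have q: "q = q' + d" by (simp add: d_def)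
  have pq': "lor p q' = -2" "lor n q' = 0" "lor q' q' = 0"
    unfolding p_eq n_eq q'_def using frame_lor re by simp_all
  have "lor p d = 0" "lor n d = 0" using pq nq pq' unfolding q lor_linear by simp_all
  then have d1: "d $ 1 * p $ 1 + d $ 2 * p $ 2 = d $ 3 * p $ 3" and d2: "d $ 1 * n $ 1 + d $ 2 * n $ 2 = d $ 3 * n $ 3"
    by (simp_all add: lor_def algebra_simps)
  have "d $ 1 * (n $ 1 * p $ 3) + d $ 2 * (n $ 2 * p $ 3) = n $ 3 * (d $ 3 * p $ 3)"
    using arg_cong[OF d2, of "\<lambda>r. r * p $ 3"] by (simp add: algebra_simps)
  then have dd: "d $ 2 * p $ 1 = d $ 1 * p $ 2"
    unfolding n1 n2 d1[symmetric] by (simp add: algebra_simps)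
  have "d $ 1 * (p $ 3)\<^sup>2 = (d $ 3 * p $ 3) * p $ 1" "d $ 2 * (p $ 3)\<^sup>2 = (d $ 3 * p $ 3) * p $ 2"
    unfolding p3[symmetric] d1[symmetric] using dd by (simp_all add: power2_eq_square algebra_simps)
  then have "d = (d $ 3 / p $ 3) *\<^sub>R p"
    using pos by (simp add: vec_eq_iff forall_3 power2_eq_square field_simps)
  then obtain r where r: "d = r *\<^sub>R p" by blast
  have "lor q q = - 4 * r" unfolding q r lor_linear using pq' pp lor_commute[of q' p] by simp
  then have "r = 0" using qq by simp
  then show "q = frame_minus w" using q r q'_def by simp
qed

section \<open>Square roots of complex functions\<close>

text \<open>For \<open>|u| = 1\<close> this is the square root of \<open>c\<close> on the side of \<open>u\<close>, defined and smooth off the ray of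
  nonnegative multiples of \<open>- u\<^sup>2\<close>: the bisector of \<open>|c| u\<close> and \<open>c cnj u\<close>, normalised.\<close>

definition root_near :: "complex \<Rightarrow> complex \<Rightarrow> complex" where
  "root_near u c = (of_real (cmod c) * u + c * cnj u) / of_real (sqrt (2 * (cmod c + Re (c * (cnj u)\<^sup>2))))"

lemma root_near_square:
  assumes u: "cmod u = 1" and c: "cmod c + Re (c * (cnj u)\<^sup>2) > 0"
  shows "(root_near u c)\<^sup>2 = c"
proof -
  have uu: "u * cnj u = 1" using u by (simp add: complex_norm_square[symmetric])
  have cc: "of_real (cmod c) * of_real (cmod c) = c * cnj c"
    using complex_norm_square[of c] by (simp add: power2_eq_square)
  have "2 * complex_of_real (Re (c * (cnj u)\<^sup>2)) = c * (cnj u)\<^sup>2 + cnj c * u\<^sup>2"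
    using complex_add_cnj[of "c * (cnj u)\<^sup>2"] by simp
  moreover have "(of_real (cmod c) * u + c * cnj u)\<^sup>2 = of_real (cmod c) * of_real (cmod c) * u\<^sup>2 + 2 * of_real (cmod c) * c * (u * cnj u) + c * (c * (cnj u)\<^sup>2)"
    by (simp add: power2_eq_square algebra_simps)
  ultimately have "(of_real (cmod c) * u + c * cnj u)\<^sup>2 = c * (2 * (of_real (cmod c) + of_real (Re (c * (cnj u)\<^sup>2))))"
    unfolding uu cc by (simp add: algebra_simps)
  also have "\<dots> = c * (of_real (sqrt (2 * (cmod c + Re (c * (cnj u)\<^sup>2)))))\<^sup>2"
    using c by (simp flip: of_real_power)
  finally show ?thesis using c unfolding root_near_def by (simp add: power_divide)
qed

lemma exists_root_direction:
  assumes "c \<noteq> 0"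
  shows "\<exists>u. cmod u = 1 \<and> cmod c + Re (c * (cnj u)\<^sup>2) > 0"
proof -
  define z where "z = csqrt c"
  have z: "z\<^sup>2 = c" "z \<noteq> 0" using assms by (auto simp: z_def)
  have "c * (cnj (sgn z))\<^sup>2 = of_real (cmod c)"
  proof -
    have "z * cnj (sgn z) = of_real (cmod z)"
      using z(2) by (simp add: sgn_div_norm scaleR_conv_of_real complex_norm_square power2_eq_square field_simps flip: complex_norm_square)
    then have "(z * cnj (sgn z))\<^sup>2 = of_real (cmod (z\<^sup>2))" by (simp add: norm_power)
    then show ?thesis using z(1) by (simp add: power_mult_distrib)
  qed
  moreover have "cmod (sgn z) = 1" using z(2) by (simp add: norm_sgn)
  ultimately show ?thesis using assms by (intro exI[of _ "sgn z"]) simp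
qed

lemma smooth_on_Re_Im: "open S \<Longrightarrow> smooth_on S f \<Longrightarrow> smooth_on S (\<lambda>x. Re (f x))"
  "open S \<Longrightarrow> smooth_on S f \<Longrightarrow> smooth_on S (\<lambda>x. Im (f x))"
  "open S \<Longrightarrow> smooth_on S f \<Longrightarrow> smooth_on S (\<lambda>x. cnj (f x))"
  "open S \<Longrightarrow> smooth_on S h \<Longrightarrow> smooth_on S (\<lambda>x. complex_of_real (h x))"
  by (auto intro: smooth_on_bounded_linear bounded_linear_Re bounded_linear_Im bounded_linear_cnj bounded_linear_of_real)

lemma smooth_on_cmod_square: "open S \<Longrightarrow> smooth_on S f \<Longrightarrow> smooth_on S (\<lambda>x. (cmod (f x))\<^sup>2)"
  unfolding cmod_power2 unfolding power2_eq_square by (intro smooth_on_add smooth_on_mult smooth_on_Re_Im)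

lemma smooth_on_cmod:
  assumes "open S" "smooth_on S f" "\<And>x. x \<in> S \<Longrightarrow> f x \<noteq> 0"
  shows "smooth_on S (\<lambda>x. cmod (f x))"
proof -
  have "smooth_on S (\<lambda>x. sqrt ((cmod (f x))\<^sup>2))"
    using assms by (intro smooth_on_sqrt smooth_on_cmod_square) auto
  then show ?thesis by simp
qed

lemma smooth_on_root_near:
  assumes S: "open S" "smooth_on S f" and f: "\<And>x. x \<in> S \<Longrightarrow> f x \<noteq> 0" "\<And>x. x \<in> S \<Longrightarrow> cmod (f x) + Re (f x * (cnj u)\<^sup>2) > 0"
  shows "smooth_on S (\<lambda>x. root_near u (f x))"
proof -
  have p: "2 * (cmod (f x) + Re (f x * (cnj u)\<^sup>2)) > 0" if "x \<in> S" for x using mult_pos_pos[OF zero_less_numeral f(2)[OF that]] .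
  then have "complex_of_real (sqrt (2 * (cmod (f x) + Re (f x * (cnj u)\<^sup>2)))) \<noteq> 0" if "x \<in> S" for x
    using that by (metis less_irrefl of_real_eq_0_iff real_sqrt_eq_zero_cancel_iff)
  with p f(1) show ?thesis
    unfolding root_near_def
    by (intro smooth_on_divide smooth_on_add smooth_on_mult smooth_on_Re_Im smooth_on_cmod smooth_on_sqrt smooth_on_const S) blast+
qed

lemma open_Collect_less_on:
  fixes f g :: "'a::topological_space \<Rightarrow> real"
  assumes "open S" "continuous_on S f" "continuous_on S g"
  shows "open {x \<in> S. f x < g x}"
proof -
  have "open (S \<inter> (\<lambda>x. g x - f x) -` {0<..})"
    by (intro continuous_open_preimage continuous_intros assms)
  moreover have "S \<inter> (\<lambda>x. g x - f x) -` {0<..} = {x \<in> S. f x < g x}" by auto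
  ultimately show ?thesis by simp
qed

text \<open>Near each point a continuous root is \<open>\<plusminus>\<close> an explicit smooth root, with a constant sign.\<close>

theorem continuous_root_smooth:
  fixes f :: "'a::real_normed_vector \<Rightarrow> complex"
  assumes S: "open S" "smooth_on S f" and f: "\<And>x. x \<in> S \<Longrightarrow> f x \<noteq> 0"
    and z: "continuous_on S z" "\<And>x. x \<in> S \<Longrightarrow> (z x)\<^sup>2 = f x"
  shows "smooth_on S z"
proof (rule smooth_on_local)
  fix x assume x: "x \<in> S"
  obtain u where u: "cmod u = 1" "cmod (f x) + Re (f x * (cnj u)\<^sup>2) > 0"
    using exists_root_direction[OF f[OF x]] by blast
  define T where "T = {y \<in> S. cmod (f y) + Re (f y * (cnj u)\<^sup>2) > 0}"
  have cf: "continuous_on S f" using S(2) by (rule smooth_on_continuous)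
  have T: "open T" "x \<in> T" "T \<subseteq> S"
    unfolding T_def using u x
    by (auto intro!: open_Collect_less_on S(1) continuous_intros cf)
  define r where "r = (\<lambda>y. root_near u (f y))"
  have r: "smooth_on T r"
    unfolding r_def using T f u by (intro smooth_on_root_near smooth_on_subset[OF S(2)]) (auto simp: T_def)
  have r2: "(r y)\<^sup>2 = (z y)\<^sup>2" if "y \<in> T" for y
    using that root_near_square[OF u(1), of "f y"] z(2)[of y] T(3) by (auto simp: T_def r_def)
  have rn: "r y \<noteq> 0" if "y \<in> T" for y using r2[OF that] z(2)[of y] f[of y] T(3) that by auto
  define e where "e = z x / r x"
  have e: "e = 1 \<or> e = -1" using r2[OF T(2)] rn[OF T(2)] by (auto simp: e_def power2_eq_iff)
  define T' where "T' = {y \<in> T. cmod (z y - e * r y) < cmod (e * r y)}"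
  have T': "open T'" "x \<in> T'"
    unfolding T'_def using T rn[OF T(2)] e
    by (auto intro!: open_Collect_less_on T(1) continuous_intros continuous_on_subset[OF z(1)] smooth_on_continuous[OF r] simp: e_def)
  have "z y = e * r y" if y: "y \<in> T'" for y
  proof -
    have "(z y - e * r y) * (z y + e * r y) = (z y)\<^sup>2 - e\<^sup>2 * (r y)\<^sup>2" by (simp add: power2_eq_square algebra_simps)
    also have "\<dots> = 0" using e r2[of y] y by (auto simp: T'_def)
    finally have "z y = e * r y \<or> z y = - (e * r y)" by (auto simp: add_eq_0_iff2)
    moreover have "z y \<noteq> - (e * r y)"
    proof
      assume "z y = - (e * r y)"
      then have "cmod (z y - e * r y) = 2 * cmod (e * r y)" by (simp add: norm_mult flip: mult_2 norm_minus_cancel[of "e * r y"])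
      then show False using y norm_ge_zero[of "e * r y"] by (simp add: T'_def)
    qed
    ultimately show ?thesis by blast
  qed
  moreover have "smooth_on T' (\<lambda>y. e * r y)"
    using T'(1) by (intro smooth_on_mult smooth_on_const smooth_on_subset[OF r]) (auto simp: T'_def)
  ultimately have "smooth_on T' z" using smooth_on_cong[OF T'(1), of "\<lambda>y. e * r y" z] by simp
  moreover have "S \<inter> T' = T'" using T(3) by (auto simp: T'_def)
  ultimately show "\<exists>T. open T \<and> x \<in> T \<and> smooth_on (S \<inter> T) z" using T' by (intro exI[of _ T']) simp
qed

section \<open>Tangent vectors and differentials on the surface\<close>

text \<open>Charts are pairs, but are always treated as units below.\<close>

declare split_paired_All [simp del] split_paired_Ex [simp del]

locale smooth_surface =
  fixes A :: "'m::topological_space chart set"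
  assumes atlas: "smooth_atlas A"
begin

definition coords :: "'m set \<Rightarrow> 'm chart \<Rightarrow> (real^2) set" where
  "coords U c = chart_map c ` (U \<inter> dom_chart c)"

definition jac :: "'m chart \<Rightarrow> 'm chart \<Rightarrow> 'm \<Rightarrow> real^2 \<Rightarrow> real^2" where
  "jac c c' p = fd (transition c c') (chart_map c p)"

lemma chart:
  assumes "c \<in> A"
  shows "open (dom_chart c)" "open (chart_map c ` dom_chart c)"
    "homeomorphism (dom_chart c) (chart_map c ` dom_chart c) (chart_map c) (chart_inv c)"
  using atlas assms by (auto simp: smooth_atlas_def is_chart_def)

lemma chart_inv: "c \<in> A \<Longrightarrow> p \<in> dom_chart c \<Longrightarrow> chart_inv c (chart_map c p) = p"
  using chart(3) by (simp add: homeomorphism_def)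

lemma coordsE:
  assumes "c \<in> A" "x \<in> coords U c"
  shows "chart_inv c x \<in> U" "chart_inv c x \<in> dom_chart c" "chart_map c (chart_inv c x) = x"
  using assms(2) chart_inv[OF assms(1)] by (auto simp: coords_def)

lemma coordsI: "p \<in> U \<Longrightarrow> p \<in> dom_chart c \<Longrightarrow> chart_map c p \<in> coords U c"
  by (auto simp: coords_def)

lemma coords_iff:
  assumes "c \<in> A"
  shows "x \<in> coords U c \<longleftrightarrow> x \<in> chart_map c ` dom_chart c \<and> chart_inv c x \<in> U"
  using chart_inv[OF assms] by (auto simp: coords_def)

lemma open_coords:
  assumes c: "c \<in> A" and U: "open U"
  shows "open (coords U c)"
proof -
  have "continuous_on (chart_map c ` dom_chart c) (chart_inv c)"
    using chart(3)[OF c] by (simp add: homeomorphism_def)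
  then have "open (chart_map c ` dom_chart c \<inter> chart_inv c -` U)"
    by (rule continuous_open_preimage[OF _ chart(2)[OF c] U])
  moreover have "chart_map c ` dom_chart c \<inter> chart_inv c -` U = coords U c"
    using coords_iff[OF c] by auto
  ultimately show ?thesis by simp
qed

lemma open_chart_inv_image:
  assumes c: "c \<in> A" and B: "open B" "B \<subseteq> chart_map c ` dom_chart c"
  shows "open (chart_inv c ` B)"
proof -
  have "continuous_on (dom_chart c) (chart_map c)"
    using chart(3)[OF c] by (simp add: homeomorphism_def)
  then have "open (dom_chart c \<inter> chart_map c -` B)"
    by (rule continuous_open_preimage[OF _ chart(1)[OF c] B(1)])
  moreover have "dom_chart c \<inter> chart_map c -` B = chart_inv c ` B"
    using B(2) chart_inv[OF c] by force
  ultimately show ?thesis by simp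
qed

lemma continuous_chart_inv:
  assumes "c \<in> A"
  shows "continuous_on (coords U c) (chart_inv c)"
  by (rule continuous_on_subset[of "chart_map c ` dom_chart c"])
    (use chart(3)[OF assms] in \<open>auto simp: homeomorphism_def coords_def\<close>)

lemma chart_around: "\<exists>c\<in>A. p \<in> dom_chart c"
  using atlas by (auto simp: smooth_atlas_def)

lemma chart_at: "chart_at A p \<in> A" "p \<in> dom_chart (chart_at A p)"
proof -
  have "\<exists>c. c \<in> A \<and> p \<in> dom_chart c" using chart_around[of p] by blast
  from someI_ex[OF this] show "chart_at A p \<in> A" "p \<in> dom_chart (chart_at A p)"
    unfolding chart_at_def by blast+
qed

lemma transition_smooth:
  "c \<in> A \<Longrightarrow> c' \<in> A \<Longrightarrow> smooth_on (coords (dom_chart c') c) (transition c c')"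
  using atlas by (simp add: smooth_atlas_def coords_def Int_commute)

lemma transition_has_derivative:
  assumes "c \<in> A" "c' \<in> A" "p \<in> dom_chart c" "p \<in> dom_chart c'"
  shows "(transition c c' has_derivative jac c c' p) (at (chart_map c p))"
  unfolding jac_def
  by (rule smooth_on_has_derivative[OF transition_smooth[OF assms(1,2)]]) (use assms in \<open>auto simp: coords_def\<close>)

lemma jac_linear:
  "c \<in> A \<Longrightarrow> c' \<in> A \<Longrightarrow> p \<in> dom_chart c \<Longrightarrow> p \<in> dom_chart c' \<Longrightarrow> linear (jac c c' p)"
  using has_derivative_linear[OF transition_has_derivative] .

lemma transition_map: "c \<in> A \<Longrightarrow> p \<in> dom_chart c \<Longrightarrow> transition c c' (chart_map c p) = chart_map c' p"
  by (simp add: transition_def chart_inv)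

text \<open>The chain rule, which makes differentials independent of the chart that \<open>chart_at\<close> happens to choose.\<close>

lemma has_derivative_change_chart:
  assumes c: "c \<in> A" "c' \<in> A" "p \<in> dom_chart c" "p \<in> dom_chart c'"
    and f: "((f \<circ> chart_inv c') has_derivative L) (at (chart_map c' p))"
  shows "((f \<circ> chart_inv c) has_derivative (\<lambda>v. L (jac c c' p v))) (at (chart_map c p))"
proof -
  have d: "((\<lambda>x. (f \<circ> chart_inv c') (transition c c' x)) has_derivative (\<lambda>v. L (jac c c' p v))) (at (chart_map c p))"
    by (rule has_derivative_compose[OF transition_has_derivative[OF c]]) (use f in \<open>simp only: transition_map c\<close>)
  show ?thesis
  proof (rule has_derivative_transform_within_open[OF d])
    show "open (coords (dom_chart c') c)" "chart_map c p \<in> coords (dom_chart c') c"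
      using c by (auto intro: open_coords coordsI chart(1))
    show "(f \<circ> chart_inv c') (transition c c' x) = (f \<circ> chart_inv c) x" if "x \<in> coords (dom_chart c') c" for x
      using coordsE[OF c(1) that] c by (simp add: transition_def chart_inv)
  qed
qed

lemma jac_compose:
  assumes c: "c \<in> A" "c' \<in> A" "c'' \<in> A" "p \<in> dom_chart c" "p \<in> dom_chart c'" "p \<in> dom_chart c''"
  shows "jac c c'' p v = jac c' c'' p (jac c c' p v)"
proof -
  have "((chart_map c'' \<circ> chart_inv c') has_derivative jac c' c'' p) (at (chart_map c' p))"
    using transition_has_derivative[OF c(2,3,5,6)] by (simp add: transition_def)
  from has_derivative_change_chart[OF c(1,2,4,5) this]
  have "(transition c c'' has_derivative (\<lambda>v. jac c' c'' p (jac c c' p v))) (at (chart_map c p))"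
    by (simp add: transition_def)
  from fd_eqI[OF this] show ?thesis by (simp add: jac_def)
qed

lemma jac_id:
  assumes c: "c \<in> A" "p \<in> dom_chart c"
  shows "jac c c p v = v"
proof -
  have "(transition c c has_derivative (\<lambda>v. v)) (at (chart_map c p))"
    by (rule has_derivative_transform_within_open[OF has_derivative_ident chart(2)[OF c(1)]])
      (use c in \<open>auto simp: transition_def chart_inv\<close>)
  from fd_eqI[OF this] show ?thesis by (simp add: jac_def)
qed

lemma tangent_jac:
  "v \<in> tangent_space A p \<Longrightarrow> c \<in> A \<Longrightarrow> c' \<in> A \<Longrightarrow> p \<in> dom_chart c \<Longrightarrow> p \<in> dom_chart c' \<Longrightarrow> v c' = jac c c' p (v c)"
  unfolding tangent_space_def jac_def by blast

lemma tangent_eqI: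
  assumes "u \<in> tangent_space A p" "v \<in> tangent_space A p" "c \<in> A" "p \<in> dom_chart c" "u c = v c"
  shows "u = v"
proof
  fix c'
  show "u c' = v c'"
  proof (cases "c' \<in> A \<and> p \<in> dom_chart c'")
    case True
    then have "u c' = jac c c' p (u c)" "v c' = jac c c' p (v c)"
      using tangent_jac[OF assms(1,3) _ assms(4)] tangent_jac[OF assms(2,3) _ assms(4)] by blast+
    then show ?thesis using assms(5) by simp
  next
    case False
    then have "u c' = 0" "v c' = 0" using assms(1,2) unfolding tangent_space_def by blast+
    then show ?thesis by simp
  qed
qed

lemma tangentI:
  assumes "\<And>c c'. c \<in> A \<Longrightarrow> c' \<in> A \<Longrightarrow> p \<in> dom_chart c \<Longrightarrow> p \<in> dom_chart c' \<Longrightarrow> v c' = jac c c' p (v c)"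
    and "\<And>c. \<not> (c \<in> A \<and> p \<in> dom_chart c) \<Longrightarrow> v c = 0"
  shows "v \<in> tangent_space A p"
  using assms unfolding tangent_space_def jac_def by blast

lemma tangent_zero: "v \<in> tangent_space A p \<Longrightarrow> \<not> (c \<in> A \<and> p \<in> dom_chart c) \<Longrightarrow> v c = 0"
  unfolding tangent_space_def by blast

lemma const_field_tangent:
  assumes "c \<in> A" "p \<in> dom_chart c"
  shows "const_field A c a p \<in> tangent_space A p" "const_field A c a p c = a"
proof -
  have cf: "const_field A c a p c' = (if c' \<in> A \<and> p \<in> dom_chart c' then jac c c' p a else 0)" for c'
    by (simp add: const_field_def jac_def)
  show "const_field A c a p \<in> tangent_space A p"
  proof (rule tangentI)
    fix c' c'' assume c': "c' \<in> A" "c'' \<in> A" "p \<in> dom_chart c'" "p \<in> dom_chart c''"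
    then show "const_field A c a p c'' = jac c' c'' p (const_field A c a p c')"
      unfolding cf using jac_compose[OF assms(1) c'(1,2) assms(2) c'(3,4), of a] by simp
  qed (auto simp: cf)
  show "const_field A c a p c = a" unfolding cf using assms by (simp add: jac_id)
qed

lemma lincomb_tangent:
  assumes "u \<in> tangent_space A p" "v \<in> tangent_space A p"
  shows "lincomb a u b v \<in> tangent_space A p"
proof (rule tangentI)
  fix c c' assume c: "c \<in> A" "c' \<in> A" "p \<in> dom_chart c" "p \<in> dom_chart c'"
  show "lincomb a u b v c' = jac c c' p (lincomb a u b v c)"
    unfolding lincomb_def linear_add[OF jac_linear[OF c]] linear_scale[OF jac_linear[OF c]]
    using tangent_jac[OF assms(1) c] tangent_jac[OF assms(2) c] by argo
next
  fix c assume "\<not> (c \<in> A \<and> p \<in> dom_chart c)"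
  then show "lincomb a u b v c = 0"
    using tangent_zero[OF assms(1)] tangent_zero[OF assms(2)] unfolding lincomb_def by simp
qed

lemma differential_eq:
  assumes c: "c \<in> A" "p \<in> dom_chart c" and v: "v \<in> tangent_space A p"
    and f: "((f \<circ> chart_inv c) has_derivative L) (at (chart_map c p))"
  shows "differential A f p v = L (v c)"
proof -
  have "((f \<circ> chart_inv (chart_at A p)) has_derivative (\<lambda>v. L (jac (chart_at A p) c p v))) (at (chart_map (chart_at A p) p))"
    by (rule has_derivative_change_chart[OF chart_at(1) c(1) chart_at(2) c(2) f])
  from fd_eqI[OF this] show ?thesis
    using tangent_jac[OF v chart_at(1) c(1) chart_at(2) c(2)] by (simp add: differential_def Let_def)
qed

lemma smooth_map_has_derivative:
  assumes "smooth_map A U f" "c \<in> A" "p \<in> U" "p \<in> dom_chart c"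
  shows "((f \<circ> chart_inv c) has_derivative fd (f \<circ> chart_inv c) (chart_map c p)) (at (chart_map c p))"
  by (rule smooth_on_has_derivative[of "coords U c"]) (use assms in \<open>auto simp: smooth_map_def coords_def\<close>)

lemma differential_smooth:
  assumes "smooth_map A U f" "c \<in> A" "p \<in> U" "p \<in> dom_chart c" "v \<in> tangent_space A p"
  shows "differential A f p v = fd (f \<circ> chart_inv c) (chart_map c p) (v c)"
  by (rule differential_eq[OF assms(2,4,5) smooth_map_has_derivative[OF assms(1-4)]])

lemma surface_path_neighbourhood:
  fixes p :: 'm
  assumes U: "open U" "p \<in> U"
  shows "\<exists>V\<subseteq>U. open V \<and> p \<in> V \<and> (\<forall>y\<in>V. \<exists>\<gamma>. path \<gamma> \<and> path_image \<gamma> \<subseteq> V \<and> \<gamma> 0 = p \<and> \<gamma> 1 = y)"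
proof -
  obtain c where c: "c \<in> A" "p \<in> dom_chart c" using chart_around by blast
  obtain e where e: "e > 0" "ball (chart_map c p) e \<subseteq> coords U c"
    using open_coords[OF c(1) U(1)] coordsI[OF U(2) c(2)] by (auto simp: open_contains_ball)
  define B where "B = ball (chart_map c p) e"
  define V where "V = chart_inv c ` B"
  have cB: "continuous_on B (chart_inv c)"
    by (rule continuous_on_subset[OF continuous_chart_inv[OF c(1), of U]]) (use e in \<open>simp add: B_def\<close>)
  have "V \<subseteq> U" using e coordsE(1)[OF c(1)] by (auto simp: V_def B_def)
  moreover have "open V"
    unfolding V_def by (rule open_chart_inv_image[OF c(1)]) (use e in \<open>auto simp: B_def coords_def\<close>)
  moreover have "p \<in> V" unfolding V_def
    by (rule image_eqI[of _ _ "chart_map c p"]) (use e in \<open>simp_all add: chart_inv[OF c] B_def\<close>)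
  moreover have "\<exists>\<gamma>. path \<gamma> \<and> path_image \<gamma> \<subseteq> V \<and> \<gamma> 0 = p \<and> \<gamma> 1 = y" if y: "y \<in> V" for y
  proof -
    obtain b where b: "b \<in> B" "y = chart_inv c b" using y by (auto simp: V_def)
    have "closed_segment (chart_map c p) b \<subseteq> B"
      by (rule closed_segment_subset) (use b e in \<open>auto simp: B_def\<close>)
    then have l: "linepath (chart_map c p) b t \<in> B" if "t \<in> {0..1}" for t
      using linepath_in_path[OF that] by blast
    have "path (\<lambda>t. chart_inv c (linepath (chart_map c p) b t))"
      unfolding path_def by (rule continuous_on_compose2[OF cB]) (use l in \<open>auto intro!: continuous_intros\<close>)
    moreover have "path_image (\<lambda>t. chart_inv c (linepath (chart_map c p) b t)) \<subseteq> V"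
      using l by (auto simp: path_image_def V_def)
    ultimately show ?thesis
      by (intro exI[of _ "\<lambda>t. chart_inv c (linepath (chart_map c p) b t)"]) (simp add: b c chart_inv linepath_def)
  qed
  ultimately show ?thesis by blast
qed

end

section \<open>Frames and spinors in a chart\<close>

locale spin_surface = smooth_surface A
  for A :: "'m::topological_space chart set" +
  fixes g :: "'m metric" and T :: "'m \<Rightarrow> 'm tangent"
    and prj :: "'q::topological_space \<Rightarrow> 'm" and act :: "'q \<Rightarrow> real \<Rightarrow> 'q"
    and Lam :: "'q \<Rightarrow> 'm tangent \<times> 'm tangent"
  assumes metric: "lorentzian_metric A g"
    and spin: "spin_structure A g T prj act Lam"
begin

lemma frame:
  shows "fst (Lam q) \<in> tangent_space A (prj q)" "snd (Lam q) \<in> tangent_space A (prj q)"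
    "g (prj q) (fst (Lam q)) (fst (Lam q)) = -1" "g (prj q) (snd (Lam q)) (snd (Lam q)) = 1"
    "g (prj q) (fst (Lam q)) (snd (Lam q)) = 0"
proof -
  have "Lam q \<in> oriented_frames A g T (prj q)" using spin by (simp add: spin_structure_def)
  then show "fst (Lam q) \<in> tangent_space A (prj q)" "snd (Lam q) \<in> tangent_space A (prj q)"
    "g (prj q) (fst (Lam q)) (fst (Lam q)) = -1" "g (prj q) (snd (Lam q)) (snd (Lam q)) = 1"
    "g (prj q) (fst (Lam q)) (snd (Lam q)) = 0"
    by (auto simp: oriented_frames_def)
qed

lemma g_sym: "u \<in> tangent_space A p \<Longrightarrow> v \<in> tangent_space A p \<Longrightarrow> g p u v = g p v u"
  using metric by (simp add: lorentzian_metric_def)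

lemma g_lin: "u \<in> tangent_space A p \<Longrightarrow> v \<in> tangent_space A p \<Longrightarrow> w \<in> tangent_space A p \<Longrightarrow>
    g p (lincomb a u b v) w = a * g p u w + b * g p v w"
  using metric by (simp add: lorentzian_metric_def)

text \<open>The coordinate fields span the tangent space, and \<open>g\<close> is bilinear there.\<close>

lemma g_gform:
  assumes c: "c \<in> A" "p \<in> dom_chart c" and u: "u \<in> tangent_space A p" and v: "v \<in> tangent_space A p"
  shows "g p u v = gform (gram A g c (chart_map c p)) (u c) (v c)"
proof -
  note cf = const_field_tangent[OF c]
  have ex: "w = lincomb (w c $ 1) (coord_field A c 1 p) (w c $ 2) (coord_field A c 2 p)" if "w \<in> tangent_space A p" for w
    by (rule tangent_eqI[OF that _ c])
      (use cf lincomb_tangent in \<open>auto simp: coord_field_def lincomb_def intro: vec2_expand\<close>)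
  have co: "coord_field A c i p \<in> tangent_space A p" for i by (simp add: coord_field_def cf)
  have gr: "g p (coord_field A c i p) (coord_field A c j p) = gram A g c (chart_map c p) $ i $ j" for i j
    by (simp add: gram_def chart_inv c)
  have gs: "gram A g c (chart_map c p) $ i $ j = gram A g c (chart_map c p) $ j $ i" for i j
    using g_sym[OF co co, of i j] unfolding gr .
  have 1: "g p u w = u c $ 1 * g p (coord_field A c 1 p) w + u c $ 2 * g p (coord_field A c 2 p) w"
    if "w \<in> tangent_space A p" for w
    by (subst ex[OF u]) (rule g_lin[OF co co that])
  have 2: "g p (coord_field A c i p) v = v c $ 1 * gram A g c (chart_map c p) $ i $ 1 + v c $ 2 * gram A g c (chart_map c p) $ i $ 2" for i
  proof -
    have "g p (coord_field A c i p) v = g p v (coord_field A c i p)" by (rule g_sym[OF co v])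
    also have "\<dots> = v c $ 1 * g p (coord_field A c 1 p) (coord_field A c i p) + v c $ 2 * g p (coord_field A c 2 p) (coord_field A c i p)"
      by (subst ex[OF v]) (rule g_lin[OF co co co])
    finally show ?thesis unfolding gr gs[of _ i] .
  qed
  show ?thesis unfolding 1[OF v] 2 by (simp add: gform_def sum_2 algebra_simps)
qed

abbreviation e2c :: "('m \<Rightarrow> 'q) \<Rightarrow> 'm chart \<Rightarrow> real^2 \<Rightarrow> real^2" where
  "e2c s c \<equiv> (\<lambda>x. fst (Lam (s (chart_inv c x))) c)"
abbreviation e3c :: "('m \<Rightarrow> 'q) \<Rightarrow> 'm chart \<Rightarrow> real^2 \<Rightarrow> real^2" where
  "e3c s c \<equiv> (\<lambda>x. snd (Lam (s (chart_inv c x))) c)"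

definition null_plus :: "'q \<Rightarrow> 'm tangent" where "null_plus q = lincomb 1 (fst (Lam q)) 1 (snd (Lam q))"
definition null_minus :: "'q \<Rightarrow> 'm tangent" where "null_minus q = lincomb 1 (fst (Lam q)) (-1) (snd (Lam q))"

lemma null_tangent: "null_plus q \<in> tangent_space A (prj q)" "null_minus q \<in> tangent_space A (prj q)"
  unfolding null_plus_def null_minus_def by (intro lincomb_tangent frame)+

lemma spinorial_frameD:
  assumes "spinorial_frame A prj Lam U s"
  shows "open U" "continuous_on U s" "p \<in> U \<Longrightarrow> prj (s p) = p"
  using assms by (auto simp: spinorial_frame_def)

lemma chart_frame:
  assumes s: "spinorial_frame A prj Lam U s" and c: "c \<in> A"
  shows "chart_frame (coords U c) (gram A g c) (e2c s c) (e3c s c)"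
proof
  have U: "open U" using s by (simp add: spinorial_frame_def)
  show "open (coords U c)" by (rule open_coords[OF c U])
  have "smooth_on (chart_map c ` dom_chart c) (gram A g c)" using metric c by (simp add: lorentzian_metric_def)
  then show "smooth_on (coords U c) (gram A g c)" by (rule smooth_on_subset) (auto simp: coords_def)
  show "smooth_on (coords U c) (e2c s c)" "smooth_on (coords U c) (e3c s c)"
    using s c by (auto simp: spinorial_frame_def smooth_vector_field_def coords_def)
  fix x assume x: "x \<in> coords U c"
  define p where "p = chart_inv c x"
  have p: "p \<in> U" "p \<in> dom_chart c" "chart_map c p = x" using coordsE[OF c x] by (auto simp: p_def)
  have sp: "prj (s p) = p" using s p by (simp add: spinorial_frame_def)
  note f = frame[of "s p", unfolded sp]
  show "gram A g c x $ i $ j = gram A g c x $ j $ i" for i j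
    using g_sym[of "coord_field A c i p" p "coord_field A c j p"] const_field_tangent(1)[OF c p(2)]
    by (simp add: gram_def p_def[symmetric] coord_field_def)
  show "gform (gram A g c x) (fst (Lam (s (chart_inv c x))) c) (fst (Lam (s (chart_inv c x))) c) = -1"
    "gform (gram A g c x) (snd (Lam (s (chart_inv c x))) c) (snd (Lam (s (chart_inv c x))) c) = 1"
    "gform (gram A g c x) (fst (Lam (s (chart_inv c x))) c) (snd (Lam (s (chart_inv c x))) c) = 0"
    using f g_gform[OF c p(2) f(1) f(1)] g_gform[OF c p(2) f(2) f(2)] g_gform[OF c p(2) f(1) f(2)]
    by (simp_all add: p_def[symmetric] p(3))
qed

text \<open>The extra terms produced by the transition map are its second derivatives in the directions \<open>e\<^sub>2\<close> and \<open>e\<^sub>3\<close>, and these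
  cancel by symmetry.\<close>

lemma bracket_change_chart:
  assumes s: "spinorial_frame A prj Lam U s" and c: "c \<in> A" "c' \<in> A"
    and p: "p \<in> U" "p \<in> dom_chart c" "p \<in> dom_chart c'"
  defines "x \<equiv> chart_map c p" and "x' \<equiv> chart_map c' p"
  shows "fd (e3c s c') x' (e2c s c' x') - fd (e2c s c') x' (e3c s c' x') =
    jac c c' p (fd (e3c s c) x (e2c s c x) - fd (e2c s c) x (e3c s c x))"
proof -
  define W where "W = coords (U \<inter> dom_chart c') c"
  define \<tau> where "\<tau> = transition c c'"
  have U: "open U" using s by (simp add: spinorial_frame_def)
  have W: "open W" "x \<in> W"
    unfolding W_def x_def using c p U by (auto intro!: open_coords coordsI chart(1))
  have \<tau>: "smooth_on W \<tau>"
    unfolding \<tau>_def by (rule smooth_on_subset[OF transition_smooth[OF c]]) (auto simp: W_def coords_def)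
  interpret C: chart_frame "coords U c" "gram A g c" "e2c s c" "e3c s c" by (rule chart_frame[OF s c(1)])
  interpret C': chart_frame "coords U c'" "gram A g c'" "e2c s c'" "e3c s c'" by (rule chart_frame[OF s c(2)])
  have xU: "x \<in> coords U c" "x' \<in> coords U c'" using p by (auto simp: x_def x'_def intro: coordsI)
  have \<tau>x: "\<tau> x = x'" by (simp add: \<tau>_def x_def x'_def transition_map c p)
  have J: "fd \<tau> x = jac c c' p" by (simp add: jac_def \<tau>_def x_def)
  have vf: "fd Yc' x' (jac c c' p v) = fd (\<lambda>y. fd \<tau> y (Yc x)) x v + jac c c' p (fd Yc x v)"
    if Y: "\<And>y. Y y \<in> tangent_space A (prj y)" "Yc = (\<lambda>x. Y (s (chart_inv c x)) c)" "Yc' = (\<lambda>x. Y (s (chart_inv c' x)) c')"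
      and d: "(Yc has_derivative fd Yc x) (at x)" "(Yc' has_derivative fd Yc' x') (at x')" for Y Yc Yc' v
  proof -
    have d1: "((\<lambda>y. Yc' (\<tau> y)) has_derivative (\<lambda>v. fd Yc' x' (fd \<tau> x v))) (at x)"
      by (rule has_derivative_compose[OF smooth_on_has_derivative[OF \<tau> W(2)]]) (simp add: \<tau>x d)
    have d2: "((\<lambda>y. fd \<tau> y (Yc y)) has_derivative (\<lambda>v. fd (\<lambda>y. fd \<tau> y (Yc x)) x v + fd \<tau> x (fd Yc x v))) (at x)"
      by (rule fd_along_field[OF W _ _ d(1)])
        (use \<tau> in \<open>auto intro: smooth_on_frechet_derivative fd_linear smooth_on_differentiable\<close>)
    have e: "Yc' (\<tau> y) = fd \<tau> y (Yc y)" if y: "y \<in> W" for y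
    proof -
      define r where "r = chart_inv c y"
      have r: "r \<in> U" "r \<in> dom_chart c'" "r \<in> dom_chart c" "chart_map c r = y"
        using coordsE[OF c(1) y[unfolded W_def]] by (auto simp: r_def)
      have "prj (s r) = r" using s r by (simp add: spinorial_frame_def)
      then have "Y (s r) \<in> tangent_space A r" using Y(1)[of "s r"] by simp
      from tangent_jac[OF this c r(3,2)] show ?thesis
        using r c by (simp add: Y(2,3) \<tau>_def transition_def chart_inv jac_def r_def[symmetric])
    qed
    have "((\<lambda>y. fd \<tau> y (Yc y)) has_derivative (\<lambda>v. fd Yc' x' (fd \<tau> x v))) (at x)"
      by (rule has_derivative_transform_within_open[OF d1 W e])
    from fun_cong[OF has_derivative_unique[OF this d2], of v] show ?thesis by (simp add: J)
  qed
  have sp: "prj (s p) = p" using s p by (simp add: spinorial_frame_def)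
  have inv: "chart_inv c x = p" "chart_inv c' x' = p" by (simp_all add: x_def x'_def chart_inv c p)
  have e: "e2c s c' x' = jac c c' p (e2c s c x)" "e3c s c' x' = jac c c' p (e3c s c x)"
    using tangent_jac[OF frame(1)[of "s p", unfolded sp] c p(2,3)] tangent_jac[OF frame(2)[of "s p", unfolded sp] c p(2,3)]
    by (simp_all add: inv)
  have "fd (\<lambda>y. fd \<tau> y (e3c s c x)) x (e2c s c x) = fd (\<lambda>y. fd \<tau> y (e2c s c x)) x (e3c s c x)"
    by (rule second_derivative_symmetric[OF W smooth_onD[OF \<tau>]])
  moreover have "fd (e3c s c') x' (jac c c' p (e2c s c x)) = fd (\<lambda>y. fd \<tau> y (e3c s c x)) x (e2c s c x) + jac c c' p (fd (e3c s c) x (e2c s c x))"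
    by (rule vf[of "\<lambda>q. snd (Lam q)"]) (use frame C.frame_has_derivative[OF xU(1)] C'.frame_has_derivative[OF xU(2)] in auto)
  moreover have "fd (e2c s c') x' (jac c c' p (e3c s c x)) = fd (\<lambda>y. fd \<tau> y (e2c s c x)) x (e3c s c x) + jac c c' p (fd (e2c s c) x (e3c s c x))"
    by (rule vf[of "\<lambda>q. fst (Lam q)"]) (use frame C.frame_has_derivative[OF xU(1)] C'.frame_has_derivative[OF xU(2)] in auto)
  ultimately show ?thesis
    unfolding e using linear_diff[OF jac_linear[OF c p(2,3)]] by simp
qed

text \<open>The connection form \<open>\<langle>\<nabla>e\<^sub>2, e\<^sub>3\<rangle>\<close> of a spinorial frame, as a function of the coordinates of the direction.\<close>

definition omega :: "('m \<Rightarrow> 'q) \<Rightarrow> 'm chart \<Rightarrow> 'm \<Rightarrow> real^2 \<Rightarrow> real" where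
  "omega s c p = chart_frame.om (gram A g c) (e2c s c) (e3c s c) (chart_map c p)"

lemma omega_change_chart:
  assumes s: "spinorial_frame A prj Lam U s" and c: "c \<in> A" "c' \<in> A"
    and p: "p \<in> U" "p \<in> dom_chart c" "p \<in> dom_chart c'" and v: "v \<in> tangent_space A p"
  shows "omega s c p (v c) = omega s c' p (v c')"
proof -
  interpret C: chart_frame "coords U c" "gram A g c" "e2c s c" "e3c s c" by (rule chart_frame[OF s c(1)])
  interpret C': chart_frame "coords U c'" "gram A g c'" "e2c s c'" "e3c s c'" by (rule chart_frame[OF s c(2)])
  have xU: "chart_map c p \<in> coords U c" "chart_map c' p \<in> coords U c'" using p by (auto intro: coordsI)
  define b where "b = fd (e3c s c) (chart_map c p) (e2c s c (chart_map c p)) - fd (e2c s c) (chart_map c p) (e3c s c (chart_map c p))"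
  \<comment> \<open>The bracket as a tangent vector: its coordinates in the other chart are again the bracket.\<close>
  define B where "B = const_field A c b p"
  have B: "B \<in> tangent_space A p" "B c = b" using const_field_tangent[OF c(1) p(2)] by (auto simp: B_def)
  have B': "B c' = fd (e3c s c') (chart_map c' p) (e2c s c' (chart_map c' p)) - fd (e2c s c') (chart_map c' p) (e3c s c' (chart_map c' p))"
    using tangent_jac[OF B(1) c p(2,3)] bracket_change_chart[OF s c p] by (simp add: B(2) b_def)
  have sp: "prj (s p) = p" using s p by (simp add: spinorial_frame_def)
  note f = frame[of "s p", unfolded sp]
  have "omega s c p (v c) = g p v (fst (Lam (s p))) * g p B (fst (Lam (s p))) - g p v (snd (Lam (s p))) * g p B (snd (Lam (s p)))"
    using C.om_bracket[OF xU(1), of "v c"]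
    by (simp add: omega_def g_gform[OF c(1) p(2)] v B f chart_inv c p b_def)
  moreover have "omega s c' p (v c') = g p v (fst (Lam (s p))) * g p B (fst (Lam (s p))) - g p v (snd (Lam (s p))) * g p B (snd (Lam (s p)))"
    using C'.om_bracket[OF xU(2), of "v c'"]
    by (simp add: omega_def g_gform[OF c(2) p(3)] v B(1) f chart_inv c p B')
  ultimately show ?thesis by simp
qed

lemma christoffel_Chr: "christoffel A g c x k i j = Chr (gram A g c) x k i j"
  by (simp add: christoffel_def Chr_def)

lemma levi_civita_nabla:
  assumes "c \<in> A" "p \<in> dom_chart c"
  shows "levi_civita A g Y p v c = nabla (gram A g c) (\<lambda>y. Y (chart_inv c y) c) (chart_map c p) (v c)"
  using assms by (simp add: levi_civita_def Let_def nabla_def Gam_def christoffel_Chr chart_inv)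

text \<open>The metric is only controlled on tangent vectors, so the first task is to see that the coordinate expressions for
  \<open>\<nabla>e\<^sub>2\<close> in the various charts fit together to a tangent vector. They do because they are \<open>\<omega> e\<^sub>3\<close> in every
  chart.\<close>

lemma levi_civita_frame:
  assumes s: "spinorial_frame A prj Lam U s" and c: "c \<in> A" and p: "p \<in> U" "p \<in> dom_chart c"
    and v: "v \<in> tangent_space A p"
  shows "g p (levi_civita A g (\<lambda>x. fst (Lam (s x))) p v) (snd (Lam (s p))) = omega s c p (v c)"
proof -
  have sp: "prj (s p) = p" using s p by (simp add: spinorial_frame_def)
  note f = frame[of "s p", unfolded sp]
  define k where "k = omega s c p (v c)"
  have "levi_civita A g (\<lambda>x. fst (Lam (s x))) p v c' = lincomb k (snd (Lam (s p))) 0 (snd (Lam (s p))) c'" for c'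
  proof (cases "c' \<in> A \<and> p \<in> dom_chart c'")
    case True
    then interpret C': chart_frame "coords U c'" "gram A g c'" "e2c s c'" "e3c s c'" by (intro chart_frame[OF s]) auto
    have "chart_map c' p \<in> coords U c'" using p True by (auto intro: coordsI)
    from C'.nabla_e2[OF this, of "v c'"] show ?thesis
      using True omega_change_chart[OF s c _ p(1,2) _ v, of c']
      by (simp add: levi_civita_nabla lincomb_def k_def omega_def chart_inv)
  next
    case False
    then have "snd (Lam (s p)) c' = 0" using tangent_zero[OF f(2)] by blast
    then show ?thesis using False by (auto simp: levi_civita_def lincomb_def)
  qed
  then have "levi_civita A g (\<lambda>x. fst (Lam (s x))) p v = lincomb k (snd (Lam (s p))) 0 (snd (Lam (s p)))" by blast
  then show ?thesis using g_lin[OF f(2) f(2) f(2)] f(4) by (simp add: k_def)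
qed

lemma gamma_products:
  "gamma2 *v \<phi> = vector [\<phi> $ 2, \<phi> $ 1]" "gamma3 *v \<phi> = vector [- \<phi> $ 2, \<phi> $ 1]"
  by (simp_all add: vec_eq_iff forall_2 gamma2_def gamma3_def matrix_vector_mult_def sum_2)

lemma complex_vec2_has_derivative:
  fixes f :: "'a::real_normed_vector \<Rightarrow> complex^2"
  assumes "f differentiable at x"
  shows "fd f x v $ i = fd (\<lambda>y. f y $ i) x v"
  using frechet_derivative_vec_nth[OF assms] by metis

text \<open>Clifford multiplication exchanges the two components, and the combination \<open>e\<^sub>2 + e\<^sub>3\<close> occurs with the second
  and \<open>e\<^sub>2 - e\<^sub>3\<close> with the first.\<close>

lemma dirac_chart:
  assumes s: "spinorial_frame A prj Lam U s" and c: "c \<in> A" and p: "p \<in> U" "p \<in> dom_chart c"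
    and \<psi>: "smooth_map A U (\<psi> \<circ> s)"
  defines "z \<equiv> (\<lambda>x. \<psi> (s (chart_inv c x)) $ 1)" and "w \<equiv> (\<lambda>x. \<psi> (s (chart_inv c x)) $ 2)" and "x \<equiv> chart_map c p"
  shows "dirac A g Lam s \<psi> p = (\<i> * of_real h) *s \<psi> (s p) \<longleftrightarrow>
     fd w x (null_plus (s p) c) = - of_real (omega s c p (null_plus (s p) c) / 2) * w x - \<i> * of_real h * z x \<and>
     fd z x (null_minus (s p) c) = of_real (omega s c p (null_minus (s p) c) / 2) * z x - \<i> * of_real h * w x"
proof -
  interpret C: chart_frame "coords U c" "gram A g c" "e2c s c" "e3c s c" by (rule chart_frame[OF s c])
  have xU: "x \<in> coords U c" using p by (auto simp: x_def intro: coordsI)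
  have sp: "prj (s p) = p" using s p by (simp add: spinorial_frame_def)
  note f = frame[of "s p", unfolded sp]
  have d: "((\<psi> \<circ> s) \<circ> chart_inv c) differentiable at x"
    using smooth_map_has_derivative[OF \<psi> c p] by (auto simp: x_def differentiable_def)
  have D1: "fd ((\<psi> \<circ> s) \<circ> chart_inv c) x v $ 1 = fd z x v" "fd ((\<psi> \<circ> s) \<circ> chart_inv c) x v $ 2 = fd w x v" for v
    unfolding complex_vec2_has_derivative[OF d] by (simp_all add: z_def w_def)
  have px: "\<psi> (s p) $ 1 = z x" "\<psi> (s p) $ 2 = w x" by (simp_all add: z_def w_def x_def chart_inv c p)
  have sc: "spin_connection A g Lam s \<psi> p v $ 1 = fd z x (v c) - of_real (omega s c p (v c) / 2) * z x"
    "spin_connection A g Lam s \<psi> p v $ 2 = fd w x (v c) + of_real (omega s c p (v c) / 2) * w x"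
    if v: "v \<in> tangent_space A p" for v
    unfolding spin_connection_def Let_def levi_civita_frame[OF s c p v] differential_smooth[OF \<psi> c p v] gamma_products
    by (simp_all add: D1 px x_def[symmetric] scaleR_conv_of_real[where 'a=complex])
  have lz: "linear (fd z x)" "linear (fd w x)"
    by (auto intro!: linearI simp: D1[symmetric] linear_add[OF fd_linear[OF d]] linear_scale[OF fd_linear[OF d]])
  have om: "omega s c p (a *\<^sub>R u + b *\<^sub>R v) = a * omega s c p u + b * omega s c p v" for a b u v
    using C.om_linear[OF xU] by (simp add: omega_def x_def)
  have pm: "null_plus (s p) c = 1 *\<^sub>R fst (Lam (s p)) c + 1 *\<^sub>R snd (Lam (s p)) c" "null_minus (s p) c = 1 *\<^sub>R fst (Lam (s p)) c + (-1) *\<^sub>R snd (Lam (s p)) c"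
    by (simp_all add: null_plus_def null_minus_def lincomb_def)
  have 1: "dirac A g Lam s \<psi> p $ 1 = - (fd w x (null_plus (s p) c) + of_real (omega s c p (null_plus (s p) c) / 2) * w x)"
    unfolding dirac_def pm om using lz sc[OF f(1)] sc[OF f(2)]
    by (simp add: gamma_products linear_add linear_scale algebra_simps add_divide_distrib)
  have 2: "dirac A g Lam s \<psi> p $ 2 = - (fd z x (null_minus (s p) c) - of_real (omega s c p (null_minus (s p) c) / 2) * z x)"
    unfolding dirac_def pm om linear_add[OF lz(1)] linear_scale[OF lz(1)] using sc[OF f(1)] sc[OF f(2)]
    by (simp add: gamma_products algebra_simps add_divide_distrib diff_divide_distrib)
  have d: "dirac A g Lam s \<psi> p = (\<i> * of_real h) *s \<psi> (s p) \<longleftrightarrow>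
     - (fd w x (null_plus (s p) c) + of_real (omega s c p (null_plus (s p) c) / 2) * w x) = \<i> * of_real h * z x \<and>
     - (fd z x (null_minus (s p) c) - of_real (omega s c p (null_minus (s p) c) / 2) * z x) = \<i> * of_real h * w x"
    by (simp add: vec_eq_iff forall_2 1 2 px del: of_real_divide)
  have e: "- (a + b) = k \<longleftrightarrow> a = - b - k" "- (a - b) = k \<longleftrightarrow> a = b - k" for a b k :: complex
    unfolding complex_eq_iff by auto
  show ?thesis unfolding d e by simp
qed

end

lemma smooth_on_vec3:
  assumes S: "open S" "smooth_on S f" "smooth_on S t"
  shows "smooth_on S (\<lambda>x. vec3 (f x) (t x))"
proof (rule smooth_on_vec[OF S(1)])
  fix i :: 3
  show "smooth_on S (\<lambda>x. vec3 (f x) (t x) $ i)"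
    using exhaust_3[of i] smooth_on_Re_Im(1,2)[OF S(1,2)] S(3) by auto
qed

lemma smooth_on_frame_plus: "open S \<Longrightarrow> smooth_on S z \<Longrightarrow> smooth_on S (\<lambda>x. frame_plus (z x))"
  and smooth_on_frame_minus: "open S \<Longrightarrow> smooth_on S w \<Longrightarrow> smooth_on S (\<lambda>x. frame_minus (w x))"
  and smooth_on_frame_normal: "open S \<Longrightarrow> smooth_on S z \<Longrightarrow> smooth_on S w \<Longrightarrow> smooth_on S (\<lambda>x. frame_normal (z x) (w x))"
  unfolding frame_explicit frame_normal_def
  by (intro smooth_on_vec3 smooth_on_minus smooth_on_add smooth_on_mult smooth_on_Re_Im smooth_on_const; assumption)+

context spin_surface
begin

section \<open>The Gauss formula in a spinorial frame\<close>

lemma chart_null: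
  assumes s: "spinorial_frame A prj Lam U s" and c: "c \<in> A"
  shows "chart_frame.ep (e2c s c) (e3c s c) y = null_plus (s (chart_inv c y)) c"
    "chart_frame.em (e2c s c) (e3c s c) y = null_minus (s (chart_inv c y)) c"
proof -
  interpret C: chart_frame "coords U c" "gram A g c" "e2c s c" "e3c s c" by (rule chart_frame[OF s c])
  show "C.ep y = null_plus (s (chart_inv c y)) c" "C.em y = null_minus (s (chart_inv c y)) c"
    by (simp_all add: C.ep_def C.em_def null_plus_def null_minus_def lincomb_def)
qed

lemma smooth_map_coords: "smooth_map A U f \<Longrightarrow> c \<in> A \<Longrightarrow> smooth_on (coords U c) (f \<circ> chart_inv c)"
  by (simp add: smooth_map_def coords_def)

text \<open>Only the factor of the connection form enters, since \<open>\<nabla>e\<^sub>-\<close> is a multiple of \<open>e\<^sub>-\<close> and \<open>\<nabla>e\<^sub>+\<close> one of \<open>e\<^sub>+\<close>.\<close>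

lemma gauss_formula:
  fixes F :: "'m \<Rightarrow> real^3"
  assumes s: "spinorial_frame A prj Lam U s" and c: "c \<in> A" and p: "p \<in> U" "p \<in> dom_chart c"
    and F: "smooth_map A UNIV F"
  defines "\<Phi> \<equiv> F \<circ> chart_inv c" and "x \<equiv> chart_map c p"
  defines "P \<equiv> (\<lambda>y. fd \<Phi> y (null_plus (s (chart_inv c y)) c))" and "Q \<equiv> (\<lambda>y. fd \<Phi> y (null_minus (s (chart_inv c y)) c))"
  shows "II (gram A g c) \<Phi> x (null_plus (s p) c) (null_minus (s p) c) =
      fd Q x (null_plus (s p) c) + omega s c p (null_plus (s p) c) *\<^sub>R Q x" (is ?thesis1)
    and "II (gram A g c) \<Phi> x (null_minus (s p) c) (null_plus (s p) c) =
      fd P x (null_minus (s p) c) - omega s c p (null_minus (s p) c) *\<^sub>R P x" (is ?thesis2)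
    and "II (gram A g c) \<Phi> x u v = II (gram A g c) \<Phi> x v u"
proof -
  interpret C: chart_frame "coords U c" "gram A g c" "e2c s c" "e3c s c" by (rule chart_frame[OF s c])
  have x: "x \<in> coords U c" using p by (auto simp: x_def intro: coordsI)
  have ix: "chart_inv c x = p" by (simp add: x_def chart_inv c p)
  have \<Phi>: "smooth_on (coords U c) \<Phi>"
    unfolding \<Phi>_def by (rule smooth_on_subset[OF smooth_map_coords[OF F c]]) (auto simp: coords_def)
  note d = C.frame_has_derivative(3,4)[OF x]
  have e: "C.ep x = null_plus (s p) c" "C.em x = null_minus (s p) c" by (simp_all add: chart_null[OF s c] ix)
  have lin: "linear (fd \<Phi> x)" by (rule fd_linear[OF smooth_on_differentiable[OF \<Phi> x]])
  have PQ: "P = (\<lambda>y. fd \<Phi> y (C.ep y))" "Q = (\<lambda>y. fd \<Phi> y (C.em y))"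
    by (simp_all add: P_def Q_def chart_null[OF s c])
  have em: "C.em differentiable at x" "C.ep differentiable at x" using d by (auto simp: differentiable_def)
  show ?thesis1
    using C.II_field[OF x \<Phi> em(1), of "C.ep x"]
    by (simp add: C.nabla_em[OF x] linear_neg[OF lin] linear_scale[OF lin] PQ e omega_def x_def[symmetric])
  show ?thesis2
    using C.II_field[OF x \<Phi> em(2), of "C.em x"]
    by (simp add: C.nabla_ep[OF x] linear_scale[OF lin] PQ e omega_def x_def[symmetric])
  show "II (gram A g c) \<Phi> x u v = II (gram A g c) \<Phi> x v u" by (rule C.II_sym[OF x \<Phi>])
qed

lemma second_fundamental_form_II:
  fixes F :: "'m \<Rightarrow> real^3"
  assumes F: "smooth_map A UNIV F" and v: "v \<in> tangent_space A p"
  defines "c \<equiv> chart_at A p"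
  shows "second_fundamental_form A g F p v w = II (gram A g c) (F \<circ> chart_inv c) (chart_map c p) (v c) (w c)"
proof -
  have c: "c \<in> A" "p \<in> dom_chart c" using chart_at unfolding c_def by auto
  define \<Phi> where "\<Phi> = F \<circ> chart_inv c"
  define W where "W = const_field A c (w c)"
  have O: "open (coords UNIV c)" "chart_map c p \<in> coords UNIV c" using c by (auto intro: open_coords coordsI)
  have \<Phi>: "smooth_on (coords UNIV c) \<Phi>" unfolding \<Phi>_def by (rule smooth_map_coords[OF F c(1)])
  have "((\<lambda>y. fd \<Phi> y (w c)) has_derivative fd (\<lambda>y. fd \<Phi> y (w c)) (chart_map c p)) (at (chart_map c p))"
    by (rule smooth_on_has_derivative[OF smooth_on_frechet_derivative[OF \<Phi>] O(2)])
  then have "(((\<lambda>x. differential A F x (W x)) \<circ> chart_inv c) has_derivative fd (\<lambda>y. fd \<Phi> y (w c)) (chart_map c p)) (at (chart_map c p))"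
  proof (rule has_derivative_transform_within_open[OF _ O])
    fix y assume y: "y \<in> coords UNIV c"
    note cy = coordsE[OF c(1) y]
    have "differential A F (chart_inv c y) (W (chart_inv c y)) = fd \<Phi> (chart_map c (chart_inv c y)) (W (chart_inv c y) c)"
      unfolding \<Phi>_def by (rule differential_smooth[OF F c(1) _ cy(2)]) (auto simp: W_def const_field_tangent[OF c(1) cy(2)])
    then show "fd \<Phi> y (w c) = ((\<lambda>x. differential A F x (W x)) \<circ> chart_inv c) y"
      by (simp add: cy W_def const_field_tangent[OF c(1) cy(2)])
  qed
  then have 1: "differential A (\<lambda>x. differential A F x (W x)) p v = fd (\<lambda>y. fd \<Phi> y (w c)) (chart_map c p) (v c)"
    by (rule differential_eq[OF c v])
  have "((\<lambda>y. W (chart_inv c y) c) has_derivative (\<lambda>_. 0)) (at (chart_map c p))"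
    by (rule has_derivative_transform_within_open[OF has_derivative_const O])
      (use coordsE[OF c(1)] const_field_tangent(2)[OF c(1)] in \<open>simp add: W_def\<close>)
  then have "levi_civita A g W p v c = Gam (gram A g c) (chart_map c p) (v c) (w c)"
    unfolding levi_civita_nabla[OF c] nabla_def by (simp add: fd_eqI chart_inv c W_def const_field_tangent)
  then have 2: "differential A F p (levi_civita A g W p v) = fd \<Phi> (chart_map c p) (Gam (gram A g c) (chart_map c p) (v c) (w c))"
    unfolding differential_def Let_def c_def[symmetric] \<Phi>_def by simp
  show ?thesis
    unfolding second_fundamental_form_def Let_def c_def[symmetric] W_def[symmetric] 1 2 II_def \<Phi>_def ..
qed

text \<open>The trace pairs \<open>e\<^sub>+\<close> with \<open>e\<^sub>-\<close>, and both mixed terms agree by symmetry.\<close>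

lemma mean_curvature_frame:
  fixes F :: "'m \<Rightarrow> real^3"
  assumes s: "spinorial_frame A prj Lam U s" and p: "p \<in> U" and F: "smooth_map A UNIV F"
  defines "c \<equiv> chart_at A p"
  shows "mean_curvature_vector A g F p = - (1/2) *\<^sub>R
    II (gram A g c) (F \<circ> chart_inv c) (chart_map c p) (null_plus (s p) c) (null_minus (s p) c)"
proof -
  have c: "c \<in> A" "p \<in> dom_chart c" using chart_at unfolding c_def by auto
  interpret C: chart_frame "coords U c" "gram A g c" "e2c s c" "e3c s c" by (rule chart_frame[OF s c(1)])
  have x: "chart_map c p \<in> coords U c" using p c by (auto intro: coordsI)
  have \<Phi>: "smooth_on (coords U c) (F \<circ> chart_inv c)"
    by (rule smooth_on_subset[OF smooth_map_coords[OF F c(1)]]) (auto simp: coords_def)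
  have "second_fundamental_form A g F p (coord_field A c i p) (coord_field A c j p) =
      II (gram A g c) (F \<circ> chart_inv c) (chart_map c p) (axis i 1) (axis j 1)" for i j
    using second_fundamental_form_II[OF F, of "coord_field A c i p" p "coord_field A c j p"]
    by (simp add: c_def[symmetric] coord_field_def const_field_tangent[OF c])
  then have "mean_curvature_vector A g F p = (1/2) *\<^sub>R (\<Sum>i\<in>UNIV. \<Sum>j\<in>UNIV. matrix_inv (gram A g c (chart_map c p)) $ i $ j *\<^sub>R
      II (gram A g c) (F \<circ> chart_inv c) (chart_map c p) (axis i 1) (axis j 1))"
    by (simp add: mean_curvature_vector_def Let_def c_def[symmetric])
  also have "\<dots> = - (1/2) *\<^sub>R II (gram A g c) (F \<circ> chart_inv c) (chart_map c p) (C.ep (chart_map c p)) (C.em (chart_map c p))"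
    unfolding C.mean_curvature_null[OF x \<Phi>] C.II_sym[OF x \<Phi>, of "C.em (chart_map c p)"]
    by (simp flip: scaleR_left.add scaleR_2)
  finally show ?thesis by (simp add: chart_null[OF s c(1)] chart_inv c)
qed

lemma spinor_field_smooth:
  "spinor_field A prj act Lam \<psi> \<Longrightarrow> spinorial_frame A prj Lam U s \<Longrightarrow> smooth_map A U (\<psi> \<circ> s)"
  unfolding spinor_field_def by blast

lemma spinor_components_smooth:
  assumes \<psi>: "spinor_field A prj act Lam \<psi>" and s: "spinorial_frame A prj Lam U s" and c: "c \<in> A"
  shows "smooth_on (coords U c) (\<lambda>y. \<psi> (s (chart_inv c y)) $ i)"
proof -
  have "smooth_on (coords U c) (\<lambda>x. (\<psi> \<circ> s \<circ> chart_inv c) x $ i)"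
    using s by (intro smooth_on_vec_nth smooth_map_coords[OF spinor_field_smooth[OF \<psi> s] c] open_coords c)
      (auto simp: spinorial_frame_def)
  then show ?thesis by simp
qed

text \<open>The bridge between both sides of the theorem: squaring the components of the spinor turns the Dirac
  equation into the Gauss formula for a surface with mean curvature vector \<open>hN\<close>, and back.\<close>

lemma dirac_iff_gauss:
  assumes s: "spinorial_frame A prj Lam U s" and c: "c \<in> A" and p: "p \<in> U" "p \<in> dom_chart c"
    and \<psi>: "smooth_map A U (\<psi> \<circ> s)"
  defines "z \<equiv> (\<lambda>x. \<psi> (s (chart_inv c x)) $ 1)" and "w \<equiv> (\<lambda>x. \<psi> (s (chart_inv c x)) $ 2)" and "x \<equiv> chart_map c p"
  assumes nz: "z x \<noteq> 0" "w x \<noteq> 0"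
  shows "dirac A g Lam s \<psi> p = (\<i> * of_real h) *s \<psi> (s p) \<longleftrightarrow>
     fd (\<lambda>y. frame_minus (w y)) x (null_plus (s p) c) + omega s c p (null_plus (s p) c) *\<^sub>R frame_minus (w x)
       = (- 2 * h) *\<^sub>R frame_normal (z x) (w x) \<and>
     fd (\<lambda>y. frame_plus (z y)) x (null_minus (s p) c) - omega s c p (null_minus (s p) c) *\<^sub>R frame_plus (z x)
       = (- 2 * h) *\<^sub>R frame_normal (z x) (w x)"
proof -
  have "smooth_on (coords U c) (\<lambda>x. (\<psi> \<circ> s \<circ> chart_inv c) x $ i)" for i
    using s by (intro smooth_on_vec_nth smooth_map_coords[OF \<psi> c] open_coords c) (auto simp: spinorial_frame_def)
  then have zw: "smooth_on (coords U c) z" "smooth_on (coords U c) w" by (simp_all add: z_def w_def)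
  have x: "x \<in> coords U c" using p by (auto simp: x_def intro: coordsI)
  note d = zw[THEN smooth_on_has_derivative, OF x]
  have f: "fd (\<lambda>y. frame_minus (w y)) x = (\<lambda>v. vec3 (2 * w x * fd w x v) (- (2 * Re (fd w x v * cnj (w x)))))"
    "fd (\<lambda>y. frame_plus (z y)) x = (\<lambda>v. vec3 (2 * z x * fd z x v) (2 * Re (fd z x v * cnj (z x))))"
    by (rule fd_eqI[OF frame_minus_has_derivative[OF d(2)]], rule fd_eqI[OF frame_plus_has_derivative[OF d(1)]])
  have D: "dirac A g Lam s \<psi> p = (\<i> * of_real h) *s \<psi> (s p) \<longleftrightarrow>
     fd w x (null_plus (s p) c) = - of_real (omega s c p (null_plus (s p) c) / 2) * w x - \<i> * of_real h * z x \<and>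
     fd z x (null_minus (s p) c) = of_real (omega s c p (null_minus (s p) c) / 2) * z x - \<i> * of_real h * w x"
    unfolding z_def w_def x_def by (rule dirac_chart[OF s c p \<psi>])
  show ?thesis
    unfolding f D
    apply (rule arg_cong2[of _ _ _ _ "(\<and>)"]; rule iffI)
       apply (erule dirac_imp_gauss)
      apply (erule gauss_imp_dirac[OF _ nz(2)])
     apply (erule dirac_imp_gauss')
    apply (erule gauss_imp_dirac'[OF _ nz(1)])
    done
qed

section \<open>From spinors to immersions\<close>

lemma prj_surj: "\<exists>q. prj q = p"
proof -
  obtain U s where "p \<in> U" "spinorial_frame A prj Lam U s" using spin unfolding spin_structure_def by meson
  then show ?thesis by (auto simp: spinorial_frame_def)
qed

lemma frame_around:
  obtains U s where "p \<in> U" "spinorial_frame A prj Lam U s"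
  using spin unfolding spin_structure_def by meson

lemma same_fibre:
  assumes "prj q = prj q'"
  obtains a where "a \<noteq> 0" "q' = act q a"
  using spin assms unfolding spin_structure_def by blast

lemma prj_act: "a \<noteq> 0 \<Longrightarrow> prj (act q a) = prj q"
  using spin unfolding spin_structure_def by blast

lemma null_act:
  assumes "a \<noteq> 0"
  shows "null_plus (act q a) c = inverse (a\<^sup>2) *\<^sub>R null_plus q c" "null_minus (act q a) c = a\<^sup>2 *\<^sub>R null_minus q c"
proof -
  have "Lam (act q a) = frame_action (Lam q) a" using spin assms unfolding spin_structure_def by blast
  then show "null_plus (act q a) c = inverse (a\<^sup>2) *\<^sub>R null_plus q c" "null_minus (act q a) c = a\<^sup>2 *\<^sub>R null_minus q c"
    by (simp_all add: null_plus_def null_minus_def frame_action_def Let_def lincomb_def vec_eq_iff field_simps)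
qed

lemma spinor_act:
  assumes "spinor_field A prj act Lam \<psi>" "a \<noteq> 0"
  shows "\<psi> (act q a) $ 1 = of_real (inverse a) * \<psi> q $ 1" "\<psi> (act q a) $ 2 = of_real a * \<psi> q $ 2"
proof -
  have "\<psi> (act q a) = spin_rep (inverse a) *v \<psi> q" using assms by (simp add: spinor_field_def)
  then show "\<psi> (act q a) $ 1 = of_real (inverse a) * \<psi> q $ 1" "\<psi> (act q a) $ 2 = of_real a * \<psi> q $ 2"
    by (simp_all add: spin_rep_def matrix_vector_mult_def sum_2)
qed

text \<open>A local solution of \<open>df(e\<^sub>\<plusminus>) = E\<^sub>\<plusminus>\<close>, stated for all spinorial frames \<open>q\<close> and all charts at once, so that no 1-form on
  the surface has to be constructed.\<close>

definition primitive :: "('q \<Rightarrow> complex^2) \<Rightarrow> 'm set \<Rightarrow> ('m \<Rightarrow> real^3) \<Rightarrow> bool" where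
  "primitive \<psi> U f \<longleftrightarrow> open U \<and> (\<forall>q. prj q \<in> U \<longrightarrow> (\<forall>c\<in>A. prj q \<in> dom_chart c \<longrightarrow>
     (\<exists>L. ((f \<circ> chart_inv c) has_derivative L) (at (chart_map c (prj q))) \<and>
       L (null_plus q c) = frame_plus (\<psi> q $ 1) \<and> L (null_minus q c) = frame_minus (\<psi> q $ 2))))"

text \<open>By \<open>frame_act\<close> and the chain rule, one spinorial frame and one chart suffice.\<close>

lemma primitive_chartI:
  assumes \<psi>: "spinor_field A prj act Lam \<psi>" and U: "open U" "U \<subseteq> dom_chart c" and c: "c \<in> A"
    and sp: "\<And>p. p \<in> U \<Longrightarrow> prj (s p) = p"
    and f: "\<And>p. p \<in> U \<Longrightarrow> ((f \<circ> chart_inv c) has_derivative L p) (at (chart_map c p))"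
    and L: "\<And>p. p \<in> U \<Longrightarrow> L p (null_plus (s p) c) = frame_plus (\<psi> (s p) $ 1)"
      "\<And>p. p \<in> U \<Longrightarrow> L p (null_minus (s p) c) = frame_minus (\<psi> (s p) $ 2)"
  shows "primitive \<psi> U f"
  unfolding primitive_def
proof (intro conjI allI impI ballI U(1))
  fix q c' assume q: "prj q \<in> U" and c': "c' \<in> A" "prj q \<in> dom_chart c'"
  define p where "p = prj q"
  have p: "p \<in> U" "p \<in> dom_chart c" "p \<in> dom_chart c'" using q c' U(2) by (auto simp: p_def)
  obtain a where a: "a \<noteq> 0" "q = act (s p) a" using same_fibre[of "s p" q] sp[OF p(1)] p_def by metis
  have lin: "linear (L p)" using f[OF p(1)] has_derivative_linear by blast
  have j: "jac c' c p (v c') = v c" if "v \<in> tangent_space A p" for v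
    using tangent_jac[OF that c'(1) c p(3,2)] by simp
  have "((f \<circ> chart_inv c') has_derivative (\<lambda>v. L p (jac c' c p v))) (at (chart_map c' p))"
    by (rule has_derivative_change_chart[OF c'(1) c p(3,2) f[OF p(1)]])
  moreover have "L p (jac c' c p (null_plus q c')) = frame_plus (\<psi> q $ 1)"
    unfolding j[OF null_tangent(1)[of q, folded p_def]] unfolding a(2) null_act[OF a(1)] spinor_act[OF \<psi> a(1)] frame_act[OF a(1)]
    by (simp add: linear_scale[OF lin] L p)
  moreover have "L p (jac c' c p (null_minus q c')) = frame_minus (\<psi> q $ 2)"
    unfolding j[OF null_tangent(2)[of q, folded p_def]] unfolding a(2) null_act[OF a(1)] spinor_act[OF \<psi> a(1)] frame_act[OF a(1)]
    by (simp add: linear_scale[OF lin] L p)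
  ultimately show "\<exists>L. ((f \<circ> chart_inv c') has_derivative L) (at (chart_map c' (prj q))) \<and>
       L (null_plus q c') = frame_plus (\<psi> q $ 1) \<and> L (null_minus q c') = frame_minus (\<psi> q $ 2)"
    unfolding p_def[symmetric] by blast
qed

lemma primitive_add_const:
  assumes "primitive \<psi> U f"
  shows "primitive \<psi> U (\<lambda>x. f x + k)"
  unfolding primitive_def
proof (intro conjI allI impI ballI)
  show "open U" using assms by (simp add: primitive_def)
  fix q c assume q: "prj q \<in> U" and c: "c \<in> A" "prj q \<in> dom_chart c"
  then obtain L where L: "((f \<circ> chart_inv c) has_derivative L) (at (chart_map c (prj q)))"
       "L (null_plus q c) = frame_plus (\<psi> q $ 1) \<and> L (null_minus q c) = frame_minus (\<psi> q $ 2)"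
    using assms unfolding primitive_def by blast
  have "(((\<lambda>x. f x + k) \<circ> chart_inv c) has_derivative L) (at (chart_map c (prj q)))"
    using has_derivative_add[OF L(1) has_derivative_const[of k]] by (simp add: o_def)
  with L(2) show "\<exists>L. (((\<lambda>x. f x + k) \<circ> chart_inv c) has_derivative L) (at (chart_map c (prj q))) \<and>
       L (null_plus q c) = frame_plus (\<psi> q $ 1) \<and> L (null_minus q c) = frame_minus (\<psi> q $ 2)" by blast
qed

lemma primitive_derivative:
  assumes s: "spinorial_frame A prj Lam U s" and c: "c \<in> A" and f: "primitive \<psi> V f"
    and x: "x \<in> coords (U \<inter> V) c"
  shows "((f \<circ> chart_inv c) has_derivative
    chart_frame.frame_form (gram A g c) (e2c s c) (e3c s c) (\<lambda>y. frame_plus (\<psi> (s (chart_inv c y)) $ 1))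
      (\<lambda>y. frame_minus (\<psi> (s (chart_inv c y)) $ 2)) x) (at x)"
proof -
  interpret C: chart_frame "coords U c" "gram A g c" "e2c s c" "e3c s c" by (rule chart_frame[OF s c])
  define p where "p = chart_inv c x"
  have p: "p \<in> U" "p \<in> V" "p \<in> dom_chart c" "chart_map c p = x" using coordsE[OF c x] by (auto simp: p_def)
  have xU: "x \<in> coords U c" using p coordsI by metis
  have sp: "prj (s p) = p" using s p by (simp add: spinorial_frame_def)
  obtain L where L: "((f \<circ> chart_inv c) has_derivative L) (at x)"
       "L (null_plus (s p) c) = frame_plus (\<psi> (s p) $ 1)" "L (null_minus (s p) c) = frame_minus (\<psi> (s p) $ 2)"
    using f p sp c unfolding primitive_def by metis
  have "L = C.frame_form (\<lambda>y. frame_plus (\<psi> (s (chart_inv c y)) $ 1)) (\<lambda>y. frame_minus (\<psi> (s (chart_inv c y)) $ 2)) x"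
    by (rule C.frame_form_unique[OF xU has_derivative_linear[OF L(1)]])
      (simp_all add: chart_null[OF s c] p_def[symmetric] L)
  with L(1) show ?thesis by simp
qed

lemma primitive_smooth:
  assumes \<psi>: "spinor_field A prj act Lam \<psi>" and F: "primitive \<psi> UNIV F"
  shows "smooth_map A UNIV F"
  unfolding smooth_map_def coords_def[symmetric]
proof (intro ballI smooth_on_local)
  fix c x assume c: "c \<in> A" and x: "x \<in> coords UNIV c"
  note p = coordsE[OF c x]
  obtain U s where s: "chart_inv c x \<in> U" "spinorial_frame A prj Lam U s" by (rule frame_around)
  interpret C: chart_frame "coords U c" "gram A g c" "e2c s c" "e3c s c" by (rule chart_frame[OF s(2) c])
  have O: "open (coords U c)" "x \<in> coords U c" "coords UNIV c \<inter> coords U c = coords U c"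
    using C.Om s(1) coordsI[OF s(1) p(2)] p(3) by (auto simp: coords_def)
  note zw = spinor_components_smooth[OF \<psi> s(2) c]
  have "smooth_on (coords U c) (F \<circ> chart_inv c)"
  proof (rule smooth_onI[OF O(1)])
    show "((F \<circ> chart_inv c) has_derivative C.frame_form (\<lambda>y. frame_plus (\<psi> (s (chart_inv c y)) $ 1))
      (\<lambda>y. frame_minus (\<psi> (s (chart_inv c y)) $ 2)) y) (at y)" if "y \<in> coords U c" for y
      by (rule primitive_derivative[OF s(2) c F]) (use that in simp)
    show "smooth_on (coords U c) (\<lambda>x. C.frame_form (\<lambda>y. frame_plus (\<psi> (s (chart_inv c y)) $ 1))
      (\<lambda>y. frame_minus (\<psi> (s (chart_inv c y)) $ 2)) x v)" for v
      by (intro C.frame_form_smooth smooth_on_frame_plus smooth_on_frame_minus O zw)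
  qed
  with O show "\<exists>T. open T \<and> x \<in> T \<and> smooth_on (coords UNIV c \<inter> T) (F \<circ> chart_inv c)"
    by (intro exI[of _ "coords U c"]) simp
qed

text \<open>By the Dirac equation both sides of \<open>closed_form_criterion\<close> are equal to \<open>-2HN\<close>.\<close>

lemma local_primitive:
  assumes \<psi>: "spinor_field A prj act Lam \<psi>" and D: "dirac_equation A g prj Lam H \<psi>"
    and n: "\<And>q. spinor_product (\<psi> q) (\<psi> q) = -1"
  shows "\<exists>U f. primitive \<psi> U f \<and> p0 \<in> U"
proof -
  obtain U s where s: "p0 \<in> U" "spinorial_frame A prj Lam U s" by (rule frame_around)
  have U: "open U" using s(2) by (simp add: spinorial_frame_def)
  obtain c where c: "c \<in> A" "p0 \<in> dom_chart c" using chart_around by blast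
  interpret C: chart_frame "coords U c" "gram A g c" "e2c s c" "e3c s c" by (rule chart_frame[OF s(2) c(1)])
  define x0 where "x0 = chart_map c p0"
  obtain e where e: "e > 0" "ball x0 e \<subseteq> coords U c"
    using C.Om coordsI[OF s(1) c(2)] by (auto simp: open_contains_ball x0_def)
  define z w where "z = (\<lambda>y. \<psi> (s (chart_inv c y)) $ 1)" and "w = (\<lambda>y. \<psi> (s (chart_inv c y)) $ 2)"
  have zw: "smooth_on (coords U c) z" "smooth_on (coords U c) w"
    using spinor_components_smooth[OF \<psi> s(2) c(1)] by (simp_all add: z_def w_def)
  define P Q where "P = (\<lambda>y. frame_plus (z y))" and "Q = (\<lambda>y. frame_minus (w y))"
  have PQ: "smooth_on (coords U c) P" "smooth_on (coords U c) Q"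
    unfolding P_def Q_def by (intro smooth_on_frame_plus smooth_on_frame_minus C.Om zw)+
  define \<beta> where "\<beta> = C.frame_form P Q"
  have \<beta>: "smooth_on (coords U c) (\<lambda>y. \<beta> y v)" "linear (\<beta> y)" for v y
    unfolding \<beta>_def by (intro C.frame_form_smooth PQ, rule C.frame_form)
  have sym: "fd (\<lambda>y. \<beta> y v) x u = fd (\<lambda>y. \<beta> y u) x v" if x: "x \<in> coords U c" for x u v
  proof (rule C.closed_form_criterion[OF x \<beta>(1) \<beta>(2)])
    show "\<beta> y (C.ep y) = P y" "\<beta> y (C.em y) = Q y" if "y \<in> coords U c" for y
      using C.frame_form(2,3)[OF that] by (simp_all add: \<beta>_def)
    define p where "p = chart_inv c x"
    have p: "p \<in> U" "p \<in> dom_chart c" "chart_map c p = x" using coordsE[OF c(1) x] by (auto simp: p_def)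
    have "Re (z x * cnj (w x)) = 1" using n[of "s p"] by (simp add: spinor_product_self z_def w_def p_def)
    then have nz: "z x \<noteq> 0" "w x \<noteq> 0" by auto
    have "dirac A g Lam s \<psi> p = (\<i> * of_real (H p)) *s \<psi> (s p)"
      using D s(2) p(1) by (simp add: dirac_equation_def)
    then have "fd Q x (null_plus (s p) c) + omega s c p (null_plus (s p) c) *\<^sub>R Q x = (- 2 * H p) *\<^sub>R frame_normal (z x) (w x)"
      "fd P x (null_minus (s p) c) - omega s c p (null_minus (s p) c) *\<^sub>R P x = (- 2 * H p) *\<^sub>R frame_normal (z x) (w x)"
      using dirac_iff_gauss[OF s(2) c(1) p(1,2) spinor_field_smooth[OF \<psi> s(2)], of "H p"] nz
      unfolding p(3) P_def Q_def z_def w_def by simp_all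
    then show "fd Q x (C.ep x) + C.om x (C.ep x) *\<^sub>R Q x = fd P x (C.em x) - C.om x (C.em x) *\<^sub>R P x"
      unfolding chart_null[OF s(2) c(1)] by (simp add: p_def[symmetric] omega_def p)
  qed
  have "\<exists>f. \<forall>x\<in>ball x0 e. (f has_derivative \<beta> x) (at x)"
    by (rule poincare_lemma_ball)
      (use \<beta> sym e smooth_on_subset smooth_onD in \<open>blast+\<close>)
  then obtain f where f: "\<And>x. x \<in> ball x0 e \<Longrightarrow> (f has_derivative \<beta> x) (at x)" by blast
  define V where "V = chart_inv c ` ball x0 e"
  have bs: "ball x0 e \<subseteq> chart_map c ` dom_chart c" using e(2) by (auto simp: coords_def)
  have V: "open V" "V \<subseteq> U" "V \<subseteq> dom_chart c"
    unfolding V_def using open_chart_inv_image[OF c(1) open_ball bs] coordsE[OF c(1)] e(2) by blast+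
  have Vx: "chart_map c p \<in> ball x0 e" if "p \<in> V" for p
    using that coordsE(3)[OF c(1)] e(2) unfolding V_def by fastforce
  have "primitive \<psi> V (f \<circ> chart_map c)"
  proof (rule primitive_chartI[OF \<psi> V(1,3) c(1), where s=s and L="\<lambda>p. \<beta> (chart_map c p)"])
    fix p assume p: "p \<in> V"
    show "prj (s p) = p" using s(2) p V(2) by (auto simp: spinorial_frame_def)
    show "(f \<circ> chart_map c \<circ> chart_inv c has_derivative \<beta> (chart_map c p)) (at (chart_map c p))"
      by (rule has_derivative_transform_within_open[OF f[OF Vx[OF p]] open_ball Vx[OF p]])
        (use coordsE(3)[OF c(1)] e(2) in force)
    have x: "chart_map c p \<in> coords U c" using Vx[OF p] e(2) by blast
    have ip: "chart_inv c (chart_map c p) = p" using chart_inv[OF c(1)] p V(3) by blast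
    show "\<beta> (chart_map c p) (null_plus (s p) c) = frame_plus (\<psi> (s p) $ 1)"
      "\<beta> (chart_map c p) (null_minus (s p) c) = frame_minus (\<psi> (s p) $ 2)"
      using C.frame_form(2,3)[OF x, where P=P and Q=Q] unfolding chart_null[OF s(2) c(1)]
      by (simp_all add: \<beta>_def ip P_def Q_def z_def w_def)
  qed
  moreover have "p0 \<in> V"
    unfolding V_def by (rule image_eqI[of _ _ x0]) (use e in \<open>simp_all add: x0_def chart_inv[OF c]\<close>)
  ultimately show ?thesis by blast
qed

lemma primitive_agree:
  assumes f: "primitive \<psi> U f" and h: "primitive \<psi> V h" and x: "x \<in> U" "x \<in> V"
  shows "\<forall>\<^sub>F y in nhds x. (f y = h y) = (f x = h x)"
proof -
  obtain W s where s: "x \<in> W" "spinorial_frame A prj Lam W s" by (rule frame_around)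
  obtain c where c: "c \<in> A" "x \<in> dom_chart c" using chart_around by blast
  have O: "open (W \<inter> (U \<inter> V))" using f h s by (auto simp: primitive_def spinorial_frame_def)
  define x0 where "x0 = chart_map c x"
  obtain e where e: "e > 0" "ball x0 e \<subseteq> coords (W \<inter> (U \<inter> V)) c"
    using open_coords[OF c(1) O] coordsI[of x "W \<inter> (U \<inter> V)" c] s x c(2) by (auto simp: open_contains_ball x0_def)
  have "((\<lambda>y. (f \<circ> chart_inv c) y - (h \<circ> chart_inv c) y) has_derivative (\<lambda>_. 0)) (at y within ball x0 e)" if y: "y \<in> ball x0 e" for y
  proof -
    have "y \<in> coords (W \<inter> U) c" "y \<in> coords (W \<inter> V) c" using y e(2) by (auto simp: coords_def)
    from has_derivative_diff[OF primitive_derivative[OF s(2) c(1) f this(1)] primitive_derivative[OF s(2) c(1) h this(2)]]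
    show ?thesis by (simp add: has_derivative_at_withinI)
  qed
  from has_derivative_zero_constant[OF convex_ball this]
  obtain k where k: "\<And>y. y \<in> ball x0 e \<Longrightarrow> f (chart_inv c y) - h (chart_inv c y) = k" by auto
  have kx: "f x - h x = k" using k[of x0] e(1) by (simp add: x0_def chart_inv[OF c])
  have "open (chart_inv c ` ball x0 e)"
    by (rule open_chart_inv_image[OF c(1) open_ball]) (use e(2) in \<open>auto simp: coords_def\<close>)
  moreover have "x \<in> chart_inv c ` ball x0 e"
    by (rule image_eqI[of _ _ x0]) (use e in \<open>simp_all add: x0_def chart_inv[OF c]\<close>)
  ultimately have "\<forall>\<^sub>F y in nhds x. y \<in> chart_inv c ` ball x0 e" by (rule eventually_nhds_in_open)
  then show ?thesis
    by (rule eventually_mono) (use k kx in \<open>auto simp: algebra_simps\<close>)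
qed

lemma global_primitive:
  assumes \<psi>: "spinor_field A prj act Lam \<psi>" and D: "dirac_equation A g prj Lam H \<psi>"
    and n: "\<And>q. spinor_product (\<psi> q) (\<psi> q) = -1" and sc: "simply_connected (UNIV :: 'm set)"
  obtains F where "primitive \<psi> UNIV F"
proof -
  define S where "S = {(U, f). primitive \<psi> U f}"
  interpret local_system S
  proof
    fix U f assume f: "(U, f) \<in> S"
    then show "open U" by (simp add: S_def primitive_def)
    fix V h x assume "(V, h) \<in> S" "x \<in> U" "x \<in> V"
    with f show "\<forall>\<^sub>F y in nhds x. (f y = h y) = (f x = h x)" using primitive_agree unfolding S_def by blast
  next
    fix x
    obtain U f where f: "primitive \<psi> U f" "x \<in> U" using local_primitive[OF \<psi> D n] by blast
    have "\<exists>f'. (U, f') \<in> S \<and> f' y = h y" for y h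
      using primitive_add_const[OF f(1), of "h y - f y"] by (intro exI[of _ "\<lambda>x. f x + (h y - f y)"]) (simp add: S_def)
    then show "\<exists>U. open U \<and> x \<in> U \<and> (\<forall>y\<in>U. \<forall>V g. (V, g) \<in> S \<longrightarrow> y \<in> V \<longrightarrow> (\<exists>f. (U, f) \<in> S \<and> f y = g y))"
      using f by (intro exI[of _ U]) (simp add: primitive_def)
  qed
  obtain U0 f0 x0 where "(U0, f0) \<in> S" "x0 \<in> U0" using local_primitive[OF \<psi> D n] unfolding S_def by blast
  then obtain F where F: "\<And>x. \<exists>U f. (U, f) \<in> S \<and> x \<in> U \<and> (\<forall>\<^sub>F y in nhds x. F y = f y)"
    using global_section[OF sc surface_path_neighbourhood] by blast
  have "primitive \<psi> UNIV F"
    unfolding primitive_def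
  proof (intro conjI allI impI ballI)
    fix q c assume c: "c \<in> A" "prj q \<in> dom_chart c"
    obtain U f where f: "primitive \<psi> U f" "prj q \<in> U" "\<forall>\<^sub>F y in nhds (prj q). F y = f y"
      using F[of "prj q"] unfolding S_def by blast
    then obtain V where V: "open V" "prj q \<in> V" "\<And>y. y \<in> V \<Longrightarrow> F y = f y" by (auto simp: eventually_nhds)
    obtain L where L: "((f \<circ> chart_inv c) has_derivative L) (at (chart_map c (prj q)))"
       "L (null_plus q c) = frame_plus (\<psi> q $ 1) \<and> L (null_minus q c) = frame_minus (\<psi> q $ 2)"
      using f(1,2) c unfolding primitive_def by blast
    have "((F \<circ> chart_inv c) has_derivative L) (at (chart_map c (prj q)))"
      by (rule has_derivative_transform_within_open[OF L(1) open_coords[OF c(1) V(1)] coordsI[OF V(2) c(2)]])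
        (use V(3) coordsE(1)[OF c(1)] in simp)
    with L(2) show "\<exists>L. ((F \<circ> chart_inv c) has_derivative L) (at (chart_map c (prj q))) \<and>
       L (null_plus q c) = frame_plus (\<psi> q $ 1) \<and> L (null_minus q c) = frame_minus (\<psi> q $ 2)" by blast
  qed simp
  then show thesis by (rule that)
qed

text \<open>All claims about \<open>F\<close> are pointwise statements about the form sending \<open>e\<^sub>\<plusminus>\<close> to \<open>E\<^sub>\<plusminus>\<close>. The vector \<open>N\<close> does not depend on the
  spinorial frame, so any \<open>q\<close> over \<open>p\<close> may be used to define it.\<close>

theorem spinor_imp_immersion:
  assumes \<psi>: "spinor_field A prj act Lam \<psi>" and D: "dirac_equation A g prj Lam H \<psi>"
    and n: "\<And>q. spinor_product (\<psi> q) (\<psi> q) = -1" and sc: "simply_connected (UNIV :: 'm set)"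
  shows "\<exists>F. isometric_immersion A g F \<and> (\<exists>N. unit_normal_field A F N \<and>
               (\<forall>p. mean_curvature_vector A g F p = H p *\<^sub>R N p))"
proof -
  obtain F where F: "primitive \<psi> UNIV F" using global_primitive[OF \<psi> D n sc] .
  have Fs: "smooth_map A UNIV F" by (rule primitive_smooth[OF \<psi> F])
  have re: "Re (\<psi> q $ 1 * cnj (\<psi> q $ 2)) = 1" for q
    using n[of q] by (simp add: spinor_product_self)
  define N where "N = (\<lambda>p. let q = (SOME q. prj q = p) in frame_normal (\<psi> q $ 1) (\<psi> q $ 2))"
  have N: "N (prj q) = frame_normal (\<psi> q $ 1) (\<psi> q $ 2)" for q
  proof -
    define q' where "q' = (SOME q'. prj q' = prj q)"
    have "prj q' = prj q" unfolding q'_def by (rule someI) (rule refl)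
    then obtain a where a: "a \<noteq> 0" "q = act q' a" by (rule same_fibre)
    have "N (prj q) = frame_normal (\<psi> q' $ 1) (\<psi> q' $ 2)" by (simp add: N_def q'_def Let_def)
    also have "\<dots> = frame_normal (\<psi> q $ 1) (\<psi> q $ 2)"
      unfolding a(2) spinor_act[OF \<psi> a(1)] frame_act[OF a(1)] ..
    finally show ?thesis .
  qed
  have local: "(\<forall>v\<in>tangent_space A p. \<forall>w\<in>tangent_space A p. lor (differential A F p v) (differential A F p w) = g p v w)
     \<and> (\<forall>v\<in>tangent_space A p. lor (N p) (differential A F p v) = 0)
     \<and> inj_on (differential A F p) (tangent_space A p)
     \<and> mean_curvature_vector A g F p = H p *\<^sub>R N p" for p
  proof -
    obtain U s where s: "p \<in> U" "spinorial_frame A prj Lam U s" by (rule frame_around)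
    define c where "c = chart_at A p"
    have c: "c \<in> A" "p \<in> dom_chart c" using chart_at by (auto simp: c_def)
    define x where "x = chart_map c p"
    have ix: "chart_inv c x = p" by (simp add: x_def chart_inv c)
    have xU: "x \<in> coords U c" using coordsI[OF s(1) c(2)] by (simp add: x_def)
    have sp: "prj (s p) = p" using s by (simp add: spinorial_frame_def)
    interpret C: chart_frame "coords U c" "gram A g c" "e2c s c" "e3c s c" by (rule chart_frame[OF s(2) c(1)])
    define z w where "z = (\<lambda>y. \<psi> (s (chart_inv c y)) $ 1)" and "w = (\<lambda>y. \<psi> (s (chart_inv c y)) $ 2)"
    define P Q where "P = (\<lambda>y. frame_plus (z y))" and "Q = (\<lambda>y. frame_minus (w y))"
    have rex: "Re (z y * cnj (w y)) = 1" for y using re by (simp add: z_def w_def)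
    have nz: "z x \<noteq> 0" "w x \<noteq> 0" using rex[of x] by auto
    have dF: "differential A F p v = C.frame_form P Q x (v c)" if "v \<in> tangent_space A p" for v
      unfolding P_def Q_def z_def w_def x_def
      by (rule differential_eq[OF c that primitive_derivative[OF s(2) c(1) F]]) (use xU in \<open>simp add: x_def\<close>)
    have l: "lor (P x) (P x) = 0" "lor (Q x) (Q x) = 0" "lor (P x) (Q x) = -2"
      using rex by (simp_all add: P_def Q_def frame_lor)
    have Np: "N p = frame_normal (z x) (w x)" using N[of "s p"] by (simp add: sp z_def w_def ix)
    have iso: "lor (differential A F p v) (differential A F p u) = g p v u" if "v \<in> tangent_space A p" "u \<in> tangent_space A p" for v u
      unfolding dF[OF that(1)] dF[OF that(2)] g_gform[OF c that, folded x_def]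
      by (rule C.frame_form_isometric[where P=P and Q=Q, OF xU l])
    have nor: "lor (N p) (differential A F p v) = 0" if "v \<in> tangent_space A p" for v
      unfolding dF[OF that] C.frame_form_def lor_linear Np P_def Q_def frame_lor by simp
    have inj: "inj_on (differential A F p) (tangent_space A p)"
    proof (rule inj_onI)
      fix v u assume v: "v \<in> tangent_space A p" and u: "u \<in> tangent_space A p" and eq: "differential A F p v = differential A F p u"
      have "gform (gram A g c x) (v c) b = gform (gram A g c x) (u c) b" for b
        using eq C.frame_form_isometric[where P=P and Q=Q, OF xU l, of "v c" b] C.frame_form_isometric[where P=P and Q=Q, OF xU l, of "u c" b]
        by (simp add: dF v u)
      then have "v c = u c" using C.null_expand[OF xU, of "v c"] C.null_expand[OF xU, of "u c"] by simp
      then show "v = u" by (rule tangent_eqI[OF v u c])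
    qed
    define \<Phi> where "\<Phi> = F \<circ> chart_inv c"
    have fd\<Phi>: "fd \<Phi> y = C.frame_form P Q y" if "y \<in> coords U c" for y
      unfolding \<Phi>_def P_def Q_def z_def w_def by (rule fd_eqI[OF primitive_derivative[OF s(2) c(1) F]]) (use that in simp)
    have Qy: "fd \<Phi> y (null_minus (s (chart_inv c y)) c) = Q y" if "y \<in> coords U c" for y
      using fd\<Phi>[OF that] C.frame_form(3)[OF that, where P=P and Q=Q] by (simp add: chart_null[OF s(2) c(1)])
    have Qs: "smooth_on (coords U c) Q"
      unfolding Q_def w_def by (intro smooth_on_frame_minus C.Om spinor_components_smooth[OF \<psi> s(2) c(1)])
    have "fd (\<lambda>y. fd \<Phi> y (null_minus (s (chart_inv c y)) c)) x = fd Q x"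
      by (rule fd_eqI, rule has_derivative_transform_within_open[OF smooth_on_has_derivative[OF Qs xU] C.Om xU])
        (simp add: Qy)
    then have "II (gram A g c) \<Phi> x (null_plus (s p) c) (null_minus (s p) c) = fd Q x (null_plus (s p) c) + omega s c p (null_plus (s p) c) *\<^sub>R Q x"
      using gauss_formula(1)[OF s(2) c(1) s(1) c(2) Fs] Qy[OF xU] unfolding \<Phi>_def x_def by (simp add: chart_inv[OF c])
    also have "\<dots> = (- 2 * H p) *\<^sub>R frame_normal (z x) (w x)"
    proof -
      have "dirac A g Lam s \<psi> p = (\<i> * of_real (H p)) *s \<psi> (s p)"
        using D s by (simp add: dirac_equation_def)
      then show ?thesis
        using dirac_iff_gauss[OF s(2) c(1) s(1) c(2) spinor_field_smooth[OF \<psi> s(2)], of "H p"] nz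
        unfolding x_def Q_def z_def w_def by simp
    qed
    finally have "mean_curvature_vector A g F p = H p *\<^sub>R N p"
      unfolding mean_curvature_frame[OF s(2,1) Fs] c_def[symmetric] \<Phi>_def[symmetric] x_def[symmetric] Np by simp
    with iso nor inj show ?thesis by blast
  qed
  have Ns: "smooth_map A UNIV N"
    unfolding smooth_map_def coords_def[symmetric]
  proof (intro ballI smooth_on_local)
    fix c x assume c: "c \<in> A" and x: "x \<in> coords UNIV c"
    note p = coordsE[OF c x]
    obtain U s where s: "chart_inv c x \<in> U" "spinorial_frame A prj Lam U s" by (rule frame_around)
    interpret C: chart_frame "coords U c" "gram A g c" "e2c s c" "e3c s c" by (rule chart_frame[OF s(2) c])
    have O: "open (coords U c)" "x \<in> coords U c" "coords UNIV c \<inter> coords U c = coords U c"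
      using C.Om s(1) coordsI[OF s(1) p(2)] p(3) by (auto simp: coords_def)
    have Ns: "smooth_on (coords U c) (\<lambda>y. frame_normal (\<psi> (s (chart_inv c y)) $ 1) (\<psi> (s (chart_inv c y)) $ 2))"
      by (intro smooth_on_frame_normal O spinor_components_smooth[OF \<psi> s(2) c])
    have Ne: "frame_normal (\<psi> (s (chart_inv c y)) $ 1) (\<psi> (s (chart_inv c y)) $ 2) = (N \<circ> chart_inv c) y" if "y \<in> coords U c" for y
      using N[of "s (chart_inv c y)"] spinorial_frameD(3)[OF s(2) coordsE(1)[OF c that]] by simp
    have "smooth_on (coords U c) (N \<circ> chart_inv c)" by (rule smooth_on_cong[OF O(1) Ne Ns])
    with O show "\<exists>T. open T \<and> x \<in> T \<and> smooth_on (coords UNIV c \<inter> T) (N \<circ> chart_inv c)"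
      by (intro exI[of _ "coords U c"]) simp
  qed
  have "lor (N p) (N p) = -1" for p
  proof -
    obtain q where "prj q = p" using prj_surj by blast
    then show ?thesis using N[of q] re[of q] by (simp add: frame_lor)
  qed
  with local Fs Ns show ?thesis
    unfolding isometric_immersion_def unit_normal_field_def by blast
qed

end

section \<open>From immersions to spinors\<close>

lemma locally_constant_simply_connected:
  fixes f :: "'x::topological_space \<Rightarrow> 'y"
  assumes "simply_connected (UNIV :: 'x set)" and f: "\<And>x. \<forall>\<^sub>F y in nhds x. f y = f x"
  shows "f x = f y"
proof -
  obtain c where c: "path c" "c 0 = x" "c 1 = y" using simply_connected_joinable[OF assms(1)] by blast
  have "(f \<circ> c) 0 = (f \<circ> c) 1"
  proof (rule connected_local_const[of "{0..1::real}"])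
    show "\<forall>a\<in>{0..1}. \<forall>\<^sub>F b in at a within {0..1}. (f \<circ> c) a = (f \<circ> c) b"
    proof
      fix t :: real assume t: "t \<in> {0..1}"
      have "\<forall>\<^sub>F j in nhds t. j \<in> {0..1} \<longrightarrow> f (c j) = f (c t)"
        by (rule eventually_nhds_compose_within[OF _ t f]) (use c(1) in \<open>simp add: path_def\<close>)
      then show "\<forall>\<^sub>F b in at t within {0..1}. (f \<circ> c) t = (f \<circ> c) b"
        unfolding eventually_at_filter by (rule eventually_mono) auto
    qed
  qed auto
  then show ?thesis using c by simp
qed

text \<open>The set where \<open>a\<close> is closer to \<open>b\<close> than to \<open>- b\<close> is open.\<close>

lemma square_roots_agree:
  fixes a b :: "'x::topological_space \<Rightarrow> complex"
  assumes S: "open S" "x \<in> S" and c: "continuous_on S a" "continuous_on S b"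
    and eq: "\<And>y. y \<in> S \<Longrightarrow> (a y)\<^sup>2 = (b y)\<^sup>2" "\<And>y. y \<in> S \<Longrightarrow> a y \<noteq> 0"
  shows "\<forall>\<^sub>F y in nhds x. y \<in> S \<and> (a y = b y \<longleftrightarrow> a x = b x)"
proof -
  have pm: "a y = b y \<or> a y = - b y" if "y \<in> S" for y using eq(1)[OF that] by (simp add: power2_eq_iff)
  define T where "T = (if a x = b x then {y \<in> S. cmod (a y - b y) < cmod (a y + b y)} else {y \<in> S. cmod (a y + b y) < cmod (a y - b y)})"
  have "open T" unfolding T_def by (auto intro!: open_Collect_less_on S continuous_intros c)
  moreover have "x \<in> T" using S(2) pm[OF S(2)] eq(2)[OF S(2)] by (auto simp: T_def)
  ultimately have "\<forall>\<^sub>F y in nhds x. y \<in> T" by (rule eventually_nhds_in_open)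
  then show ?thesis
  proof (rule eventually_mono)
    fix y assume y: "y \<in> T"
    then have "y \<in> S" by (auto simp: T_def split: if_splits)
    with y pm[of y] show "y \<in> S \<and> (a y = b y \<longleftrightarrow> a x = b x)" by (auto simp: T_def split: if_splits)
  qed
qed

lemma continuous_on_local:
  assumes "\<And>x. x \<in> S \<Longrightarrow> \<exists>T. open T \<and> x \<in> T \<and> continuous_on (S \<inter> T) f"
  shows "continuous_on S f"
  unfolding continuous_on_topological
proof (intro ballI allI impI)
  fix x B assume x: "x \<in> S" and B: "open B" "f x \<in> B"
  obtain T where T: "open T" "x \<in> T" "continuous_on (S \<inter> T) f" using assms[OF x] by blast
  then obtain V where "open V" "x \<in> V" "\<And>y. y \<in> S \<inter> T \<Longrightarrow> y \<in> V \<Longrightarrow> f y \<in> B"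
    using x B unfolding continuous_on_topological by (metis IntI)
  with T show "\<exists>A. open A \<and> x \<in> A \<and> (\<forall>y\<in>S. y \<in> A \<longrightarrow> f y \<in> B)"
    by (intro exI[of _ "V \<inter> T"]) auto
qed

text \<open>A reflection of \<open>R\<^sup>2\<^sup>,\<^sup>1\<close> when \<open>\<epsilon>\<close> and \<open>\<eta>\<close> are signs. The four choices represent the components of the isometry
  group, and \<open>SL(2,R)\<close> only covers one of them.\<close>

definition flip :: "real \<Rightarrow> real \<Rightarrow> real^3 \<Rightarrow> real^3" where
  "flip \<epsilon> \<eta> v = vector [v $ 1, \<epsilon> * v $ 2, \<eta> * v $ 3]"

lemma flip_nth [simp]: "flip \<epsilon> \<eta> v $ 1 = v $ 1" "flip \<epsilon> \<eta> v $ 2 = \<epsilon> * v $ 2" "flip \<epsilon> \<eta> v $ 3 = \<eta> * v $ 3"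
  by (simp_all add: flip_def)

lemma bounded_linear_flip: "bounded_linear (flip \<epsilon> \<eta>)"
proof -
  have "linear (flip \<epsilon> \<eta>)" by (intro linearI) (simp_all add: vec_eq_iff forall_3 algebra_simps)
  then show ?thesis by (simp add: linear_conv_bounded_linear)
qed

lemmas flip_linear = linear_add[OF bounded_linear.linear[OF bounded_linear_flip]]
  linear_diff[OF bounded_linear.linear[OF bounded_linear_flip]] linear_scale[OF bounded_linear.linear[OF bounded_linear_flip]]

lemma lor_flip: "\<epsilon>\<^sup>2 = 1 \<Longrightarrow> \<eta>\<^sup>2 = 1 \<Longrightarrow> lor (flip \<epsilon> \<eta> u) (flip \<epsilon> \<eta> v) = lor u v"
proof -
  assume "\<epsilon>\<^sup>2 = 1" "\<eta>\<^sup>2 = 1"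
  moreover have "lor (flip \<epsilon> \<eta> u) (flip \<epsilon> \<eta> v) = - (u $ 1 * v $ 1) - \<epsilon>\<^sup>2 * (u $ 2 * v $ 2) + \<eta>\<^sup>2 * (u $ 3 * v $ 3)"
    by (simp add: lor_def power2_eq_square algebra_simps)
  ultimately show ?thesis by (simp add: lor_def)
qed

text \<open>The signs of these two numbers distinguish the components of the set of frames \<open>(p, q, n)\<close>.\<close>

lemma frame_signs:
  assumes pp: "lor p p = 0" and pq: "lor p q = -2" and nn: "lor n n = -1" and np: "lor n p = 0"
  shows "p $ 3 \<noteq> 0" "n $ 2 * p $ 1 - n $ 1 * p $ 2 \<noteq> 0"
proof -
  have p3: "(p $ 1)\<^sup>2 + (p $ 2)\<^sup>2 = (p $ 3)\<^sup>2" using pp by (simp add: lor_def power2_eq_square)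
  show 3: "p $ 3 \<noteq> 0"
  proof
    assume "p $ 3 = 0"
    moreover from this p3 have "p $ 1 = 0" "p $ 2 = 0" by (auto simp: sum_power2_eq_zero_iff)
    ultimately show False using pq by (simp add: lor_def)
  qed
  have np': "n $ 1 * p $ 1 + n $ 2 * p $ 2 = n $ 3 * p $ 3" using np by (simp add: lor_def)
  have nn': "(n $ 1)\<^sup>2 + (n $ 2)\<^sup>2 = 1 + (n $ 3)\<^sup>2" using nn by (simp add: lor_def power2_eq_square)
  have "(n $ 2 * p $ 1 - n $ 1 * p $ 2)\<^sup>2 + (n $ 3 * p $ 3)\<^sup>2 = ((n $ 1)\<^sup>2 + (n $ 2)\<^sup>2) * ((p $ 1)\<^sup>2 + (p $ 2)\<^sup>2)"
    unfolding np'[symmetric] by (simp add: power2_eq_square algebra_simps)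
  then have "(n $ 2 * p $ 1 - n $ 1 * p $ 2)\<^sup>2 = (p $ 3)\<^sup>2"
    unfolding nn' p3 by (simp add: power2_eq_square algebra_simps)
  then show "n $ 2 * p $ 1 - n $ 1 * p $ 2 \<noteq> 0" using 3 by auto
qed

context spin_surface
begin

lemma smooth_map_continuous:
  assumes U: "open U" and f: "smooth_map A U f"
  shows "continuous_on U f"
proof -
  have c: "continuous_on (U \<inter> dom_chart c) f" if c: "c \<in> A" for c
  proof -
    have "continuous_on (dom_chart c) (chart_map c)" using chart(3)[OF c] by (simp add: homeomorphism_def)
    then have "continuous_on (U \<inter> dom_chart c) (\<lambda>p. (f \<circ> chart_inv c) (chart_map c p))"
      by (intro continuous_on_compose2[OF smooth_on_continuous[OF smooth_map_coords[OF f c]]])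
        (auto simp: coords_def intro: continuous_on_subset)
    then show ?thesis
      by (rule continuous_on_eq) (use chart_inv[OF c] in auto)
  qed
  show ?thesis
    by (rule continuous_on_local) (use c chart_around chart(1) in blast)
qed

lemma g_null:
  "g (prj q) (null_plus q) (null_plus q) = 0" "g (prj q) (null_minus q) (null_minus q) = 0"
  "g (prj q) (null_plus q) (null_minus q) = -2"
proof -
  note f = frame[of q]
  note t = null_tangent[of q]
  have 1: "g (prj q) (null_plus q) v = g (prj q) (fst (Lam q)) v + g (prj q) (snd (Lam q)) v"
    "g (prj q) (null_minus q) v = g (prj q) (fst (Lam q)) v - g (prj q) (snd (Lam q)) v"
    if "v \<in> tangent_space A (prj q)" for v
    using g_lin[OF f(1,2) that] by (simp_all add: null_plus_def null_minus_def)
  have 2: "g (prj q) v (null_plus q) = g (prj q) v (fst (Lam q)) + g (prj q) v (snd (Lam q))"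
    "g (prj q) v (null_minus q) = g (prj q) v (fst (Lam q)) - g (prj q) v (snd (Lam q))"
    if "v \<in> tangent_space A (prj q)" for v
    using 1[OF that] g_sym[OF that] t f by simp_all
  show "g (prj q) (null_plus q) (null_plus q) = 0" "g (prj q) (null_minus q) (null_minus q) = 0"
    "g (prj q) (null_plus q) (null_minus q) = -2"
    using 1[OF t(1)] 1[OF t(2)] 2[OF f(1)] 2[OF f(2)] f g_sym[OF f(2,1)] by simp_all
qed

text \<open>The action multiplies \<open>G\<close> by a positive factor, so its sign is a function on the surface, locally constant by
  continuity.\<close>

lemma fibrewise_sign_constant:
  assumes sc: "simply_connected (UNIV :: 'm set)"
    and nz: "\<And>q. G q \<noteq> (0::real)" and act: "\<And>q a. a \<noteq> 0 \<Longrightarrow> G (act q a) = inverse (a\<^sup>2) * G q"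
    and cont: "\<And>U s. spinorial_frame A prj Lam U s \<Longrightarrow> continuous_on U (\<lambda>p. G (s p))"
  obtains \<epsilon> where "\<epsilon>\<^sup>2 = (1::real)" "\<And>q. \<epsilon> * G q > 0"
proof -
  define P where "P = (\<lambda>p. \<exists>q. prj q = p \<and> G q > 0)"
  have P: "P (prj q) \<longleftrightarrow> G q > 0" for q
  proof
    assume "P (prj q)"
    then obtain q' where q': "prj q' = prj q" "G q' > 0" by (auto simp: P_def)
    then obtain a where "a \<noteq> 0" "q = act q' a" using same_fibre by blast
    then show "G q > 0" using act[of a q'] q'(2) by simp
  qed (auto simp: P_def)
  have loc: "\<forall>\<^sub>F y in nhds x. P y = P x" for x
  proof -
    obtain U s where s: "x \<in> U" "spinorial_frame A prj Lam U s" by (rule frame_around)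
    note sU = spinorial_frameD[OF s(2)]
    define k where "k = sgn (G (s x))"
    have "open {y \<in> U. 0 < k * G (s y)}"
      by (intro open_Collect_less_on sU(1) continuous_intros cont[OF s(2)])
    moreover have "x \<in> {y \<in> U. 0 < k * G (s y)}"
      using s(1) nz[of "s x"] by (simp add: k_def mult_sgn_abs sgn_if)
    ultimately have "\<forall>\<^sub>F y in nhds x. y \<in> {y \<in> U. 0 < k * G (s y)}" by (rule eventually_nhds_in_open)
    then show ?thesis
    proof (rule eventually_mono)
      fix y assume y: "y \<in> {y \<in> U. 0 < k * G (s y)}"
      then have "P y \<longleftrightarrow> G (s y) > 0" "P x \<longleftrightarrow> G (s x) > 0"
        using P[of "s y"] P[of "s x"] sU(3)[of y] sU(3)[OF s(1)] by auto
      with y nz[of "s x"] show "P y = P x" by (auto simp: k_def sgn_if split: if_splits)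
    qed
  qed
  have const: "P x = P y" for x y by (rule locally_constant_simply_connected[OF sc loc])
  show thesis
  proof (cases "\<exists>q. G q > 0")
    case True
    then have "G q > 0" for q using P const by blast
    then show thesis using that[of 1] by simp
  next
    case False
    then have "G q < 0" for q using nz[of q] by (meson linorder_neqE_linordered_idom)
    then show thesis using that[of "-1"] by simp
  qed
qed

text \<open>The first component of a spinor field, characterised as an equivariant continuous root of the complex part of
  \<open>dF(e\<^sub>+)\<close>. It lives on the spinorial frames, not on the surface.\<close>

definition square_root_on :: "('q \<Rightarrow> complex) \<Rightarrow> 'm set \<Rightarrow> ('q \<Rightarrow> complex) \<Rightarrow> bool" where
  "square_root_on K U \<zeta> \<longleftrightarrow> continuous_on (prj -` U) \<zeta> \<and> (\<forall>q. prj q \<in> U \<longrightarrow> (\<zeta> q)\<^sup>2 = K q) \<and>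
     (\<forall>q a. prj q \<in> U \<longrightarrow> a \<noteq> 0 \<longrightarrow> \<zeta> (act q a) = \<zeta> q / of_real a)"

text \<open>A function on the spinorial frames seen as a function on the surface whose values are functions on a fibre;
  0 outside the fibre makes equality of values mean equality on the fibre.\<close>

definition on_fibres :: "('q \<Rightarrow> complex) \<Rightarrow> 'm \<Rightarrow> 'q \<Rightarrow> complex" where
  "on_fibres \<zeta> p q = (if prj q = p then \<zeta> q else 0)"

text \<open>By equivariance a root is determined on a fibre by its value at one point.\<close>

lemma on_fibres_eq_iff:
  assumes \<zeta>: "square_root_on K U \<zeta>" "square_root_on K V \<xi>" and q: "prj q \<in> U" "prj q \<in> V"
  shows "on_fibres \<zeta> (prj q) = on_fibres \<xi> (prj q) \<longleftrightarrow> \<zeta> q = \<xi> q"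
proof
  assume "on_fibres \<zeta> (prj q) = on_fibres \<xi> (prj q)"
  then have "on_fibres \<zeta> (prj q) q = on_fibres \<xi> (prj q) q" by simp
  then show "\<zeta> q = \<xi> q" by (simp add: on_fibres_def)
next
  assume eq: "\<zeta> q = \<xi> q"
  have "\<zeta> q' = \<xi> q'" if q': "prj q' = prj q" for q'
  proof -
    obtain a where "a \<noteq> 0" "q' = act q a" using same_fibre[OF q'[symmetric]] .
    then show ?thesis using \<zeta> q eq by (simp add: square_root_on_def)
  qed
  then show "on_fibres \<zeta> (prj q) = on_fibres \<xi> (prj q)" by (auto simp: on_fibres_def fun_eq_iff)
qed

lemma square_root_on_minus: "square_root_on K U \<zeta> \<Longrightarrow> square_root_on K U (\<lambda>q. - \<zeta> q)"
  by (auto simp: square_root_on_def intro: continuous_on_minus)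

lemma act_act: "a \<noteq> 0 \<Longrightarrow> b \<noteq> 0 \<Longrightarrow> act (act q a) b = act q (a * b)"
  using spin unfolding spin_structure_def by (elim conjE) simp

lemma continuous_prj: "continuous_on UNIV prj"
  using spin by (simp add: spin_structure_def)

lemma open_prj_vimage: "open U \<Longrightarrow> open (prj -` U)"
  using continuous_prj by (simp add: open_vimage)

text \<open>In a local trivialisation a root on the section extends equivariantly along the fibres.\<close>

lemma local_square_root:
  assumes nz: "\<And>q. K q \<noteq> 0" and K: "\<And>q a. a \<noteq> 0 \<Longrightarrow> K (act q a) = of_real (inverse (a\<^sup>2)) * K q"
    and cont: "\<And>U s. spinorial_frame A prj Lam U s \<Longrightarrow> continuous_on U (\<lambda>p. K (s p))"
  shows "\<exists>U \<zeta>. open U \<and> p \<in> U \<and> square_root_on K U \<zeta>"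
proof -
  have "\<exists>U s h. p \<in> U \<and> spinorial_frame A prj Lam U s \<and>
        homeomorphism (U \<times> (UNIV - {0})) (prj -` U) (\<lambda>(x, a). act (s x) a) h"
    using spin unfolding spin_structure_def by blast
  then obtain W s h where s: "p \<in> W" "spinorial_frame A prj Lam W s"
    and h: "homeomorphism (W \<times> (UNIV - {0})) (prj -` W) (\<lambda>(x, a). act (s x) a) h" by blast
  note sW = spinorial_frameD[OF s(2)]
  obtain u where u: "cmod u = 1" "cmod (K (s p)) + Re (K (s p) * (cnj u)\<^sup>2) > 0"
    using exists_root_direction[OF nz] by blast
  define U where "U = {y \<in> W. 0 < cmod (K (s y)) + Re (K (s y) * (cnj u)\<^sup>2)}"
  have U: "open U" "p \<in> U" "U \<subseteq> W"
    using s(1) u(2) unfolding U_def by (auto intro!: open_Collect_less_on sW(1) continuous_intros cont[OF s(2)])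
  define r where "r = (\<lambda>y. root_near u (K (s y)))"
  have r2: "(r y)\<^sup>2 = K (s y)" if "y \<in> U" for y
    unfolding r_def by (rule root_near_square[OF u(1)]) (use that in \<open>simp add: U_def\<close>)
  have rc: "continuous_on U r"
    unfolding r_def root_near_def
    by (intro continuous_intros continuous_on_subset[OF cont[OF s(2)] U(3)]) (auto simp: U_def)
  define \<zeta> where "\<zeta> = (\<lambda>q. r (fst (h q)) / of_real (snd (h q)))"
  have hq: "h (act (s y) a) = (y, a)" if "y \<in> W" "a \<noteq> 0" for y a
    using homeomorphism_apply1[OF h, of "(y, a)"] that by simp
  have fib: "\<exists>a. a \<noteq> 0 \<and> q = act (s (prj q)) a" if "prj q \<in> W" for q
    using same_fibre[of "s (prj q)" q] sW(3)[OF that] by metis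
  have "square_root_on K U \<zeta>"
    unfolding square_root_on_def
  proof (intro conjI allI impI)
    have hc: "continuous_on (prj -` U) h"
      by (rule continuous_on_subset[OF homeomorphism_cont2[OF h]]) (use U(3) in auto)
    have hU: "fst (h q) \<in> U \<and> snd (h q) \<noteq> 0" if "prj q \<in> U" for q
    proof -
      have W: "prj q \<in> W" using that U(3) by blast
      then obtain b where b: "b \<noteq> 0" "q = act (s (prj q)) b" using fib by blast
      from hq[OF W b(1)] b(2) have "h q = (prj q, b)" by metis
      then show ?thesis using that b(1) by simp
    qed
    show "continuous_on (prj -` U) \<zeta>"
      unfolding \<zeta>_def
      by (intro continuous_on_divide continuous_on_compose2[OF rc] continuous_on_fst[OF hc] continuous_on_of_real continuous_on_snd[OF hc])
        (use hU in auto)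
    fix q assume q: "prj q \<in> U"
    then obtain b where b: "b \<noteq> 0" "q = act (s (prj q)) b" using fib U(3) by blast
    define y where "y = prj q"
    have qy: "q = act (s y) b" "y \<in> W" "y \<in> U" using b(2) q U(3) by (auto simp: y_def)
    have \<zeta>q: "\<zeta> q = r y / of_real b" using hq[OF qy(2) b(1)] by (simp add: \<zeta>_def qy(1))
    then show "(\<zeta> q)\<^sup>2 = K q"
      using r2[OF qy(3)] K[OF b(1), of "s y"] b(1) by (simp add: qy(1) power_divide power_mult_distrib power_inverse divide_inverse mult.commute)
    fix a :: real assume a: "a \<noteq> 0"
    have "act q a = act (s y) (b * a)"
      unfolding qy(1) by (rule act_act[OF b(1) a])
    then show "\<zeta> (act q a) = \<zeta> q / of_real a"
      using hq[OF qy(2), of "b * a"] a b(1) unfolding \<zeta>q by (simp add: \<zeta>_def)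
  qed
  with U show ?thesis by blast
qed

lemma square_roots_agree_on_fibres:
  assumes nz: "\<And>q. K q \<noteq> 0" and U: "open U" "open V" and \<zeta>: "square_root_on K U \<zeta>" "square_root_on K V \<xi>"
    and x: "x \<in> U" "x \<in> V"
  shows "\<forall>\<^sub>F y in nhds x. (on_fibres \<zeta> y = on_fibres \<xi> y) = (on_fibres \<zeta> x = on_fibres \<xi> x)"
proof -
  obtain W s where s: "x \<in> W" "spinorial_frame A prj Lam W s" by (rule frame_around)
  note sW = spinorial_frameD[OF s(2)]
  define Z where "Z = W \<inter> (U \<inter> V)"
  have Z: "open Z" "x \<in> Z" using U x s(1) sW(1) by (auto simp: Z_def)
  have c: "continuous_on Z (\<lambda>y. \<zeta> (s y))" "continuous_on Z (\<lambda>y. \<xi> (s y))"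
    using \<zeta> sW(3) unfolding square_root_on_def
    by (auto simp: Z_def intro!: continuous_on_compose2[OF _ continuous_on_subset[OF sW(2)]])
  have "\<forall>\<^sub>F y in nhds x. y \<in> Z \<and> (\<zeta> (s y) = \<xi> (s y) \<longleftrightarrow> \<zeta> (s x) = \<xi> (s x))"
  proof (rule square_roots_agree[OF Z c])
    fix y assume "y \<in> Z"
    then have y: "prj (s y) \<in> U" "prj (s y) \<in> V" using sW(3) by (auto simp: Z_def)
    then have "(\<zeta> (s y))\<^sup>2 = K (s y)" "(\<xi> (s y))\<^sup>2 = K (s y)" using \<zeta> by (auto simp: square_root_on_def)
    then show "(\<zeta> (s y))\<^sup>2 = (\<xi> (s y))\<^sup>2" "\<zeta> (s y) \<noteq> 0" using nz[of "s y"] by auto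
  qed
  then show ?thesis
  proof (rule eventually_mono)
    fix y assume y: "y \<in> Z \<and> (\<zeta> (s y) = \<xi> (s y) \<longleftrightarrow> \<zeta> (s x) = \<xi> (s x))"
    have "on_fibres \<zeta> y = on_fibres \<xi> y \<longleftrightarrow> \<zeta> (s y) = \<xi> (s y)" if "y \<in> Z" for y
      using on_fibres_eq_iff[OF \<zeta>, of "s y"] that sW(3)[of y] by (simp add: Z_def)
    with y Z(2) show "(on_fibres \<zeta> y = on_fibres \<xi> y) = (on_fibres \<zeta> x = on_fibres \<xi> x)" by simp
  qed
qed

lemma global_square_root:
  assumes sc: "simply_connected (UNIV :: 'm set)"
    and nz: "\<And>q. K q \<noteq> 0" and K: "\<And>q a. a \<noteq> 0 \<Longrightarrow> K (act q a) = of_real (inverse (a\<^sup>2)) * K q"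
    and cont: "\<And>U s. spinorial_frame A prj Lam U s \<Longrightarrow> continuous_on U (\<lambda>p. K (s p))"
  obtains \<zeta> where "square_root_on K UNIV \<zeta>"
proof -
  define S where "S = {(U, f). \<exists>\<zeta>. open U \<and> square_root_on K U \<zeta> \<and> f = on_fibres \<zeta>}"
  interpret local_system S
  proof
    fix U f assume f: "(U, f) \<in> S"
    then show "open U" by (auto simp: S_def)
    fix V h x assume h: "(V, h) \<in> S" and x: "x \<in> U" "x \<in> V"
    obtain \<zeta> \<xi> where \<zeta>: "open U" "square_root_on K U \<zeta>" "f = on_fibres \<zeta>"
      and \<xi>: "open V" "square_root_on K V \<xi>" "h = on_fibres \<xi>"
      using f h by (auto simp: S_def)
    show "\<forall>\<^sub>F y in nhds x. (f y = h y) = (f x = h x)"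
      unfolding \<zeta>(3) \<xi>(3) by (rule square_roots_agree_on_fibres[OF nz \<zeta>(1) \<xi>(1) \<zeta>(2) \<xi>(2) x])
  next
    fix x
    obtain U \<zeta> where U: "open U" "x \<in> U" and \<zeta>: "square_root_on K U \<zeta>"
      using local_square_root[OF nz K cont] by blast
    have "\<exists>f. (U, f) \<in> S \<and> f y = h y" if y: "y \<in> U" and h: "(V, h) \<in> S" "y \<in> V" for y V h
    proof -
      obtain \<xi> where \<xi>: "square_root_on K V \<xi>" "h = on_fibres \<xi>" using h(1) by (auto simp: S_def)
      obtain q where q: "prj q = y" using prj_surj by blast
      have "(\<zeta> q)\<^sup>2 = (\<xi> q)\<^sup>2" using \<zeta> \<xi>(1) y h(2) q by (simp add: square_root_on_def)
      then consider "\<zeta> q = \<xi> q" | "- \<zeta> q = \<xi> q" unfolding power2_eq_iff by force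
      then show ?thesis
      proof cases
        case 1
        then have "on_fibres \<zeta> y = h y" using on_fibres_eq_iff[OF \<zeta> \<xi>(1), of q] y h(2) q \<xi>(2) by simp
        then show ?thesis using U(1) \<zeta> by (auto simp: S_def)
      next
        case 2
        then have "on_fibres (\<lambda>q. - \<zeta> q) y = h y"
          using on_fibres_eq_iff[OF square_root_on_minus[OF \<zeta>] \<xi>(1), of q] y h(2) q \<xi>(2) by simp
        then show ?thesis using U(1) square_root_on_minus[OF \<zeta>] by (auto simp: S_def)
      qed
    qed
    then show "\<exists>U. open U \<and> x \<in> U \<and> (\<forall>y\<in>U. \<forall>V g. (V, g) \<in> S \<longrightarrow> y \<in> V \<longrightarrow> (\<exists>f. (U, f) \<in> S \<and> f y = g y))"
      using U by blast
  qed
  obtain U0 f0 x0 where "(U0, f0) \<in> S" "x0 \<in> U0" using local_square_root[OF nz K cont] unfolding S_def by blast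
  then obtain F where F: "\<And>x. \<exists>U f. (U, f) \<in> S \<and> x \<in> U \<and> (\<forall>\<^sub>F y in nhds x. F y = f y)"
    using global_section[OF sc surface_path_neighbourhood] by blast
  define \<zeta> where "\<zeta> = (\<lambda>q. F (prj q) q)"
  have loc: "\<exists>V \<xi>. open V \<and> p \<in> V \<and> square_root_on K V \<xi> \<and> (\<forall>q. prj q \<in> V \<longrightarrow> \<zeta> q = \<xi> q)" for p
  proof -
    obtain U \<xi> where U: "open U" "p \<in> U" "square_root_on K U \<xi>" "\<forall>\<^sub>F y in nhds p. F y = on_fibres \<xi> y"
      using F[of p] unfolding S_def by blast
    then obtain V where V: "open V" "p \<in> V" "\<And>y. y \<in> V \<Longrightarrow> F y = on_fibres \<xi> y" by (auto simp: eventually_nhds)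
    have "square_root_on K (U \<inter> V) \<xi>"
      using U(3) unfolding square_root_on_def by (auto intro: continuous_on_subset)
    moreover have "\<zeta> q = \<xi> q" if "prj q \<in> U \<inter> V" for q using V(3)[of "prj q"] that by (simp add: \<zeta>_def on_fibres_def)
    ultimately show ?thesis using U V by (intro exI[of _ "U \<inter> V"] exI[of _ \<xi>]) auto
  qed
  have "square_root_on K UNIV \<zeta>"
    unfolding square_root_on_def
  proof (intro conjI allI impI)
    show "continuous_on (prj -` UNIV) \<zeta>"
    proof (rule continuous_on_local)
      fix q
      obtain V \<xi> where V: "open V" "prj q \<in> V" "square_root_on K V \<xi>" "\<And>q. prj q \<in> V \<Longrightarrow> \<zeta> q = \<xi> q"
        using loc[of "prj q"] by blast
      have "continuous_on (prj -` V) \<zeta>"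
        by (rule continuous_on_eq[of _ \<xi>]) (use V in \<open>auto simp: square_root_on_def\<close>)
      then show "\<exists>T. open T \<and> q \<in> T \<and> continuous_on (prj -` UNIV \<inter> T) \<zeta>"
        using open_prj_vimage[OF V(1)] V(2) by (intro exI[of _ "prj -` V"]) simp
    qed
    fix q
    obtain V \<xi> where V: "prj q \<in> V" "square_root_on K V \<xi>" "\<And>q. prj q \<in> V \<Longrightarrow> \<zeta> q = \<xi> q"
      using loc[of "prj q"] by blast
    then show "(\<zeta> q)\<^sup>2 = K q" by (simp add: square_root_on_def)
    fix a :: real assume "a \<noteq> 0"
    then show "\<zeta> (act q a) = \<zeta> q / of_real a" using V by (simp add: square_root_on_def prj_act)
  qed
  then show thesis by (rule that)
qed

text \<open>The reflection is applied to the frame of \<open>F\<close>, not to \<open>F\<close> itself; the equations for the frame are linear and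
  therefore preserved.\<close>

theorem immersion_imp_spinor:
  assumes F: "isometric_immersion A g F" and N: "unit_normal_field A F N"
    and mc: "\<And>p. mean_curvature_vector A g F p = H p *\<^sub>R N p"
    and sc: "simply_connected (UNIV :: 'm set)"
  shows "\<exists>\<psi>. spinor_field A prj act Lam \<psi> \<and> dirac_equation A g prj Lam H \<psi> \<and>
            (\<forall>q. spinor_product (\<psi> q) (\<psi> q) = -1)"
proof -
  have Fs: "smooth_map A UNIV F" and Ns: "smooth_map A UNIV N"
    using F N by (auto simp: isometric_immersion_def unit_normal_field_def)
  define P0 Q0 where "P0 = (\<lambda>q. differential A F (prj q) (null_plus q))" and "Q0 = (\<lambda>q. differential A F (prj q) (null_minus q))"
  have dF: "differential A F p v = fd (F \<circ> chart_inv c) (chart_map c p) (v c)"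
    if "c \<in> A" "p \<in> dom_chart c" "v \<in> tangent_space A p" for p c v
    by (rule differential_smooth[OF Fs that(1) _ that(2,3)]) simp
  have lor0: "lor (P0 q) (P0 q) = 0" "lor (Q0 q) (Q0 q) = 0" "lor (P0 q) (Q0 q) = -2"
      "lor (N (prj q)) (P0 q) = 0" "lor (N (prj q)) (Q0 q) = 0" "lor (N (prj q)) (N (prj q)) = -1" for q
    using F N g_null[of q] null_tangent[of q]
    by (auto simp: P0_def Q0_def isometric_immersion_def unit_normal_field_def)
  have P0_act: "P0 (act q a) = inverse (a\<^sup>2) *\<^sub>R P0 q" if a: "a \<noteq> 0" for q a
  proof -
    obtain c where c: "c \<in> A" "prj q \<in> dom_chart c" using chart_around by blast
    have "linear (fd (F \<circ> chart_inv c) (chart_map c (prj q)))"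
      using smooth_map_has_derivative[OF Fs c(1) _ c(2)] has_derivative_linear by blast
    then show ?thesis
      using dF[OF c null_tangent(1)] dF[of c "prj q", OF c null_tangent(1)[of "act q a", unfolded prj_act[OF a]]]
      by (simp add: P0_def prj_act[OF a] null_act[OF a] linear_scale)
  qed
  have chart_PQ: "P0 (s (chart_inv c y)) = fd (F \<circ> chart_inv c) y (null_plus (s (chart_inv c y)) c)"
    "Q0 (s (chart_inv c y)) = fd (F \<circ> chart_inv c) y (null_minus (s (chart_inv c y)) c)"
    if s: "spinorial_frame A prj Lam U s" and c: "c \<in> A" and y: "y \<in> coords U c" for U s c y
    using dF[OF c coordsE(2)[OF c y]] coordsE[OF c y] spinorial_frameD(3)[OF s coordsE(1)[OF c y]]
      null_tangent[of "s (chart_inv c y)"] by (simp_all add: P0_def Q0_def)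
  have smooth_PQ: "smooth_map A U (\<lambda>p. P0 (s p))" "smooth_map A U (\<lambda>p. Q0 (s p))" if s: "spinorial_frame A prj Lam U s" for U s
  proof -
    have "smooth_on (coords U c) ((\<lambda>p. P0 (s p)) \<circ> chart_inv c) \<and> smooth_on (coords U c) ((\<lambda>p. Q0 (s p)) \<circ> chart_inv c)"
      if c: "c \<in> A" for c
    proof -
      interpret C: chart_frame "coords U c" "gram A g c" "e2c s c" "e3c s c" by (rule chart_frame[OF s c])
      have \<Phi>: "smooth_on (coords U c) (F \<circ> chart_inv c)"
        by (rule smooth_on_subset[OF smooth_map_coords[OF Fs c]]) (auto simp: coords_def)
      have sm: "smooth_on (coords U c) (\<lambda>y. fd (F \<circ> chart_inv c) y (Y y))" if Y: "smooth_on (coords U c) Y" for Y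
      proof -
        have "smooth_on (coords U c) (\<lambda>y. Y y $ 1 *\<^sub>R fd (F \<circ> chart_inv c) y (axis 1 1) + Y y $ 2 *\<^sub>R fd (F \<circ> chart_inv c) y (axis 2 1))"
          by (intro smooth_on_add smooth_on_scaleR smooth_on_vec_nth smooth_on_frechet_derivative C.Om \<Phi> Y)
        then show ?thesis
          by (rule smooth_on_cong[OF C.Om, rotated]) (rule fd_vec2[symmetric], rule smooth_on_differentiable[OF \<Phi>])
      qed
      show ?thesis
        using smooth_on_cong[OF C.Om _ sm[OF C.ep_smooth], of "(\<lambda>p. P0 (s p)) \<circ> chart_inv c"]
          smooth_on_cong[OF C.Om _ sm[OF C.em_smooth], of "(\<lambda>p. Q0 (s p)) \<circ> chart_inv c"]
        by (simp add: chart_PQ[OF s c] chart_null[OF s c])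
    qed
    then show "smooth_map A U (\<lambda>p. P0 (s p))" "smooth_map A U (\<lambda>p. Q0 (s p))"
      by (simp_all add: smooth_map_def coords_def[symmetric])
  qed
  have contP: "continuous_on U (\<lambda>p. P0 (s p))" if "spinorial_frame A prj Lam U s" for U s
    by (rule smooth_map_continuous[OF _ smooth_PQ(1)[OF that]]) (use that in \<open>simp add: spinorial_frame_def\<close>)
  have contN: "continuous_on U N" for U
    using smooth_map_continuous[OF open_UNIV Ns] continuous_on_subset by blast
  \<comment> \<open>The two signs by which the frame of \<open>F\<close> may differ from the frame of a spinor do not change along the
    surface.\<close>
  obtain \<eta> where \<eta>: "\<eta>\<^sup>2 = 1" "\<And>q. \<eta> * P0 q $ 3 > 0"
  proof (rule fibrewise_sign_constant[OF sc, of "\<lambda>q. P0 q $ 3"])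
    show "P0 q $ 3 \<noteq> 0" for q by (rule frame_signs[OF lor0(1,3,6,4)])
    show "continuous_on U (\<lambda>p. P0 (s p) $ 3)" if "spinorial_frame A prj Lam U s" for U s
      by (intro continuous_intros contP[OF that])
  qed (auto simp: P0_act)
  obtain \<epsilon> where \<epsilon>: "\<epsilon>\<^sup>2 = 1" "\<And>q. \<epsilon> * (N (prj q) $ 2 * P0 q $ 1 - N (prj q) $ 1 * P0 q $ 2) > 0"
  proof (rule fibrewise_sign_constant[OF sc, of "\<lambda>q. N (prj q) $ 2 * P0 q $ 1 - N (prj q) $ 1 * P0 q $ 2"])
    show "N (prj q) $ 2 * P0 q $ 1 - N (prj q) $ 1 * P0 q $ 2 \<noteq> 0" for q by (rule frame_signs[OF lor0(1,3,6,4)])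
    show "continuous_on U (\<lambda>p. N (prj (s p)) $ 2 * P0 (s p) $ 1 - N (prj (s p)) $ 1 * P0 (s p) $ 2)"
      if s: "spinorial_frame A prj Lam U s" for U s
    proof -
      have "continuous_on U (\<lambda>p. N p $ 2 * P0 (s p) $ 1 - N p $ 1 * P0 (s p) $ 2)"
        by (intro continuous_intros contP[OF s] contN)
      then show ?thesis by (rule continuous_on_eq) (simp add: spinorial_frameD(3)[OF s])
    qed
  qed (auto simp: P0_act prj_act algebra_simps)
  define R where "R = flip \<epsilon> \<eta>"
  define P Q n where "P = (\<lambda>q. R (P0 q))" and "Q = (\<lambda>q. R (Q0 q))" and "n = (\<lambda>p. R (N p))"
  have lorR: "lor (R u) (R v) = lor u v" for u v unfolding R_def by (rule lor_flip[OF \<epsilon>(1) \<eta>(1)])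
  have pos: "P q $ 3 > 0" "n (prj q) $ 2 * P q $ 1 - n (prj q) $ 1 * P q $ 2 > 0" for q
    using \<eta>(2)[of q] \<epsilon>(2)[of q] by (simp_all add: P_def n_def R_def algebra_simps)
  define K where "K = (\<lambda>q. Complex (P q $ 1) (P q $ 2))"
  have lorPQ: "lor (P q) (P q) = 0" "lor (Q q) (Q q) = 0" "lor (P q) (Q q) = -2"
      "lor (n (prj q)) (n (prj q)) = -1" "lor (n (prj q)) (P q) = 0" "lor (n (prj q)) (Q q) = 0" for q
    unfolding P_def Q_def n_def lorR by (rule lor0)+
  note to_spinor = frame_to_spinor[OF lorPQ pos, folded K_def[THEN fun_cong]]
  have Knz: "K q \<noteq> 0" for q
  proof
    assume "K q = 0"
    then have "(0::complex)\<^sup>2 = K q" by simp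
    from to_spinor(5)[OF this] show False by simp
  qed
  have Kact: "K (act q a) = of_real (inverse (a\<^sup>2)) * K q" if "a \<noteq> 0" for q a
  proof -
    define r where "r = inverse (a\<^sup>2)"
    have "P0 (act q a) = r *\<^sub>R P0 q" unfolding r_def by (rule P0_act[OF that])
    then show ?thesis unfolding r_def[symmetric] by (simp add: K_def P_def R_def flip_linear complex_eq_iff)
  qed
  have contK: "continuous_on U (\<lambda>p. K (s p))" if "spinorial_frame A prj Lam U s" for U s
    unfolding K_def P_def R_def Complex_eq flip_nth by (intro continuous_intros contP[OF that])
  obtain \<zeta> where \<zeta>: "square_root_on K UNIV \<zeta>"
    using global_square_root[OF sc Knz Kact contK] .
  have \<zeta>2: "(\<zeta> q)\<^sup>2 = K q" for q using \<zeta> by (simp add: square_root_on_def)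
  define w where "w = (\<lambda>q. (1 - \<i> * of_real (n (prj q) $ 3)) / cnj (\<zeta> q))"
  note sp = to_spinor[OF \<zeta>2, folded w_def[THEN fun_cong]]
  define \<psi> :: "'q \<Rightarrow> complex^2" where "\<psi> = (\<lambda>q. vector [\<zeta> q, w q])"
  have \<psi>12: "\<psi> q $ 1 = \<zeta> q" "\<psi> q $ 2 = w q" for q by (simp_all add: \<psi>_def)
  have \<psi>_smooth: "smooth_map A U (\<psi> \<circ> s)" if s: "spinorial_frame A prj Lam U s" for U s
    unfolding smooth_map_def coords_def[symmetric]
  proof
    fix c assume c: "c \<in> A"
    have O: "open (coords U c)" using s c by (auto intro: open_coords simp: spinorial_frame_def)
    have P0s: "smooth_on (coords U c) (\<lambda>y. P0 (s (chart_inv c y)))"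
      using smooth_map_coords[OF smooth_PQ(1)[OF s] c] by (simp add: o_def)
    have Ks: "smooth_on (coords U c) (\<lambda>y. K (s (chart_inv c y)))"
      unfolding K_def P_def R_def Complex_eq flip_nth
      by (intro smooth_on_add smooth_on_mult smooth_on_const smooth_on_Re_Im smooth_on_vec_nth O P0s)
    \<comment> \<open>Only continuity of the root is known; its smoothness is that of its square.\<close>
    have cs: "continuous_on (coords U c) (\<lambda>y. s (chart_inv c y))"
      by (rule continuous_on_compose2[OF spinorial_frameD(2)[OF s] continuous_chart_inv[OF c]]) (use coordsE(1)[OF c] in auto)
    have "continuous_on UNIV \<zeta>" using \<zeta> by (simp add: square_root_on_def)
    then have "continuous_on (coords U c) (\<lambda>y. \<zeta> (s (chart_inv c y)))"
      by (rule continuous_on_compose2[OF _ cs]) simp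
    then have z: "smooth_on (coords U c) (\<lambda>y. \<zeta> (s (chart_inv c y)))"
      by (rule continuous_root_smooth[OF O Ks Knz]) (rule \<zeta>2)
    have "smooth_on (coords U c) (N \<circ> chart_inv c)"
      by (rule smooth_on_subset[OF smooth_map_coords[OF Ns c]]) (auto simp: coords_def)
    then have n3: "smooth_on (coords U c) (\<lambda>y. n (chart_inv c y) $ 3)"
      unfolding n_def R_def flip_nth o_def by (intro smooth_on_mult smooth_on_const smooth_on_vec_nth O)
    have "smooth_on (coords U c) (\<lambda>y. (1 - \<i> * of_real (n (chart_inv c y) $ 3)) / cnj (\<zeta> (s (chart_inv c y))))"
      by (intro smooth_on_divide smooth_on_diff smooth_on_mult smooth_on_const smooth_on_Re_Im O n3 z) (simp add: sp(5))
    then have w: "smooth_on (coords U c) (\<lambda>y. w (s (chart_inv c y)))"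
      by (rule smooth_on_cong[OF O, rotated]) (simp add: w_def spinorial_frameD(3)[OF s coordsE(1)[OF c]])
    show "smooth_on (coords U c) (\<psi> \<circ> s \<circ> chart_inv c)"
    proof (rule smooth_on_vec[OF O])
      fix i :: 2
      show "smooth_on (coords U c) (\<lambda>x. (\<psi> \<circ> s \<circ> chart_inv c) x $ i)"
        using exhaust_2[of i] z w by (auto simp: \<psi>12)
    qed
  qed
  have "spinor_field A prj act Lam \<psi>"
    unfolding spinor_field_def
  proof (intro conjI allI impI \<psi>_smooth)
    fix q and a :: real assume a: "a \<noteq> 0"
    have "\<zeta> (act q a) = \<zeta> q / of_real a" using \<zeta> a by (simp add: square_root_on_def)
    moreover from this have "w (act q a) = of_real a * w q" using a by (simp add: w_def prj_act)
    ultimately show "\<psi> (act q a) = spin_rep (inverse a) *v \<psi> q"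
      by (simp add: vec_eq_iff forall_2 \<psi>12 spin_rep_def matrix_vector_mult_def sum_2 divide_inverse mult.commute)
  qed
  moreover have "spinor_product (\<psi> q) (\<psi> q) = -1" for q
    unfolding spinor_product_self \<psi>12 using sp(4)[of q] by simp
  moreover have "dirac_equation A g prj Lam H \<psi>"
    unfolding dirac_equation_def
  proof (intro allI impI ballI)
    fix U s p assume s: "spinorial_frame A prj Lam U s" and p: "p \<in> U"
    define c where "c = chart_at A p"
    have c: "c \<in> A" "p \<in> dom_chart c" using chart_at by (auto simp: c_def)
    define x where "x = chart_map c p"
    have x: "x \<in> coords U c" "chart_inv c x = p" using coordsI[OF p c(2)] by (simp_all add: x_def chart_inv c)
    have O: "open (coords U c)" using s c by (auto intro: open_coords simp: spinorial_frame_def)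
    have prs: "prj (s p) = p" by (rule spinorial_frameD(3)[OF s p])
    define Pc Qc where "Pc = (\<lambda>y. P0 (s (chart_inv c y)))" and "Qc = (\<lambda>y. Q0 (s (chart_inv c y)))"
    have PQs: "smooth_on (coords U c) Pc" "smooth_on (coords U c) Qc"
      using smooth_PQ[OF s] smooth_map_coords[OF _ c(1)] by (auto simp: Pc_def Qc_def o_def)
    define \<Phi> where "\<Phi> = F \<circ> chart_inv c"
    have fdPQ: "fd (\<lambda>y. fd \<Phi> y (null_plus (s (chart_inv c y)) c)) x = fd Pc x"
      "fd (\<lambda>y. fd \<Phi> y (null_minus (s (chart_inv c y)) c)) x = fd Qc x"
      by (rule fd_eqI, rule has_derivative_transform_within_open[OF smooth_on_has_derivative[OF PQs(1) x(1)] O x(1)],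
          simp add: Pc_def \<Phi>_def chart_PQ[OF s c(1)])
        (rule fd_eqI, rule has_derivative_transform_within_open[OF smooth_on_has_derivative[OF PQs(2) x(1)] O x(1)],
          simp add: Qc_def \<Phi>_def chart_PQ[OF s c(1)])
    have atx: "fd \<Phi> x (null_plus (s p) c) = Pc x" "fd \<Phi> x (null_minus (s p) c) = Qc x"
      using chart_PQ[OF s c(1) x(1)] by (simp_all add: Pc_def Qc_def \<Phi>_def x(2))
    have II: "II (gram A g c) \<Phi> x (null_plus (s p) c) (null_minus (s p) c) = (- 2 * H p) *\<^sub>R N p"
    proof -
      define X where "X = II (gram A g c) \<Phi> x (null_plus (s p) c) (null_minus (s p) c)"
      have m: "- (1/2) *\<^sub>R X = H p *\<^sub>R N p"
        using mean_curvature_frame[OF s p Fs] mc[of p] unfolding X_def c_def \<Phi>_def x_def by simp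
      have "X = (-2) *\<^sub>R (- (1/2) *\<^sub>R X)" by simp
      then have "X = (- 2 * H p) *\<^sub>R N p" unfolding m by simp
      then show ?thesis by (simp only: X_def)
    qed
    note gf = gauss_formula[OF s c(1) p c(2) Fs, folded \<Phi>_def x_def, unfolded x(2) fdPQ atx]
    have G1: "fd Qc x (null_plus (s p) c) + omega s c p (null_plus (s p) c) *\<^sub>R Qc x = (- 2 * H p) *\<^sub>R N p"
      using gf(1) II by simp
    have G2: "fd Pc x (null_minus (s p) c) - omega s c p (null_minus (s p) c) *\<^sub>R Pc x = (- 2 * H p) *\<^sub>R N p"
      using gf(2) gf(3)[of "null_plus (s p) c" "null_minus (s p) c"] II by simp
    have fr: "frame_plus (\<zeta> (s (chart_inv c y))) = R (Pc y)" "frame_minus (w (s (chart_inv c y))) = R (Qc y)" for y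
      using sp(1,2)[of "s (chart_inv c y)"] by (simp_all add: P_def Q_def Pc_def Qc_def)
    have bR: "bounded_linear R" unfolding R_def by (rule bounded_linear_flip)
    have fdR: "fd (\<lambda>y. R (Pc y)) x = (\<lambda>v. R (fd Pc x v))" "fd (\<lambda>y. R (Qc y)) x = (\<lambda>v. R (fd Qc x v))"
      by (rule fd_eqI[OF bounded_linear.has_derivative[OF bR smooth_on_has_derivative[OF PQs(1) x(1)]]],
          rule fd_eqI[OF bounded_linear.has_derivative[OF bR smooth_on_has_derivative[OF PQs(2) x(1)]]])
    have nrm: "frame_normal (\<zeta> (s p)) (w (s p)) = R (N p)" using sp(3)[of "s p"] by (simp add: n_def prs)
    show "dirac A g Lam s \<psi> p = (\<i> * of_real (H p)) *s \<psi> (s p)"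
    proof -
      have G1': "R (fd Qc x (null_plus (s p) c)) + omega s c p (null_plus (s p) c) *\<^sub>R R (Qc x) = (- 2 * H p) *\<^sub>R R (N p)"
        using arg_cong[OF G1, of R] unfolding R_def flip_linear .
      have G2': "R (fd Pc x (null_minus (s p) c)) - omega s c p (null_minus (s p) c) *\<^sub>R R (Pc x) = (- 2 * H p) *\<^sub>R R (N p)"
        using arg_cong[OF G2, of R] unfolding R_def flip_linear .
      have 1: "fd (\<lambda>y. frame_minus (\<psi> (s (chart_inv c y)) $ 2)) x (null_plus (s p) c) +
          omega s c p (null_plus (s p) c) *\<^sub>R frame_minus (\<psi> (s (chart_inv c x)) $ 2)
          = (- 2 * H p) *\<^sub>R frame_normal (\<psi> (s (chart_inv c x)) $ 1) (\<psi> (s (chart_inv c x)) $ 2)"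
        unfolding \<psi>12 fr fdR unfolding x(2) nrm by (rule G1')
      have 2: "fd (\<lambda>y. frame_plus (\<psi> (s (chart_inv c y)) $ 1)) x (null_minus (s p) c) -
          omega s c p (null_minus (s p) c) *\<^sub>R frame_plus (\<psi> (s (chart_inv c x)) $ 1)
          = (- 2 * H p) *\<^sub>R frame_normal (\<psi> (s (chart_inv c x)) $ 1) (\<psi> (s (chart_inv c x)) $ 2)"
        unfolding \<psi>12 fr fdR unfolding x(2) nrm by (rule G2')
      have nz: "\<psi> (s (chart_inv c x)) $ 1 \<noteq> 0" "\<psi> (s (chart_inv c x)) $ 2 \<noteq> 0"
        unfolding \<psi>12 by (rule sp(5), rule sp(6))
      show ?thesis
        using dirac_iff_gauss[OF s c(1) p c(2) \<psi>_smooth[OF s], folded x_def, OF nz, of "H p"] 1 2 by blast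
    qed
  qed
  ultimately show ?thesis by blast
qed

end

theorem mainTheorem4:
  fixes A :: "'m::{t2_space, second_countable_topology} chart set"
    and g :: "'m metric"
    and T :: "'m \<Rightarrow> 'm tangent"
    and prj :: "'q::topological_space \<Rightarrow> 'm"
    and act :: "'q \<Rightarrow> real \<Rightarrow> 'q"
    and Lam :: "'q \<Rightarrow> 'm tangent \<times> 'm tangent"
    and H :: "'m \<Rightarrow> real"
  assumes "oriented_atlas A"
    and "lorentzian_metric A g"
    and "time_orientation A g T"
    and "simply_connected (UNIV :: 'm set)"
    and "spin_structure A g T prj act Lam"
    and "smooth_map A UNIV H"
  shows "(\<exists>\<psi>. spinor_field A prj act Lam \<psi> \<and> dirac_equation A g prj Lam H \<psi> \<and>
            (\<forall>q. spinor_product (\<psi> q) (\<psi> q) = -1)) \<longleftrightarrow>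
         (\<exists>F. isometric_immersion A g F \<and>
            (\<exists>N. unit_normal_field A F N \<and>
               (\<forall>p. mean_curvature_vector A g F p = H p *\<^sub>R N p)))"
proof -
  interpret spin_surface A g T prj act Lam
    by unfold_locales (use assms in \<open>auto simp: oriented_atlas_def\<close>)
  show ?thesis
    using spinor_imp_immersion immersion_imp_spinor assms(4) by meson
qed

end
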